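(* For an integer $n\ge 3$, let $m(n)$ denote the minimum of $p_3(\mathcal{A})$ over all simple, digon-free, pairwise intersecting arrangements $\mathcal{A}$ of $n$ pseudocircles. Then: (i) $m(n)=8$ for $3\le n\le 6$; (ii) $m(n)=\lceil \tfrac{4}{3}n\rceil$ for $6\le n\le 14$; (iii) $m(n)<\tfrac{16}{11}n$ for every $n$ of the form $n=11k+1$ with $k\in\mathbb{N}$, $k\ge 1$.
   Context: A pseudocircle is a simple closed curve on the sphere (or in the plane). An arrangement of pseudocircles is a finite collection of pseudocircles such that any two of them are either disjoint or intersect in exactly two points, at which they cross. It is simple if no three pseudocircles pass through a common point, and pairwise intersecting if every two of its pseudocircles intersect. The arrangement decomposes the sphere into cells; a $k$-cell is a cell with $k$ crossings on its boundary. $2$-cells are called digons and $3$-cells triangles; $p_k(\mathcal{A})$ denotes the number of $k$-cells of $\mathcal{A}$ (counted on the sphere). An arrangement is digon-free if it has no digon. *)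

theory Defs
  imports "HOL-Analysis.Analysis"
begin

text \<open>Arrangements are drawn in the plane (complex numbers); cells are the connected
  components of the complement of the union, including the unbounded one, so counts
  agree with counts on the sphere (via stereographic projection).\<close>

definition pseudocircle :: "complex set \<Rightarrow> bool" where
  "pseudocircle C \<longleftrightarrow> (\<exists>g::real \<Rightarrow> complex. simple_path g \<and> pathfinish g = pathstart g \<and> path_image g = C)"

definition cross_twice :: "complex set \<Rightarrow> complex set \<Rightarrow> bool" where
  "cross_twice C D \<longleftrightarrow> card (C \<inter> D) = 2 \<and> D \<inter> inside C \<noteq> {} \<and> D \<inter> outside C \<noteq> {}"

definition arrangement :: "complex set set \<Rightarrow> bool" where
  "arrangement A \<longleftrightarrow> finite A \<and> (\<forall>C\<in>A. pseudocircle C) \<and>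
     (\<forall>C\<in>A. \<forall>D\<in>A. C \<noteq> D \<longrightarrow> C \<inter> D = {} \<or> cross_twice C D)"

definition simple_arr :: "complex set set \<Rightarrow> bool" where
  "simple_arr A \<longleftrightarrow> (\<forall>C\<in>A. \<forall>D\<in>A. \<forall>E\<in>A. C \<noteq> D \<and> C \<noteq> E \<and> D \<noteq> E \<longrightarrow> C \<inter> D \<inter> E = {})"

definition pairwise_intersecting :: "complex set set \<Rightarrow> bool" where
  "pairwise_intersecting A \<longleftrightarrow> (\<forall>C\<in>A. \<forall>D\<in>A. C \<noteq> D \<longrightarrow> C \<inter> D \<noteq> {})"

definition crossings :: "complex set set \<Rightarrow> complex set" where
  "crossings A = \<Union>{C \<inter> D | C D. C \<in> A \<and> D \<in> A \<and> C \<noteq> D}"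

definition cells :: "complex set set \<Rightarrow> complex set set" where
  "cells A = components (- \<Union>A)"

definition num_kcells :: "nat \<Rightarrow> complex set set \<Rightarrow> nat" where
  "num_kcells k A = card {F \<in> cells A. card (frontier F \<inter> crossings A) = k}"

definition digon_free :: "complex set set \<Rightarrow> bool" where
  "digon_free A \<longleftrightarrow> num_kcells 2 A = 0"

definition admissible :: "nat \<Rightarrow> complex set set \<Rightarrow> bool" where
  "admissible n A \<longleftrightarrow> arrangement A \<and> card A = n \<and> simple_arr A \<and>
     pairwise_intersecting A \<and> digon_free A"

definition min_triangles :: "nat \<Rightarrow> nat" where
  "min_triangles n = Inf {num_kcells 3 A | A. admissible n A}"

end

theory Submission
  imports Defs
begin

text \<open>
  Lower bounds. An arrangement has \<open>V = n (n - 1)\<close> crossings, each a corner of at most four cells, and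
  at least \<open>V + 2\<close> cells, each with at least three corners. Hence the sum of \<open>4 - k\<close> over the cells, \<open>k\<close>
  being the number of corners, is at least \<open>8\<close>, and only triangles contribute positively. For \<open>4 n / 3\<close>,
  cut a pseudocircle \<open>C\<close> at a noncrossing point; the other pseudocircles are chords of either side of \<open>C\<close>.
  From every chord end follow the chord to its first crossing. If no triangle had an edge on \<open>C\<close>, two
  chord ends could be found whose first crossing chords are forced by planarity to meet three times. So
  each side contains a triangle with an edge on \<open>C\<close> away from the cut, and recutting inside that edge gives
  a second one. Thus \<open>C\<close> has four triangles along it, while a triangle lies along at most three
  pseudocircles.

  Upper bounds. A closed word of adjacent transpositions of \<open>n\<close> strands in which every ordered pair of
  strands crosses exactly once, drawn on a cylinder, is an arrangement. Its bounded cells other than the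
  innermost one lie between two consecutive transpositions at the same level, and the corners are these
  two and the transpositions at the neighbouring levels in between. Explicit words settle \<open>n \<le> 14\<close>. For
  the infinite family, one strand is replaced by a bundle of twelve strands that cross each other in a
  short block placed at an edge of a triangle: this adds eleven pseudocircles and sixteen triangles.
\<close>

section \<open>Crosscuts of a Jordan curve\<close>

text \<open>Cells are given only as components of a complement and corners only as frontier points,
  so there is no embedded graph to which Euler's formula could be applied. Both halves therefore
  rest on one-sided estimates. For the lower bounds, cells are counted by adding arcs to a connected
  set, each of which splits a region; only the region found along a pseudocircle has to be
  identified as a cell with exactly known frontier. For the upper bounds it suffices to bound the
  corners of each cell from below, and no frontier is ever computed. The two lower bounds agree at
  \<open>n = 6\<close>, which is why both ranges contain it. Cutting a pseudocircle turns a cyclic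
  order into the order of the reals. A crossed chord may then lie wholly on one side of the end it
  was reached from, and its far end has to count as lying beyond the cut; hence the values
  \<open>-1\<close> and \<open>2\<close> outside the parameter interval in the chord argument. A
  bundle of twelve strands by itself would add seventeen triangles. It also puts a further corner on
  one triangle of the host, which brings the increase down to sixteen and the total for
  \<open>n = 11 k + 1\<close> to \<open>16 k\<close>, just below \<open>16 n / 11\<close>.\<close>

lemma Jordan_sides:
  fixes g :: "real \<Rightarrow> complex"
  assumes "simple_path g" "pathfinish g = pathstart g" "S = inside (path_image g) \<or> S = outside (path_image g)"
  shows "open S" "connected S" "S \<noteq> {}" "S \<inter> path_image g = {}" "frontier S = path_image g"
    "S \<in> components (- path_image g)"
proof -
  note J = Jordan_inside_outside[OF assms(1,2)]
  show o: "open S" and c: "connected S" and ne: "S \<noteq> {}" and d: "S \<inter> path_image g = {}" and f: "frontier S = path_image g"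
    using J assms(3) inside_no_overlap[of "path_image g"] outside_no_overlap[of "path_image g"] by (auto simp: Int_commute)
  have "closed (path_image g)" using assms(1) by (simp add: closed_simple_path_image)
  show "S \<in> components (- path_image g)"
    using assms(3)
  proof
    assume "S = inside (path_image g)" then show ?thesis using J by (simp add: inside_in_components)
  next
    assume "S = outside (path_image g)" then show ?thesis using J by (simp add: outside_in_components)
  qed
qed

lemma connected_sandwich:
  fixes g :: "real \<Rightarrow> complex"
  assumes "connected D" "D \<inter> K = {}" "K = path_image g" "simple_path g" "pathfinish g = pathstart g"
  shows "D \<subseteq> inside K \<or> D \<subseteq> outside K"
proof -
  note J = Jordan_inside_outside[OF assms(4,5), folded assms(3)]
  have D: "D \<subseteq> inside K \<union> outside K" using J assms(2) by auto
  have "inside K \<inter> D = {} \<or> outside K \<inter> D = {}"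
    by (rule connectedD[OF assms(1)]) (use J D in auto)
  then show ?thesis using D by blast
qed

lemma other_side:
  assumes "S = inside K \<or> S = outside K"
  obtains S' where "S' = inside K \<or> S' = outside K" "S' \<inter> S = {}" "S \<union> S' = - K"
  using assms
proof
  assume "S = inside K" then show thesis
    using that[of "outside K"] by (simp add: Int_commute)
next
  assume "S = outside K" then show thesis
    using that[of "inside K"] by (simp add: Un_commute)
qed

text \<open>\<open>X\<close> is the side of the Jordan curve formed by \<open>c1\<close> and
  \<open>c\<close> on which the interior of \<open>c2\<close> lies. The opposite side of the
  original curve accumulates at \<open>c2\<close>, hence lies in \<open>X\<close>, and this forces
  \<open>Y\<close> into \<open>S\<close>. Connectedness of \<open>S \<inter> X\<close> is
  Janiszewski's theorem: the two closed curves share exactly the arc \<open>c1\<close>.\<close>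

lemma crosscut_region:
  fixes c1 c2 c :: "real \<Rightarrow> complex"
  assumes arcs: "arc c1" "arc c2" "arc c"
    and ends: "pathstart c1 = a" "pathfinish c1 = b" "pathstart c2 = a" "pathfinish c2 = b"
      "pathstart c = a" "pathfinish c = b"
    and c12: "path_image c1 \<inter> path_image c2 = {a,b}"
    and S: "S = inside (path_image c1 \<union> path_image c2) \<or> S = outside (path_image c1 \<union> path_image c2)"
    and cS: "path_image c - {a,b} \<subseteq> S"
  obtains X Y where "connected Y" "open Y" "Y \<noteq> {}" "Y \<subseteq> S" "X \<inter> Y = {}" "open X"
    "path_image c2 - {a,b} \<subseteq> X" "frontier Y = path_image c1 \<union> path_image c"
    "X \<union> Y = - (path_image c1 \<union> path_image c)" "connected (S \<inter> X)"
    "\<And>x y. x \<in> S \<inter> X \<Longrightarrow> y \<in> S \<inter> X \<Longrightarrow> connected_component (S - path_image c) x y"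
proof -
  let ?C = "path_image c1 \<union> path_image c2"
  let ?J = "path_image c1 \<union> path_image c"
  let ?g = "c1 +++ reversepath c2" let ?j = "c1 +++ reversepath c"
  have ab: "a \<noteq> b" using arcs(1) ends arc_distinct_ends by metis
  have g: "simple_path ?g" "pathfinish ?g = pathstart ?g" "path_image ?g = ?C"
    using arcs ends c12 by (auto intro!: simple_path_join_loop simp: path_image_join arc_reversepath)
  have Cfacts: "S \<inter> ?C = {}" "open S" "connected S" "frontier S = ?C" "S \<in> components (- ?C)"
    using Jordan_sides[OF g(1,2), unfolded g(3), OF S] by auto
  have abin: "a \<in> path_image c" "b \<in> path_image c" "a \<in> path_image c1" "b \<in> path_image c1" "a \<in> path_image c2" "b \<in> path_image c2"
    using ends pathstart_in_path_image pathfinish_in_path_image by metis+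
  have cC: "path_image c \<inter> ?C = {a,b}"
    using cS Cfacts(1) abin by blast
  have c1c: "path_image c1 \<inter> path_image c = {a,b}"
    using cC abin by blast
  have c2c: "path_image c2 \<inter> path_image c = {a,b}"
    using cC abin by blast
  have j: "simple_path ?j" "pathfinish ?j = pathstart ?j" "path_image ?j = ?J"
    using arcs ends c1c by (auto intro!: simple_path_join_loop simp: path_image_join arc_reversepath)
  note J = Jordan_inside_outside[OF j(1,2), unfolded j(3)]
  have c2con: "connected (path_image c2 - {a,b})"
    using connected_simple_path_endless[of c2] arcs ends by (simp add: arc_simple_path)
  have c2disj: "(path_image c2 - {a,b}) \<inter> ?J = {}" using c12 c2c by blast
  have c2in: "path_image c2 - {a,b} \<subseteq> inside ?J \<or> path_image c2 - {a,b} \<subseteq> outside ?J"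
    using connected_sandwich[OF c2con c2disj j(3)[symmetric] j(1,2)] .
  obtain X Y where XY: "(X = inside ?J \<and> Y = outside ?J) \<or> (X = outside ?J \<and> Y = inside ?J)"
    and c2X: "path_image c2 - {a,b} \<subseteq> X" using c2in by blast
  have Xf: "open X" "connected X" "open Y" "connected Y" "Y \<noteq> {}" "X \<noteq> {}" "X \<inter> Y = {}" "X \<union> Y = - ?J"
     "frontier Y = ?J" "frontier X = ?J"
    using XY J by (blast | metis)+
  \<comment> \<open>the other side of the Jordan curve cannot meet Y, because it accumulates at the interior of c2\<close>
  note JC = Jordan_inside_outside[OF g(1,2), unfolded g(3)]
  obtain S' where S': "S' = inside ?C \<or> S' = outside ?C" "S' \<inter> S = {}" "S \<union> S' = - ?C"
    using other_side[OF S] by metis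
  have S'f: "open S'" "connected S'" "S' \<inter> ?C = {}" "frontier S' = ?C"
    using Jordan_sides[OF g(1,2), unfolded g(3), OF S'(1)] by auto
  have S'J: "S' \<inter> ?J = {}" using S'(2) S'f(3) cS abin by auto
  have "S' \<subseteq> X \<or> S' \<subseteq> Y" using connected_sandwich[OF S'f(2) S'J j(3)[symmetric] j(1,2)] XY by metis
  have c2ne: "path_image c2 - {a,b} \<noteq> {}"
    using nonempty_simple_path_endless[of c2] arcs ends by (simp add: arc_simple_path)
  then obtain z where z: "z \<in> path_image c2 - {a,b}" by blast
  have "z \<in> closure S'" using z S'f(4) by (metis DiffD1 UnI2 closure_Un_frontier)
  then have "S' \<inter> X \<noteq> {}" using Xf(1) z c2X
    by (metis open_Int_closure_eq_empty Int_commute disjoint_iff subsetD)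
  then have S'X: "S' \<subseteq> X" using \<open>S' \<subseteq> X \<or> S' \<subseteq> Y\<close> Xf(7) by blast
  have YS: "Y \<subseteq> S"
  proof -
    have "Y \<inter> ?C = {}" using c2X Xf(7,8) abin by blast
    then show ?thesis using S'X Xf(7) S'(3) by blast
  qed
  have *: "connected_component (S - path_image c) x y" if "x \<in> S \<inter> X" "y \<in> S \<inter> X" for x y
  proof -
    have 1: "connected_component (- ?C) x y"
      unfolding connected_component_def using that Cfacts(1,3) by blast
    have 2: "connected_component (- ?J) x y"
      unfolding connected_component_def using that Xf(2,8) by blast
    have "?C \<inter> ?J = path_image c1" using cC abin by blast
    then have "connected (?C \<inter> ?J)" using arcs by (simp add: connected_arc_image)
    then have "connected_component (- (?C \<union> ?J)) x y"
      using Janiszewski[of ?C ?J x y] 1 2 arcs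
      by (simp add: compact_Un compact_arc_image closed_Un closed_arc_image)
    then obtain T where T: "connected T" "T \<subseteq> - (?C \<union> ?J)" "x \<in> T" "y \<in> T"
      unfolding connected_component_def by blast
    have "T \<subseteq> S" using components_maximal[OF Cfacts(5) T(1)] T that by blast
    then show ?thesis unfolding connected_component_def using T by blast
  qed
  have "connected (S \<inter> X)"
  proof -
    have "connected_component (S \<inter> X) x y" if xy: "x \<in> S \<inter> X" "y \<in> S \<inter> X" for x y
    proof -
      obtain T where T: "connected T" "T \<subseteq> S - path_image c" "x \<in> T" "y \<in> T"
        using *[OF xy] unfolding connected_component_def by blast
      have TJ: "T \<inter> ?J = {}" using T(2) Cfacts(1) by blast
      have "T \<subseteq> X \<or> T \<subseteq> Y" using connected_sandwich[OF T(1) TJ j(3)[symmetric] j(1,2)] XY by metis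
      then have "T \<subseteq> X" using T(3) xy(1) Xf(7) by blast
      then have "T \<subseteq> S \<inter> X" using T(2) by blast
      then show ?thesis unfolding connected_component_def using T(1,3,4) by blast
    qed
    then show ?thesis by (simp add: connected_iff_connected_component)
  qed
  then show thesis using that[OF Xf(4,3,5) YS Xf(7,1) c2X Xf(9,8) _ *] by blast
qed

text \<open>The previous lemma, applied once at \<open>c1\<close> and once at \<open>c2\<close>,
  yields both frontiers. It remains to see that the piece \<open>Y'\<close> found at
  \<open>c2\<close> is the remainder \<open>S \<inter> X\<close> left at \<open>c1\<close>:
  connectedness allows only nested positions, and \<open>Y = Y'\<close> is excluded by the different
  frontiers.\<close>

lemma crosscut:
  fixes c1 c2 c :: "real \<Rightarrow> complex"
  assumes arcs: "arc c1" "arc c2" "arc c"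
    and ends: "pathstart c1 = a" "pathfinish c1 = b" "pathstart c2 = a" "pathfinish c2 = b"
      "pathstart c = a" "pathfinish c = b"
    and c12: "path_image c1 \<inter> path_image c2 = {a,b}"
    and S: "S = inside (path_image c1 \<union> path_image c2) \<or> S = outside (path_image c1 \<union> path_image c2)"
    and cS: "path_image c - {a,b} \<subseteq> S"
  obtains D1 D2 where "open D1" "open D2" "connected D1" "connected D2" "D1 \<noteq> {}" "D2 \<noteq> {}" "D1 \<inter> D2 = {}"
    "D1 \<union> D2 = S - path_image c"
    "frontier D1 = path_image c1 \<union> path_image c" "frontier D2 = path_image c2 \<union> path_image c"
proof -
  obtain X Y where XY: "connected Y" "open Y" "Y \<noteq> {}" "Y \<subseteq> S" "X \<inter> Y = {}" "open X"
    "path_image c2 - {a,b} \<subseteq> X" "frontier Y = path_image c1 \<union> path_image c"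
    "X \<union> Y = - (path_image c1 \<union> path_image c)" "connected (S \<inter> X)"
    using crosscut_region[OF assms] by metis
  have c21: "path_image c2 \<inter> path_image c1 = {a,b}" using c12 by blast
  have S': "S = inside (path_image c2 \<union> path_image c1) \<or> S = outside (path_image c2 \<union> path_image c1)"
    using S by (simp add: Un_commute)
  obtain X' Y' where XY': "connected Y'" "open Y'" "Y' \<noteq> {}" "Y' \<subseteq> S" "X' \<inter> Y' = {}" "open X'"
    "path_image c1 - {a,b} \<subseteq> X'" "frontier Y' = path_image c2 \<union> path_image c"
    "X' \<union> Y' = - (path_image c2 \<union> path_image c)" "connected (S \<inter> X')"
    using crosscut_region[OF arcs(2,1,3) ends(3,4,1,2,5,6) c21 S' cS] by metis
  let ?g = "c1 +++ reversepath c2"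
  have g: "simple_path ?g" "pathfinish ?g = pathstart ?g" "path_image ?g = path_image c1 \<union> path_image c2"
    using arcs ends c12 by (auto intro!: simple_path_join_loop simp: path_image_join arc_reversepath)
  have SC: "S \<inter> (path_image c1 \<union> path_image c2) = {}" "open S"
    using Jordan_sides[OF g(1,2), unfolded g(3), OF S] by auto
  have p1: "Y \<union> (S \<inter> X) = S - path_image c" using XY SC by blast
  have p2: "Y' \<union> (S \<inter> X') = S - path_image c" using XY' SC by blast
  have oSX: "open (S \<inter> X)" "open (S \<inter> X')" using XY XY' SC by auto
  have c2ne: "path_image c2 - {a,b} \<noteq> {}" "path_image c1 - {a,b} \<noteq> {}"
    using nonempty_simple_path_endless[of c2] nonempty_simple_path_endless[of c1] arcs ends by (simp_all add: arc_simple_path)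
  have cc: "path_image c2 \<inter> path_image c \<subseteq> {a,b}" using cS SC by blast
  have neq: "Y \<noteq> Y'" using XY(8) XY'(8) c2ne c12 cc by blast
  have split: "T \<subseteq> A \<or> T \<subseteq> B" if "connected T" "open A" "open B" "A \<inter> B = {}" "T \<subseteq> A \<union> B" for T A B :: "complex set"
  proof -
    have "A \<inter> T = {} \<or> B \<inter> T = {}" by (rule connectedD[OF that(1-3)]) (use that in auto)
    then show ?thesis using that by blast
  qed
  have d: "Y \<inter> (S \<inter> X) = {}" "Y' \<inter> (S \<inter> X') = {}" using XY(5) XY'(5) by auto
  have "Y' \<subseteq> Y \<or> Y' \<subseteq> S \<inter> X"
    by (rule split[OF XY'(1) XY(2) oSX(1) d(1)]) (use p1 p2 in auto)
  moreover have "\<not> Y' \<subseteq> Y"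
  proof
    assume l: "Y' \<subseteq> Y"
    have "Y \<subseteq> Y' \<or> Y \<subseteq> S \<inter> X'"
      by (rule split[OF XY(1) XY'(2) oSX(2) d(2)]) (use p1 p2 in auto)
    then show False using l neq XY'(3,5) by blast
  qed
  moreover have "S \<inter> X \<subseteq> Y' \<or> S \<inter> X \<subseteq> S \<inter> X'"
    by (rule split[OF XY(10) XY'(2) oSX(2) d(2)]) (use p1 p2 in auto)
  ultimately have Y': "Y' = S \<inter> X"
    using XY'(3,5) by blast
  show thesis
  proof (rule that[of Y Y'])
    show "Y \<inter> Y' = {}" "Y \<union> Y' = S - path_image c" using Y' d p1 by auto
  qed (use XY XY' in auto)
qed

section \<open>Chords of a disc\<close>

lemma closed_path_split:
  fixes g :: "real \<Rightarrow> complex"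
  assumes g: "simple_path g" "pathfinish g = pathstart g" and t: "0 < t1" "t1 < t2" "t2 < 1"
  obtains c1 c2 where "arc c1" "arc c2" "pathstart c1 = g t1" "pathfinish c1 = g t2"
    "pathstart c2 = g t1" "pathfinish c2 = g t2"
    "path_image c1 = g ` {t1..t2}" "path_image c2 = g ` ({0..t1} \<union> {t2..1})"
    "path_image c1 \<inter> path_image c2 = {g t1, g t2}" "path_image c1 \<union> path_image c2 = path_image g"
proof -
  have inj: "\<And>x y. 0 \<le> x \<Longrightarrow> x \<le> 1 \<Longrightarrow> 0 \<le> y \<Longrightarrow> y \<le> 1 \<Longrightarrow> g x = g y \<Longrightarrow> x = y \<or> x = 0 \<and> y = 1 \<or> x = 1 \<and> y = 0"
    using g(1) unfolding simple_path_def loop_free_def by auto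
  have g01: "g 1 = g 0" using g(2) by (simp add: pathstart_def pathfinish_def)
  define c1 where "c1 = subpath t1 t2 g"
  define c2 where "c2 = reversepath (subpath t2 1 g +++ subpath 0 t1 g)"
  have a1: "arc c1" unfolding c1_def using g t by (intro arc_simple_path_subpath_interior) auto
  have neq: "g t2 \<noteq> g 1" "g 0 \<noteq> g t1" using inj[of t2 1] inj[of 0 t1] t by auto
  have s1: "arc (subpath t2 1 g)" "arc (subpath 0 t1 g)"
    using g t neq by (auto intro!: arc_simple_path_subpath)
  have i1: "path_image (subpath t2 1 g) = g ` {t2..1}" "path_image (subpath 0 t1 g) = g ` {0..t1}"
    using t by (auto simp: path_image_subpath)
  have "arc (subpath t2 1 g +++ subpath 0 t1 g)"
  proof (rule arc_join[OF s1])
    show "pathfinish (subpath t2 1 g) = pathstart (subpath 0 t1 g)" using g01 by simp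
    show "path_image (subpath t2 1 g) \<inter> path_image (subpath 0 t1 g) \<subseteq> {pathstart (subpath 0 t1 g)}"
    proof
      fix z assume z: "z \<in> path_image (subpath t2 1 g) \<inter> path_image (subpath 0 t1 g)"
      obtain u where u: "z = g u" "u \<in> {t2..1}" using z unfolding i1 by (meson IntD1 imageE)
      obtain w where w: "z = g w" "w \<in> {0..t1}" using z unfolding i1 by (meson IntD2 imageE)
      have "u = w \<or> u = 0 \<and> w = 1 \<or> u = 1 \<and> w = 0" using inj[of u w] u w t by auto
      then have "w = 0" using u(2) w(2) t by auto
      then show "z \<in> {pathstart (subpath 0 t1 g)}" using w(1) by simp
    qed
  qed
  then have a2: "arc c2" unfolding c2_def by (simp add: arc_reversepath)
  have im1: "path_image c1 = g ` {t1..t2}" unfolding c1_def using t by (simp add: path_image_subpath)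
  have "path_image c2 = path_image (subpath t2 1 g) \<union> path_image (subpath 0 t1 g)"
    unfolding c2_def path_image_reversepath by (rule path_image_join) (simp add: g01)
  then have im2: "path_image c2 = g ` ({0..t1} \<union> {t2..1})"
    unfolding i1 by (simp add: image_Un Un_commute)
  have int: "path_image c1 \<inter> path_image c2 = {g t1, g t2}"
  proof
    show "path_image c1 \<inter> path_image c2 \<subseteq> {g t1, g t2}"
    proof
      fix z assume z: "z \<in> path_image c1 \<inter> path_image c2"
      obtain u where u: "z = g u" "u \<in> {t1..t2}" using z unfolding im1 by (meson IntD1 imageE)
      obtain w where w: "z = g w" "w \<in> {0..t1} \<union> {t2..1}" using z unfolding im2 by (meson IntD2 imageE)
      have "u = w \<or> u = 0 \<and> w = 1 \<or> u = 1 \<and> w = 0" using inj[of u w] u w t by auto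
      then have "u = t1 \<or> u = t2" using u(2) w(2) t by auto
      then show "z \<in> {g t1, g t2}" using u(1) by auto
    qed
    have "t1 \<in> {t1..t2}" "t2 \<in> {t1..t2}" "t1 \<in> {0..t1} \<union> {t2..1}" "t2 \<in> {0..t1} \<union> {t2..1}" using t by auto
    then show "{g t1, g t2} \<subseteq> path_image c1 \<inter> path_image c2" unfolding im1 im2 by blast
  qed
  have "{0..1} = {t1..t2} \<union> ({0..t1} \<union> {t2..1})" using t by auto
  then have un: "path_image c1 \<union> path_image c2 = path_image g"
    unfolding im1 im2 by (simp add: path_image_def image_Un)
  show thesis
    by (rule that[OF a1 a2 _ _ _ _ im1 im2 int un]) (auto simp: c1_def c2_def)
qed

text \<open>Alternation of two pairs of points on a circle, expressed in the parameters of the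
  circle cut open at one point.\<close>

definition separated :: "real \<Rightarrow> real \<Rightarrow> real \<Rightarrow> real \<Rightarrow> bool" where
  "separated p r q s \<longleftrightarrow> p \<noteq> r \<and> p \<noteq> q \<and> p \<noteq> s \<and> r \<noteq> q \<and> r \<noteq> s \<and> q \<noteq> s \<and>
     ((min p r < q \<and> q < max p r) \<noteq> (min p r < s \<and> s < max p r))"

lemma separated_swap1: "separated p r q s \<Longrightarrow> separated r p q s"
  by (simp add: separated_def min.commute max.commute)

lemma separated_swap2: "separated p r q s \<Longrightarrow> separated p r s q"
  by (auto simp: separated_def)

locale disc =
  fixes g :: "real \<Rightarrow> complex" and S :: "complex set"
  assumes simple: "simple_path g" and closed: "pathfinish g = pathstart g"
    and side: "S = inside (path_image g) \<or> S = outside (path_image g)"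
begin

lemma g_inj: "0 < x \<Longrightarrow> x < 1 \<Longrightarrow> 0 \<le> y \<Longrightarrow> y \<le> 1 \<Longrightarrow> g x = g y \<Longrightarrow> x = y"
  using simple unfolding simple_path_def loop_free_def by force

lemma g_mem: "0 \<le> x \<Longrightarrow> x \<le> 1 \<Longrightarrow> g x \<in> path_image g"
  by (auto simp: path_image_def)

lemma side_facts: "open S" "connected S" "S \<inter> path_image g = {}" "frontier S = path_image g"
  using Jordan_sides[OF simple closed side] by auto

text \<open>The crosscut \<open>c\<close> leaves two regions whose frontiers contain different arcs
  of the closed curve. If \<open>b\<close> missed \<open>c\<close>, its connected interior would
  stay in one region, although its two ends lie inside the two different arcs.\<close>

lemma arcs_meet_aux:
  assumes t: "0 < t1" "t1 < t2" "t2 < 1" and s: "t1 < s1" "s1 < t2" "0 < s2" "s2 < 1" "s2 < t1 \<or> t2 < s2"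
    and c: "arc c" "pathstart c = g t1" "pathfinish c = g t2" "path_image c - {g t1, g t2} \<subseteq> S"
    and b: "arc b" "pathstart b = g s1" "pathfinish b = g s2" "path_image b - {g s1, g s2} \<subseteq> S"
  shows "path_image c \<inter> path_image b \<noteq> {}"
proof
  assume dis: "path_image c \<inter> path_image b = {}"
  obtain c1 c2 where c12: "arc c1" "arc c2" "pathstart c1 = g t1" "pathfinish c1 = g t2"
    "pathstart c2 = g t1" "pathfinish c2 = g t2"
    "path_image c1 = g ` {t1..t2}" "path_image c2 = g ` ({0..t1} \<union> {t2..1})"
    "path_image c1 \<inter> path_image c2 = {g t1, g t2}" "path_image c1 \<union> path_image c2 = path_image g"
    using closed_path_split[OF simple closed t] .
  obtain D1 D2 where D: "open D1" "open D2" "connected D1" "connected D2" "D1 \<noteq> {}" "D2 \<noteq> {}" "D1 \<inter> D2 = {}"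
    "D1 \<union> D2 = S - path_image c"
    "frontier D1 = path_image c1 \<union> path_image c" "frontier D2 = path_image c2 \<union> path_image c"
    using crosscut[OF c12(1,2) c(1) c12(3-6) c(2,3) c12(9) side[folded c12(10)] c(4)] .
  let ?B = "path_image b - {g s1, g s2}"
  have conB: "connected ?B" using connected_simple_path_endless[of b] b by (simp add: arc_simple_path)
  have BS: "?B \<subseteq> D1 \<union> D2" using b(4) dis D(8) by blast
  have int0: "D1 \<inter> D2 \<inter> ?B = {}" using D(7) by simp
  have "D1 \<inter> ?B = {} \<or> D2 \<inter> ?B = {}"
    using connectedD[OF conB D(1,2) int0 BS] .
  moreover have "B' \<subseteq> D2" if "D1 \<inter> B' = {}" "B' \<subseteq> D1 \<union> D2" for B' using that by blast
  moreover have "B' \<subseteq> D1" if "D2 \<inter> B' = {}" "B' \<subseteq> D1 \<union> D2" for B' using that by blast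
  ultimately have BD: "?B \<subseteq> D2 \<or> ?B \<subseteq> D1" using BS by metis
  have neq: "g s1 \<noteq> g s2" using g_inj[of s1 s2] s t by force
  have bs: "g s1 \<in> path_image b" "g s2 \<in> path_image b" using b(2,3) by (metis pathstart_in_path_image, metis pathfinish_in_path_image)
  have cl: "g s1 \<in> closure ?B" "g s2 \<in> closure ?B"
  proof -
    have "u \<in> closure ?B" if u: "u \<in> path_image b" for u
    proof -
      have "u islimpt path_image b"
        by (rule connected_imp_perfect[OF connected_arc_image[OF b(1)] u]) (use bs neq in auto)
      then have "u islimpt ({g s1,g s2} \<union> ?B)" by (rule islimpt_subset) auto
      then have "u islimpt ?B" by (metis islimpt_Un islimpt_finite finite.emptyI finite.insertI)
      then show ?thesis by (simp add: closure_def)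
    qed
    then show "g s1 \<in> closure ?B" "g s2 \<in> closure ?B" using bs by auto
  qed
  have nS: "g s1 \<notin> S" "g s2 \<notin> S" using side_facts(3) g_mem[of s1] g_mem[of s2] s t by auto
  have nc: "g s1 \<notin> path_image c" "g s2 \<notin> path_image c" using bs dis by auto
  have n1: "g s1 \<notin> path_image c2"
  proof
    assume "g s1 \<in> path_image c2"
    then obtain w where "w \<in> {0..t1} \<union> {t2..1}" "g s1 = g w" unfolding c12(8) by blast
    then show False using g_inj[of s1 w] s t by auto
  qed
  have n2: "g s2 \<notin> path_image c1"
  proof
    assume "g s2 \<in> path_image c1"
    then obtain w where "w \<in> {t1..t2}" "g s2 = g w" unfolding c12(7) by blast
    then show False using g_inj[of s2 w] s t by auto
  qed
  have "closure D1 = D1 \<union> frontier D1" "closure D2 = D2 \<union> frontier D2" by (simp_all add: closure_Un_frontier)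
  then have "g s2 \<notin> closure D1" "g s1 \<notin> closure D2" using D(8,9,10) n1 n2 nc nS by auto
  then show False using BD cl closure_mono by blast
qed

text \<open>Stated for paths and not only for arcs because the routes used later change chord at a
  crossing and may touch themselves; an arc inside each path leads back to the previous
  lemma.\<close>

lemma paths_meet:
  assumes sep: "separated p r q s" and r: "0 < p" "p < 1" "0 < q" "q < 1" "0 < r" "r < 1" "0 < s" "s < 1"
    and c: "path c" "pathstart c = g p" "pathfinish c = g r" "path_image c - {g p, g r} \<subseteq> S"
    and b: "path b" "pathstart b = g q" "pathfinish b = g s" "path_image b - {g q, g s} \<subseteq> S"
  shows "path_image c \<inter> path_image b \<noteq> {}"
proof -
  have neq: "g p \<noteq> g r" "g q \<noteq> g s" using sep g_inj r unfolding separated_def by (metis less_imp_le)+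
  obtain c' where c': "arc c'" "path_image c' \<subseteq> path_image c" "pathstart c' = g p" "pathfinish c' = g r"
    using path_contains_arc[OF c(1-3) neq(1)] by blast
  obtain b' where b': "arc b'" "path_image b' \<subseteq> path_image b" "pathstart b' = g q" "pathfinish b' = g s"
    using path_contains_arc[OF b(1-3) neq(2)] by blast
  define c'' where "c'' = (if p < r then c' else reversepath c')"
  define b'' where "b'' = (if min p r < q \<and> q < max p r then b' else reversepath b')"
  have "path_image c'' \<inter> path_image b'' \<noteq> {}"
  proof (rule arcs_meet_aux[of "min p r" "max p r" "if min p r < q \<and> q < max p r then q else s"
        "if min p r < q \<and> q < max p r then s else q"])
    show "path_image c'' - {g (min p r), g (max p r)} \<subseteq> S"
      using c' c(4) unfolding c''_def by (auto simp: min_def max_def)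
    show "path_image b'' - {g (if min p r < q \<and> q < max p r then q else s), g (if min p r < q \<and> q < max p r then s else q)} \<subseteq> S"
      using b' b(4) unfolding b''_def by auto
  qed (use sep r c' b' in \<open>auto simp: separated_def c''_def b''_def min_def max_def arc_reversepath split: if_splits\<close>)
  then show ?thesis using c'(2) b'(2) unfolding c''_def b''_def by (auto split: if_splits)
qed

end

text \<open>Going through the inverse of the parametrisation turns positions along an arc into
  comparisons of reals; \<open>up\<close> selects the end toward which the leg runs.\<close>

definition leg :: "(real \<Rightarrow> complex) \<Rightarrow> complex \<Rightarrow> bool \<Rightarrow> complex set" where
  "leg d z up = d ` (if up then {inv_into {0..1} d z..1} else {0..inv_into {0..1} d z})"

context
  fixes d :: "real \<Rightarrow> complex"
  assumes d: "arc d"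
begin

lemma arc_inj: "inj_on d {0..1}"
  using d by (simp add: arc_def)

lemma arc_param: "z \<in> path_image d \<Longrightarrow> inv_into {0..1} d z \<in> {0..1} \<and> d (inv_into {0..1} d z) = z"
  by (metis f_inv_into_f inv_into_into path_image_def)

lemma arc_param_eq: "u \<in> {0..1} \<Longrightarrow> inv_into {0..1} d (d u) = u"
  using arc_inj by simp

lemma leg_iff: "z \<in> path_image d \<Longrightarrow> y \<in> leg d z up \<longleftrightarrow>
    y \<in> path_image d \<and> (if up then inv_into {0..1} d z \<le> inv_into {0..1} d y else inv_into {0..1} d y \<le> inv_into {0..1} d z)"
  unfolding leg_def using arc_param[of z] arc_param_eq arc_param[of y]
  by (auto simp: path_image_def image_iff)

lemma param_inj: "y \<in> path_image d \<Longrightarrow> z \<in> path_image d \<Longrightarrow> inv_into {0..1} d y = inv_into {0..1} d z \<Longrightarrow> y = z"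
  by (metis arc_param)

lemma leg_subset: "z \<in> path_image d \<Longrightarrow> leg d z up \<subseteq> path_image d"
  using leg_iff by auto

lemma leg_self: "z \<in> path_image d \<Longrightarrow> z \<in> leg d z up"
  by (simp add: leg_iff)

lemma leg_total: "z \<in> path_image d \<Longrightarrow> y \<in> path_image d \<Longrightarrow> y \<in> leg d z up \<or> y \<in> leg d z (\<not> up)"
  by (auto simp: leg_iff)

lemma leg_swap: "z \<in> path_image d \<Longrightarrow> y \<in> leg d z up \<Longrightarrow> z \<in> leg d y (\<not> up)"
  by (auto simp: leg_iff split: if_splits)

lemma leg_Int: "z \<in> path_image d \<Longrightarrow> y \<in> leg d z up \<Longrightarrow> y \<in> leg d z (\<not> up) \<Longrightarrow> y = z"
  using param_inj[of y z] by (auto simp: leg_iff split: if_splits)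

lemma leg_mono: "z \<in> path_image d \<Longrightarrow> y \<in> leg d z up \<Longrightarrow> leg d y up \<subseteq> leg d z up"
  by (auto simp: leg_iff split: if_splits)

lemma leg_arc:
  assumes z: "z \<in> path_image d" "z \<noteq> (if up then pathfinish d else pathstart d)"
  obtains p where "arc p" "pathstart p = z" "pathfinish p = (if up then pathfinish d else pathstart d)" "path_image p = leg d z up"
proof -
  let ?u = "inv_into {0..1} d z"
  have u: "?u \<in> {0..1}" "d ?u = z" using arc_param[OF z(1)] by auto
  have "?u \<noteq> (if up then 1 else 0)" using z(2) u by (auto simp: pathfinish_def pathstart_def)
  then have a: "arc (subpath ?u (if up then 1 else 0) d)"
    using u d by (intro arc_subpath_arc) auto
  show thesis
  proof (rule that[OF a])
    show "path_image (subpath ?u (if up then 1 else 0) d) = leg d z up"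
      unfolding path_image_subpath_gen using u by (auto simp: leg_def closed_segment_eq_real_ivl)
  qed (use u in \<open>auto simp: pathfinish_def pathstart_def subpath_def\<close>)
qed

lemma leg_end: "z \<in> path_image d \<Longrightarrow> (if up then pathfinish d else pathstart d) \<in> leg d z up"
  using arc_param[of z] unfolding leg_def pathfinish_def pathstart_def by auto

end

text \<open>Models the other pseudocircles as seen from one side of the cut curve.
  \<open>cross1\<close> records that chords with alternating ends also meet on the opposite side,
  which uses up one of the two crossings of their pseudocircles.\<close>

locale chords = disc +
  fixes I :: "'i set" and lo hi :: "'i \<Rightarrow> real" and d :: "'i \<Rightarrow> real \<Rightarrow> complex"
  assumes fin: "finite I"
    and range: "i \<in> I \<Longrightarrow> 0 < lo i \<and> lo i < hi i \<and> hi i < 1"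
    and arc: "i \<in> I \<Longrightarrow> arc (d i) \<and> pathstart (d i) = g (lo i) \<and> pathfinish (d i) = g (hi i)"
    and inS: "i \<in> I \<Longrightarrow> path_image (d i) - {g (lo i), g (hi i)} \<subseteq> S"
    and ends_distinct: "i \<in> I \<Longrightarrow> j \<in> I \<Longrightarrow> i \<noteq> j \<Longrightarrow> {lo i, hi i} \<inter> {lo j, hi j} = {}"
    and cross2: "i \<in> I \<Longrightarrow> j \<in> I \<Longrightarrow> i \<noteq> j \<Longrightarrow> finite (path_image (d i) \<inter> path_image (d j)) \<and> card (path_image (d i) \<inter> path_image (d j)) \<le> 2"
    and cross1: "i \<in> I \<Longrightarrow> j \<in> I \<Longrightarrow> i \<noteq> j \<Longrightarrow> separated (lo i) (hi i) (lo j) (hi j) \<Longrightarrow> card (path_image (d i) \<inter> path_image (d j)) \<le> 1"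
    and triple: "i \<in> I \<Longrightarrow> j \<in> I \<Longrightarrow> k \<in> I \<Longrightarrow> i \<noteq> j \<Longrightarrow> i \<noteq> k \<Longrightarrow> j \<noteq> k \<Longrightarrow> path_image (d i) \<inter> path_image (d j) \<inter> path_image (d k) = {}"
begin

abbreviation K :: "'i \<Rightarrow> complex set" where "K i \<equiv> path_image (d i)"

definition is_end :: "real \<Rightarrow> 'i \<Rightarrow> bool" where
  "is_end t i \<longleftrightarrow> i \<in> I \<and> (t = lo i \<or> t = hi i)"

text \<open>Naming a leg by the parameter of its end, not by a direction, makes the statements
  symmetric in the two ends of a chord.\<close>

definition L :: "'i \<Rightarrow> complex \<Rightarrow> real \<Rightarrow> complex set" where
  "L i z t = leg (d i) z (t = hi i)"

lemma end_I: "is_end t i \<Longrightarrow> i \<in> I"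
  by (simp add: is_end_def)

lemma end_range: "is_end t i \<Longrightarrow> 0 < t \<and> t < 1"
  using range by (fastforce simp: is_end_def)

lemma end_owner: "is_end t i \<Longrightarrow> is_end t j \<Longrightarrow> i = j"
  using ends_distinct[of i j] by (cases "i = j") (auto simp: is_end_def)

lemma end_neq: "is_end t i \<Longrightarrow> is_end t' j \<Longrightarrow> i \<noteq> j \<Longrightarrow> t \<noteq> t'"
  using end_owner by blast

lemma dir: "is_end t i \<Longrightarrow> is_end t' i \<Longrightarrow> t \<noteq> t' \<Longrightarrow> (t' = hi i) = (\<not> t = hi i)"
  using range[of i] by (auto simp: is_end_def)

lemma dir2: "is_end t i \<Longrightarrow> (if t = hi i then pathfinish (d i) else pathstart (d i)) = g t"
  using arc[of i] by (auto simp: is_end_def)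

lemma L_sub: "i \<in> I \<Longrightarrow> z \<in> K i \<Longrightarrow> L i z t \<subseteq> K i"
  using leg_subset[of "d i" z] arc[of i] by (simp add: L_def)

lemma L_self: "i \<in> I \<Longrightarrow> z \<in> K i \<Longrightarrow> z \<in> L i z t"
  using leg_self[of "d i" z] arc[of i] by (simp add: L_def)

lemma L_total: "is_end t i \<Longrightarrow> is_end t' i \<Longrightarrow> t \<noteq> t' \<Longrightarrow> z \<in> K i \<Longrightarrow> y \<in> K i \<Longrightarrow> y \<in> L i z t \<or> y \<in> L i z t'"
  using leg_total[of "d i" z y "t = hi i"] arc[of i] dir[of t i t'] by (simp add: L_def end_I)

lemma L_swap: "is_end t i \<Longrightarrow> is_end t' i \<Longrightarrow> t \<noteq> t' \<Longrightarrow> z \<in> K i \<Longrightarrow> y \<in> L i z t \<Longrightarrow> z \<in> L i y t'"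
  using leg_swap[of "d i" z y "t = hi i"] arc[of i] dir[of t i t'] by (simp add: L_def end_I)

lemma L_Int: "is_end t i \<Longrightarrow> is_end t' i \<Longrightarrow> t \<noteq> t' \<Longrightarrow> z \<in> K i \<Longrightarrow> y \<in> L i z t \<Longrightarrow> y \<in> L i z t' \<Longrightarrow> y = z"
  using leg_Int[of "d i" z y "t = hi i"] arc[of i] dir[of t i t'] by (simp add: L_def end_I)

lemma L_mono: "i \<in> I \<Longrightarrow> z \<in> K i \<Longrightarrow> y \<in> L i z t \<Longrightarrow> L i y t \<subseteq> L i z t"
  using leg_mono[of "d i" z y "t = hi i"] arc[of i] by (simp add: L_def)

lemma other_end: assumes "is_end t i" obtains t' where "is_end t' i" "t' \<noteq> t"
proof (cases "t = lo i")
  case True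
  then show thesis using that[of "hi i"] assms range[of i] by (simp add: is_end_def)
next
  case False
  then show thesis using that[of "lo i"] assms by (simp add: is_end_def)
qed

lemma ends_two: "is_end t i \<Longrightarrow> is_end t' i \<Longrightarrow> t \<noteq> t' \<Longrightarrow> is_end s i \<Longrightarrow> s = t \<or> s = t'"
  by (auto simp: is_end_def)

lemma separated_ends:
  assumes "separated p r q s" "is_end p i" "is_end r i" "is_end q j" "is_end s j" "p \<noteq> r" "q \<noteq> s"
  shows "separated (lo i) (hi i) (lo j) (hi j)"
proof -
  have "p = lo i \<and> r = hi i \<or> p = hi i \<and> r = lo i" "q = lo j \<and> s = hi j \<or> q = hi j \<and> s = lo j"
    using assms by (auto simp: is_end_def)
  then show ?thesis using assms(1) separated_swap1 separated_swap2 by metis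
qed

lemma K_cases: "i \<in> I \<Longrightarrow> z \<in> K i \<Longrightarrow> z \<in> S \<or> z = g (lo i) \<or> z = g (hi i)"
  using inS[of i] by (auto simp: subset_iff)

lemma g_end_notin_S: "is_end t i \<Longrightarrow> g t \<notin> S"
  using end_range[of t i] g_mem[of t] side_facts(3) by auto

lemma g_end_inj: "is_end t i \<Longrightarrow> is_end t' j \<Longrightarrow> g t = g t' \<Longrightarrow> t = t'"
  using end_range[of t i] end_range[of t' j] g_inj[of t t'] by auto

lemma crossing_in_S: assumes "i \<in> I" "j \<in> I" "i \<noteq> j" "v \<in> K i" "v \<in> K j" shows "v \<in> S"
proof (rule ccontr)
  assume "v \<notin> S"
  then have "v = g (lo i) \<or> v = g (hi i)" "v = g (lo j) \<or> v = g (hi j)"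
    using K_cases[of i v] K_cases[of j v] assms by metis+
  moreover have "is_end (lo i) i" "is_end (hi i) i" "is_end (lo j) j" "is_end (hi j) j"
    using assms by (simp_all add: is_end_def)
  ultimately obtain t t' where "is_end t i" "is_end t' j" "v = g t" "v = g t'" by metis
  then show False using g_end_inj end_neq assms(3) by metis
qed

lemma L_arc:
  assumes "is_end t i" "z \<in> K i" "z \<in> S"
  obtains c where "arc c" "pathstart c = z" "pathfinish c = g t" "path_image c = L i z t" "path_image c - {g t} \<subseteq> S"
proof -
  have i: "i \<in> I" using assms(1) end_I by auto
  have neq: "z \<noteq> g t" using g_end_notin_S[OF assms(1)] assms(3) by auto
  obtain c where c: "arc c" "pathstart c = z" "pathfinish c = g t" "path_image c = L i z t"
    using leg_arc[of "d i" z "t = hi i"] arc[OF i] assms(2) neq dir2[OF assms(1)] unfolding L_def by metis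
  obtain t' where t': "is_end t' i" "t' \<noteq> t" using other_end[OF assms(1)] .
  have "g t' \<notin> L i z t"
  proof
    assume "g t' \<in> L i z t"
    moreover have "g t' \<in> L i z t'"
      using leg_end[of "d i" z "t' = hi i"] arc[OF i] assms(2) dir2[OF t'(1)] unfolding L_def by simp
    ultimately show False using L_Int[OF assms(1) t'(1) _ assms(2)] t'(2) g_end_notin_S[OF t'(1)] assms(3) by blast
  qed
  then have "L i z t - {g t} \<subseteq> S"
    using L_sub[OF i assms(2), of t] K_cases[OF i] ends_two[OF assms(1) t'(1)] t' assms(1)
    unfolding is_end_def by blast
  then show thesis using that c by metis
qed

lemma bent_path:
  assumes "i \<in> I" "j \<in> I" "i \<noteq> j" "v \<in> K i" "v \<in> K j" "is_end p i" "is_end r j"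
  obtains c where "path c" "pathstart c = g p" "pathfinish c = g r" "path_image c = L i v p \<union> L j v r"
    "path_image c - {g p, g r} \<subseteq> S"
proof -
  have vS: "v \<in> S" using crossing_in_S[OF assms(1-5)] .
  obtain c where c: "arc c" "pathstart c = v" "pathfinish c = g p" "path_image c = L i v p" "path_image c - {g p} \<subseteq> S"
    using L_arc[OF assms(6,4) vS] .
  obtain e where e: "arc e" "pathstart e = v" "pathfinish e = g r" "path_image e = L j v r" "path_image e - {g r} \<subseteq> S"
    using L_arc[OF assms(7,5) vS] .
  have "path (reversepath c +++ e)" using c e by (simp add: arc_imp_path)
  moreover have "path_image (reversepath c +++ e) = L i v p \<union> L j v r"
    using c e by (simp add: path_image_join)
  moreover have "L i v p \<union> L j v r - {g p, g r} \<subseteq> S" using c(4,5) e(4,5) by blast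
  ultimately show thesis using that[of "reversepath c +++ e"] c e by simp
qed

lemma bent_meet:
  assumes "a \<in> I" "x \<in> I" "a \<noteq> x" "v \<in> K a" "v \<in> K x" "is_end p a" "is_end r x"
    and "b \<in> I" "y \<in> I" "b \<noteq> y" "w \<in> K b" "w \<in> K y" "is_end q b" "is_end s y"
    and sep: "separated p r q s"
  obtains z where "z \<in> L a v p \<union> L x v r" "z \<in> L b w q \<union> L y w s"
proof -
  obtain c where c: "path c" "pathstart c = g p" "pathfinish c = g r" "path_image c = L a v p \<union> L x v r"
    "path_image c - {g p, g r} \<subseteq> S" using bent_path[OF assms(1-7)] .
  obtain e where e: "path e" "pathstart e = g q" "pathfinish e = g s" "path_image e = L b w q \<union> L y w s"
    "path_image e - {g q, g s} \<subseteq> S" using bent_path[OF assms(8-14)] .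
  have "path_image c \<inter> path_image e \<noteq> {}"
    by (rule paths_meet[OF sep _ _ _ _ _ _ _ _ c(1-3,5) e(1-3,5)])
      (use end_range assms(6,7,13,14) in blast)+
  then show thesis using that c(4) e(4) by blast
qed

section \<open>Chords followed from an end to the first crossing\<close>

definition first_crossing :: "real \<Rightarrow> 'i \<Rightarrow> 'i \<Rightarrow> complex \<Rightarrow> bool" where
  "first_crossing t i x v \<longleftrightarrow> is_end t i \<and> x \<in> I \<and> x \<noteq> i \<and> v \<in> K i \<and> v \<in> K x \<and>
     (\<forall>j\<in>I. j \<noteq> i \<longrightarrow> (L i v t - {v}) \<inter> K j = {})"

lemma first_crossingD: assumes "first_crossing t i x v"
  shows "is_end t i" "i \<in> I" "x \<in> I" "x \<noteq> i" "v \<in> K i" "v \<in> K x"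
    "\<And>j z. j \<in> I \<Longrightarrow> j \<noteq> i \<Longrightarrow> z \<in> L i v t \<Longrightarrow> z \<in> K j \<Longrightarrow> z = v"
  using assms unfolding first_crossing_def is_end_def by blast+

lemma first_crossing_not_third: "first_crossing t i x v \<Longrightarrow> y \<in> I \<Longrightarrow> y \<noteq> i \<Longrightarrow> y \<noteq> x \<Longrightarrow> v \<notin> K y"
  using triple[of i x y] first_crossingD(2-6)[of t i x v] by auto

text \<open>The initial leg meets no other chord before \<open>v\<close>. The delicate case is
  \<open>b = a\<close>, when both initial legs lie on one chord: they start at different ends and
  stop at their first crossings, so they share at most \<open>v\<close>.\<close>

lemma first_crossing_avoid:
  assumes f1: "first_crossing p a x v" and f2: "first_crossing q b y w" and pq: "p \<noteq> q" and ya: "y \<noteq> a" and s: "is_end s y"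
    and z: "z \<in> L a v p" "z \<in> L b w q \<union> L y w s"
  shows "z = v"
proof -
  note F1 = first_crossingD[OF f1] note F2 = first_crossingD[OF f2]
  consider "z \<in> L y w s" | "z \<in> L b w q" using z(2) by blast
  then show ?thesis
  proof cases
    case 1
    then have "z \<in> K y" using L_sub[OF F2(3,6)] by blast
    then show ?thesis using F1(7)[OF F2(3) ya z(1)] by blast
  next
    case 2
    then have zb: "z \<in> K b" using L_sub[OF F2(2,5)] by blast
    show ?thesis
    proof (cases "b = a")
      case False
      then show ?thesis using F1(7)[OF F2(2) _ z(1) zb] by blast
    next
      case True
      have q: "is_end q a" using F2(1) True by simp
      have wa: "w \<in> K a" using F2(5) True by simp
      have "w \<in> L a v p \<or> w \<in> L a v q" using L_total[OF F1(1) q pq F1(5) wa] .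
      moreover have "w = v" if "w \<in> L a v p" using F1(7)[OF F2(3) ya that F2(6)] .
      ultimately have "w \<in> L a v q" using L_self[OF F1(2,5)] by metis
      then have "z \<in> L a v q" using L_mono[OF F1(2,5)] 2 True by blast
      then show ?thesis using L_Int[OF F1(1) q pq F1(5) z(1)] by blast
    qed
  qed
qed

text \<open>Each route consists of an initial leg and a leg on the crossed chord, and planarity
  makes the routes meet. A common point on an initial leg can only be the bend, which also belongs
  to the second leg; so the crossed chords themselves meet.\<close>

lemma legs_cross:
  assumes f1: "first_crossing p a x v" and f2: "first_crossing q b y w" and pq: "p \<noteq> q" and ya: "y \<noteq> a" and xb: "x \<noteq> b"
    and r: "is_end r x" and s: "is_end s y" and sep: "separated p r q s"
  obtains z where "z \<in> L x v r" "z \<in> L y w s"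
proof -
  note F1 = first_crossingD[OF f1] note F2 = first_crossingD[OF f2]
  obtain z where z: "z \<in> L a v p \<union> L x v r" "z \<in> L b w q \<union> L y w s"
    using bent_meet[OF F1(2,3) F1(4)[symmetric] F1(5,6,1) r F2(2,3) F2(4)[symmetric] F2(5,6,1) s sep] .
  have "z \<in> L a v p \<Longrightarrow> z = v" using first_crossing_avoid[OF f1 f2 pq ya s _ z(2)] .
  then have 1: "z \<in> L x v r" using z(1) L_self[OF F1(3,6)] by blast
  have "z \<in> L b w q \<Longrightarrow> z = w" using first_crossing_avoid[OF f2 f1 pq[symmetric] xb r _ z(1)] .
  then have 2: "z \<in> L y w s" using z(2) L_self[OF F2(3,6)] by blast
  show thesis using that 1 2 .
qed

text \<open>The two chords that are crossed first from the ends \<open>p\<close> and \<open>q\<close> cannot separate each other in this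
  way: bending the chords at the first crossings, planarity forces three common points.\<close>

lemma pattern_generic:
  assumes f1: "first_crossing p a x v" and f2: "first_crossing q b y w" and pq: "p \<noteq> q" and ya: "y \<noteq> a" and xb: "x \<noteq> b" and xy: "x \<noteq> y"
    and x: "is_end x1 x" "is_end x2 x" "x1 \<noteq> x2" and y: "is_end y1 y" "is_end y2 y" "y1 \<noteq> y2"
    and sep: "separated p x2 q y1" "separated p x1 q y1" "separated p x2 q y2"
  shows False
proof -
  note F1 = first_crossingD[OF f1] note F2 = first_crossingD[OF f2]
  obtain z1 where z1: "z1 \<in> L x v x2" "z1 \<in> L y w y1" using legs_cross[OF f1 f2 pq ya xb x(2) y(1) sep(1)] .
  obtain z2 where z2: "z2 \<in> L x v x1" "z2 \<in> L y w y1" using legs_cross[OF f1 f2 pq ya xb x(1) y(1) sep(2)] .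
  obtain z3 where z3: "z3 \<in> L x v x2" "z3 \<in> L y w y2" using legs_cross[OF f1 f2 pq ya xb x(2) y(2) sep(3)] .
  have zx: "z1 \<in> K x" "z2 \<in> K x" "z3 \<in> K x" using z1 z2 z3 L_sub[OF F1(3,6)] by blast+
  have zy: "z1 \<in> K y" "z2 \<in> K y" "z3 \<in> K y" using z1 z2 z3 L_sub[OF F2(3,6)] by blast+
  have vy: "v \<notin> K y" using first_crossing_not_third[OF f1 F2(3) ya] xy by auto
  have wx: "w \<notin> K x" using first_crossing_not_third[OF f2 F1(3) xb] xy by auto
  \<comment> \<open>The bends tell the points apart: on \<open>x\<close> they lie on different sides
    of \<open>v\<close>, or on \<open>y\<close> on different sides of \<open>w\<close>, and neither
    bend lies on both \<open>x\<close> and \<open>y\<close>.\<close>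
  have "z1 \<noteq> z2" using L_Int[OF x F1(6) z2(1)] z1(1) vy zy by metis
  moreover have "z2 \<noteq> z3" using L_Int[OF x F1(6) z2(1)] z3(1) vy zy by metis
  moreover have "z1 \<noteq> z3" using L_Int[OF y F2(6) z1(2)] z3(2) wx zx by metis
  ultimately have "card {z1,z2,z3} = 3" by simp
  moreover have "card {z1,z2,z3} \<le> card (K x \<inter> K y)"
    using zx zy cross2[OF F1(3) F2(3) xy] by (intro card_mono) auto
  ultimately show False using cross2[OF F1(3) F2(3) xy] by linarith
qed

text \<open>Here the chord crossed first from \<open>p\<close> is the one that starts at
  \<open>q\<close>. On it \<open>w\<close> comes before \<open>v\<close>, so continuing from
  \<open>v\<close> away from \<open>q\<close> never reaches \<open>w\<close>. Every forced meeting
  with \<open>y\<close> is therefore new besides \<open>w\<close>: two of them exceed the bound of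
  two common points, and a single one exceeds the bound of one that alternating ends impose.\<close>

lemma pattern_special:
  assumes f1: "first_crossing p a b v" and f2: "first_crossing q b y w" and pq: "p \<noteq> q" and ya: "y \<noteq> a"
    and x: "is_end x1 b" "x1 \<noteq> q" and y: "is_end y1 y" "is_end y2 y" "y1 \<noteq> y2"
    and sep: "separated p x1 q y1" "separated p x1 q y2 \<or> separated q x1 y2 y1"
  shows False
proof -
  note F1 = first_crossingD[OF f1] note F2 = first_crossingD[OF f2]
  have vy: "v \<notin> K y" using first_crossing_not_third[OF f1 F2(3) ya F2(4)] .
  have vw: "v \<noteq> w" using vy F2(6) by auto
  have "v \<notin> L b w q" using F2(7)[OF F1(2) F1(4)[symmetric] _ F1(5)] vw by blast
  then have vx1: "v \<in> L b w x1" using L_total[OF F2(1) x(1) x(2)[symmetric] F2(5) F1(6)] by blast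
  then have "w \<in> L b v q" using L_swap[OF x(1) F2(1) x(2) F2(5)] by blast
  then have wn: "w \<notin> L b v x1" using L_Int[OF F2(1) x(1) x(2)[symmetric] F1(6)] vw by metis
  have sub: "L b v x1 \<subseteq> L b w x1" using L_mono[OF F2(2,5) vx1] .
  have cr: "\<exists>z. z \<in> L b v x1 \<and> z \<in> L y w s \<and> z \<noteq> w" if s: "is_end s y" "separated p x1 q s" for s
  proof -
    obtain z where z: "z \<in> L a v p \<union> L b v x1" "z \<in> L b w q \<union> L y w s"
      using bent_meet[OF F1(2,3) F1(4)[symmetric] F1(5,6,1) x(1) F2(2,3) F2(4)[symmetric] F2(5,6,1) s] .
    have zK: "z \<in> K b \<or> z \<in> K y" using z(2) L_sub[OF F2(2,5)] L_sub[OF F2(3,6)] by blast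
    have "z = v" if "z \<in> L a v p" using F1(7)[OF _ _ that] zK F2(2,3) F1(4) ya by blast
    then have z1: "z \<in> L b v x1" using z(1) L_self[OF F1(3,6)] by blast
    have "z \<notin> L b w q" using L_Int[OF F2(1) x(1) x(2)[symmetric] F2(5)] z1 sub wn by blast
    then show ?thesis using z1 z(2) wn by blast
  qed
  obtain z where z: "z \<in> L b v x1" "z \<in> L y w y1" "z \<noteq> w" using cr[OF y(1) sep(1)] by blast
  have zK: "z \<in> K b" "z \<in> K y" using z L_sub[OF F2(2) F1(6)] L_sub[OF F2(3,6)] by blast+
  note bY = F2(2,3) F2(4)[symmetric]
  from sep(2) show False
  proof
    assume "separated p x1 q y2"
    then obtain z' where z': "z' \<in> L b v x1" "z' \<in> L y w y2" "z' \<noteq> w" using cr[OF y(2)] by blast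
    have z'K: "z' \<in> K b" "z' \<in> K y" using z' L_sub[OF F2(2) F1(6)] L_sub[OF F2(3,6)] by blast+
    have "z \<noteq> z'" using L_Int[OF y F2(6) z(2)] z'(2) z(3) by metis
    then have "card {z,z',w} = 3" using z(3) z'(3) by simp
    moreover have "card {z,z',w} \<le> card (K b \<inter> K y)"
      using zK z'K F2(5,6) cross2[OF bY] by (intro card_mono) auto
    ultimately show False using cross2[OF bY] by linarith
  next
    assume s: "separated q x1 y2 y1"
    have "separated (lo b) (hi b) (lo y) (hi y)"
      using separated_ends[OF s F2(1) x(1) y(2,1) x(2)[symmetric] y(3)[symmetric]] .
    then have "card (K b \<inter> K y) \<le> 1" using cross1[OF bY] by blast
    moreover have "card {z,w} \<le> card (K b \<inter> K y)"
      using zK F2(5,6) cross2[OF bY] by (intro card_mono) auto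
    ultimately show False using z(3) by simp
  qed
qed

text \<open>The points \<open>v\<close> and \<open>w\<close> are all that \<open>a\<close> and
  \<open>b\<close> have in common. In the first case the two routes run along pieces of
  \<open>a\<close> and \<open>b\<close> that share neither of them; in the second case alternating
  ends allow a single crossing only.\<close>

lemma mutual_first:
  assumes f1: "first_crossing p a b v" and f2: "first_crossing q b a w" and vw: "v \<noteq> w"
    and x: "is_end x1 b" "x1 \<noteq> q" and y: "is_end y2 a" "y2 \<noteq> p"
  shows "\<not> separated p x1 q y2" "\<not> separated p y2 q x1"
proof -
  note F1 = first_crossingD[OF f1] note F2 = first_crossingD[OF f2]
  have vn: "v \<notin> L b w q" using F2(7)[OF F1(2) F1(4)[symmetric] _ F1(5)] vw by blast
  have wn: "w \<notin> L a v p" using F1(7)[OF F2(2) F2(4)[symmetric] _ F2(5)] vw by blast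
  have vx1: "v \<in> L b w x1" using L_total[OF F2(1) x(1) x(2)[symmetric] F2(5) F1(6)] vn by blast
  have wy2: "w \<in> L a v y2" using L_total[OF F1(1) y(1) y(2)[symmetric] F1(5) F2(6)] wn by blast
  have "v \<in> L a w p" using L_swap[OF y(1) F1(1) y(2) F1(5) wy2] .
  then have vn2: "v \<notin> L a w y2" using L_Int[OF F1(1) y(1) y(2)[symmetric] F2(6)] vw by blast
  have "w \<in> L b v q" using L_swap[OF x(1) F2(1) x(2) F2(5) vx1] .
  then have wn2: "w \<notin> L b v x1" using L_Int[OF F2(1) x(1) x(2)[symmetric] F1(6)] vw by blast
  have ab: "K a \<inter> K b = {v,w}"
  proof -
    have "{v,w} \<subseteq> K a \<inter> K b" using F1 F2 by blast
    moreover have "finite (K a \<inter> K b)" "card (K a \<inter> K b) \<le> card {v,w}" using cross2[OF F1(2) F2(2) F2(4)] vw by auto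
    ultimately show ?thesis using card_seteq by metis
  qed
  show "\<not> separated p x1 q y2"
  proof
    assume s: "separated p x1 q y2"
    obtain z where z: "z \<in> L a v p \<union> L b v x1" "z \<in> L b w q \<union> L a w y2"
      using bent_meet[OF F1(2,3) F1(4)[symmetric] F1(5,6,1) x(1) F2(2,3) F2(4)[symmetric] F2(5,6,1) y(1) s] .
    have 1: False if "z \<in> L a v p" "z \<in> L b w q"
      using F1(7)[OF F2(2) F2(4)[symmetric] that(1)] L_sub[OF F2(2,5)] that vn by blast
    have 2: False if "z \<in> L a v p" "z \<in> L a w y2"
    proof -
      have "z \<in> L a v y2" using L_mono[OF F1(2,5) wy2] that(2) by blast
      then have "z = v" using L_Int[OF F1(1) y(1) y(2)[symmetric] F1(5) that(1)] by blast
      then show False using that(2) vn2 by blast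
    qed
    have 3: False if "z \<in> L b v x1" "z \<in> L b w q"
    proof -
      have "z \<in> L b w x1" using L_mono[OF F2(2,5) vx1] that(1) by blast
      then have "z = w" using L_Int[OF F2(1) x(1) x(2)[symmetric] F2(5) that(2)] by blast
      then show False using that(1) wn2 by blast
    qed
    have 4: False if "z \<in> L b v x1" "z \<in> L a w y2"
    proof -
      have "z \<in> K a \<inter> K b" using that L_sub[OF F2(2) F1(6)] L_sub[OF F1(2) F2(6)] by blast
      then have "z = v \<or> z = w" using ab by simp
      then show False using that vn2 wn2 by metis
    qed
    show False using z 1 2 3 4 by blast
  qed
  show "\<not> separated p y2 q x1"
  proof
    assume s: "separated p y2 q x1"
    have "separated (lo a) (hi a) (lo b) (hi b)"
      using separated_ends[OF s F1(1) y(1) F2(1) x(1) y(2)[symmetric] x(2)[symmetric]] .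
    then have "card (K a \<inter> K b) \<le> 1" using cross1[OF F1(2) F2(2) F2(4)] by blast
    then show False using ab vw by simp
  qed
qed

text \<open>The route from \<open>z\<close> over its first crossing to an end \<open>f\<close>
  outside must meet one of the two legs that join at \<open>v\<close>. No other chord crosses these
  legs before \<open>v\<close>, so the route would have to continue on \<open>a\<close> or
  \<open>b\<close>; but it enters that chord beyond \<open>v\<close> and runs away from the
  triangle.\<close>

lemma no_end_under_triangle:
  assumes f1: "first_crossing p a b v" and f2: "first_crossing q b a v" and f3: "first_crossing z c u t"
    and c: "c \<noteq> a" "c \<noteq> b" and f: "is_end f u" "f \<noteq> p" "f \<noteq> q" and sep: "separated p q z f"
  shows False
proof -
  note F1 = first_crossingD[OF f1] note F2 = first_crossingD[OF f2] note F3 = first_crossingD[OF f3]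
  obtain s where s: "s \<in> L a v p \<union> L b v q" "s \<in> L c t z \<union> L u t f"
    using bent_meet[OF F1(2,3) F1(4)[symmetric] F1(5,6,1) F2(1) F3(2,3) F3(4)[symmetric] F3(5,6,1) f(1) sep] .
  have vc: "v \<notin> K c" using triple[OF F1(2,3) F3(2) F1(4)[symmetric] c[symmetric]] F1(5,6) by blast
  have sK: "s \<in> K c \<or> s \<in> K u" using s(2) L_sub[OF F3(2,5)] L_sub[OF F3(3,6)] by blast
  have key: False if h: "first_crossing p' a' b' v" "c \<noteq> a'" "u = a'" "s \<in> L u t f" "f \<noteq> p'" "s \<in> L a' v p'" for p' a' b'
  proof -
    note H = first_crossingD[OF h(1)]
    have fa: "is_end f a'" using f h by simp
    have ta: "t \<in> K a'" using F3(6) h by simp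
    have "t \<notin> L a' v p'" using H(7)[OF F3(2) h(2) _ F3(5)] vc F3(5) by blast
    then have "t \<in> L a' v f" using L_total[OF H(1) fa h(5)[symmetric] H(5) ta] by blast
    then have 1: "L a' t f \<subseteq> L a' v f" "v \<in> L a' t p'" using L_mono[OF H(2,5)] L_swap[OF fa H(1) h(5) H(5)] by blast+
    then have "s = v" using L_Int[OF H(1) fa h(5)[symmetric] H(5) h(6)] h by blast
    then have "v \<in> L a' t f" using h by blast
    then have "v = t" using L_Int[OF H(1) fa h(5)[symmetric] ta 1(2)] by blast
    then show False using vc F3(5) by blast
  qed
  have vK: "u = a \<or> u = b" if "v \<in> K u"
    using triple[OF F1(2,3) F3(3) F1(4)[symmetric]] F1(5,6) that by blast
  consider "s \<in> L a v p" | "s \<in> L b v q" using s(1) by blast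
  then show False
  proof cases
    case 1
    have "s \<notin> K c" using F1(7)[OF F3(2) c(1) 1] vc by blast
    then have su: "s \<in> L u t f" "s \<in> K u" using s(2) L_sub[OF F3(2,5)] sK by blast+
    show False
    proof (cases "u = a")
      case True then show False using key[OF f1 c(1) _ su(1) f(2) 1] by blast
    next
      case False
      then have "s = v" using F1(7)[OF F3(3) _ 1 su(2)] by blast
      then have "u = b" using vK su False by blast
      moreover have "s \<in> L b v q" using \<open>s = v\<close> L_self[OF F2(2,5)] by blast
      ultimately show False using key[OF f2 c(2) _ su(1) f(3)] by blast
    qed
  next
    case 2
    have "s \<notin> K c" using F2(7)[OF F3(2) c(2) 2] vc by blast
    then have su: "s \<in> L u t f" "s \<in> K u" using s(2) L_sub[OF F3(2,5)] sK by blast+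
    show False
    proof (cases "u = b")
      case True then show False using key[OF f2 c(2) _ su(1) f(3) 2] by blast
    next
      case False
      then have "s = v" using F2(7)[OF F3(3) _ 2 su(2)] by blast
      then have "u = a" using vK su False by blast
      moreover have "s \<in> L a v p" using \<open>s = v\<close> L_self[OF F1(2,5)] by blast
      ultimately show False using key[OF f1 c(1) _ su(1) f(2)] by blast
    qed
  qed
qed

end

text \<open>The combinatorial core: \<open>Lf t\<close> and \<open>Rf t\<close> stand for the left and right end of the chord that is
  crossed first from the end \<open>t\<close>. A pair as in the conclusion contradicts planarity.\<close>

lemma shift_pair:
  fixes Lf Rf :: "real \<Rightarrow> real"
  assumes fin: "finite W" and z: "z0 \<in> W" "zk \<in> W" "z0 < zk" "\<And>t. t \<in> W \<Longrightarrow> z0 \<le> t"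
    and LR: "\<And>t. t \<in> W \<Longrightarrow> Lf t < t \<and> t < Rf t"
    and RW: "\<And>t j. t \<in> W \<Longrightarrow> j \<in> W \<Longrightarrow> Rf t < j \<Longrightarrow> Rf t \<in> W"
    and LW: "\<And>t j. t \<in> W \<Longrightarrow> j \<in> W \<Longrightarrow> t < Lf j \<Longrightarrow> Lf j \<in> W"
    and L0: "\<And>j. j \<in> W \<Longrightarrow> j \<noteq> z0 \<Longrightarrow> Lf z0 < Lf j"
    and Rk: "\<And>j. j \<in> W \<Longrightarrow> j \<noteq> zk \<Longrightarrow> Rf j < Rf zk"
  shows "\<exists>i\<in>W. \<exists>j\<in>W. i < j \<and> j \<le> Rf i \<and> Lf j \<le> i \<and> Lf i < Lf j \<and> Rf i < Rf j"
proof -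
  \<comment> \<open>Descent on the right element \<open>j\<close>. The pair has all the required
    properties except possibly \<open>Lf j \<le> i\<close>; in addition no element from
    \<open>i\<close> up to \<open>j\<close> reaches further to the right than
    \<open>i\<close>.\<close>
  have step: "\<exists>i\<in>W. \<exists>j\<in>W. i < j \<and> j \<le> Rf i \<and> Lf j \<le> i \<and> Lf i < Lf j \<and> Rf i < Rf j"
    if "i \<in> W" "j \<in> W" "i < j" "\<And>t. t \<in> W \<Longrightarrow> i \<le> t \<Longrightarrow> t < j \<Longrightarrow> Rf t \<le> Rf i" "Rf i < Rf j" "j \<le> Rf i" "Lf i < Lf j"
    for i j
    using that
  proof (induction "card {t \<in> W. t < j}" arbitrary: i j rule: less_induct)
    case less
    note H = less.prems
    show ?case
    proof (cases "Lf j \<le> i")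
      case True
      then show ?thesis using H by blast
    next
      case False
      define l where "l = Lf j"
      have l: "l \<in> W" "i < l" "l < j" using LW[OF H(1,2)] False LR[OF H(2)] unfolding l_def by auto
      define M where "M = {t \<in> W. l \<le> t \<and> t < j \<and> Lf t < l}"
      have M: "finite M" "l \<in> M" using fin l LR[OF l(1)] unfolding M_def by auto
      define i' where "i' = Max M"
      have "i' \<in> M" unfolding i'_def using M by (intro Max_in) auto
      then have i': "i' \<in> W" "l \<le> i'" "i' < j" "Lf i' < l" unfolding M_def by auto
      have above: "l \<le> Lf t" if "t \<in> W" "i' < t" "t < j" for t
      proof (rule ccontr)
        assume "\<not> l \<le> Lf t"
        then have "t \<in> M" unfolding M_def using that i' by auto
        then have "t \<le> i'" unfolding i'_def using M by auto
        then show False using that by auto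
      qed
      have Ri': "Rf i' \<le> Rf i" using H(4)[OF i'(1)] i' l by auto
      show ?thesis
      proof (cases "j \<le> Rf i'")
        case True
        then show ?thesis using i' H(2,5) Ri' unfolding l_def by fastforce
      next
        case False
        define r where "r = Rf i'"
        have r: "r \<in> W" "i' < r" "r < j" using RW[OF i'(1) H(2)] False LR[OF i'(1)] unfolding r_def by auto
        \<comment> \<open>Otherwise \<open>i'\<close> reaches only to \<open>r\<close>, and the
          first later element that reaches beyond \<open>r\<close> takes the role of
          \<open>j\<close>. It lies at or before \<open>r\<close>, hence before \<open>j\<close>, so
          the descent terminates.\<close>
        define N where "N = {t \<in> W. i' < t \<and> r < Rf t \<and> t \<le> r}"
        have N: "finite N" "r \<in> N" using fin r LR[OF r(1)] unfolding N_def by auto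
        define j' where "j' = Min N"
        have "j' \<in> N" unfolding j'_def using N by (intro Min_in) auto
        then have j': "j' \<in> W" "i' < j'" "r < Rf j'" "j' \<le> r" unfolding N_def by auto
        have below: "Rf t \<le> Rf i'" if "t \<in> W" "i' \<le> t" "t < j'" for t
        proof (rule ccontr)
          assume c: "\<not> Rf t \<le> Rf i'"
          then have "t \<in> N" unfolding N_def r_def using that j' r_def by (cases "t = i'") auto
          then have "j' \<le> t" unfolding j'_def using N by auto
          then show False using that by auto
        qed
        have "{t \<in> W. t < j'} \<subset> {t \<in> W. t < j}" using j' r by fastforce
        then have "card {t \<in> W. t < j'} < card {t \<in> W. t < j}" using fin by (intro psubset_card_mono) auto
        then show ?thesis
          by (rule less.hyps[OF _ i'(1) j'(1,2) below]) (use j' above[OF j'(1,2)] i' r r_def in auto)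
      qed
    qed
  qed
  define N where "N = {t \<in> W. Rf z0 < Rf t}"
  have N: "finite N" "zk \<in> N" unfolding N_def using fin z Rk[OF z(1)] by auto
  define j where "j = Min N"
  have "j \<in> N" unfolding j_def using N by (intro Min_in) auto
  then have j: "j \<in> W" "Rf z0 < Rf j" unfolding N_def by auto
  have zj: "z0 < j" using z(4)[OF j(1)] j(2) by (cases "z0 = j") auto
  have small: "Rf t \<le> Rf z0" if "t \<in> W" "t < j" for t
  proof (rule ccontr)
    assume "\<not> Rf t \<le> Rf z0"
    then have "t \<in> N" using that unfolding N_def by auto
    then have "j \<le> t" unfolding j_def using N by auto
    then show False using that by auto
  qed
  have "j \<le> Rf z0"
  proof (rule ccontr)
    assume c: "\<not> j \<le> Rf z0"
    then have w: "Rf z0 \<in> W" using RW[OF z(1) j(1)] by auto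
    show False using small[OF w] c LR[OF w] by auto
  qed
  then show ?thesis using step[OF z(1) j(1) zj small j(2) _ L0[OF j(1)]] zj by auto
qed

section \<open>Order patterns on the cut circle that imply alternation\<close>

lemma separatedI:
  "s < p \<Longrightarrow> p < q \<Longrightarrow> q < r \<Longrightarrow> separated p r q s"
  "p < q \<Longrightarrow> q < r \<Longrightarrow> r < s \<Longrightarrow> separated p r q s"
  "r < s \<Longrightarrow> s < p \<Longrightarrow> p < q \<Longrightarrow> separated p r q s"
  by (simp_all add: separated_def)

text \<open>The disjunctions let the far ends \<open>x1\<close> and \<open>y2\<close> lie on either
  side of the cut, since only their cyclic position counts. This lemma and the next three match the
  cases distinguished in \<open>crossed_triangle\<close>.\<close>

lemma separated_generic:
  assumes "y1 < p" "p < q" "q < x2" "x1 < y1 \<or> x2 < x1" "x2 < y2 \<or> y2 < y1"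
  shows "separated p x2 q y1" "separated p x1 q y1" "separated p x2 q y2"
  using assms separatedI by (metis less_trans)+

lemma separated_left:
  assumes "p < q" "q < x2" "x1 < p \<or> x2 < x1" "x2 < y2 \<or> y2 < p" "x1 \<noteq> y2"
  shows "separated q y2 p x2" "separated q y2 p x1 \<or> separated p y2 x1 x2"
  using assms unfolding separated_def min_def max_def by (smt (verit))+

lemma separated_right:
  assumes "y1 < p" "p < q" "x1 < y1 \<or> q < x1" "q < y2 \<or> y2 < y1" "x1 \<noteq> y2"
  shows "separated p x1 q y1" "separated p x1 q y2 \<or> separated q x1 y2 y1"
  using assms unfolding separated_def min_def max_def by (smt (verit))+

lemma separated_both:
  assumes "p < q" "x1 < p \<or> q < x1" "q < y2 \<or> y2 < p" "x1 \<noteq> y2"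
  shows "separated p x1 q y2 \<or> separated p y2 q x1"
  using assms unfolding separated_def min_def max_def by (smt (verit))

context chords
begin

lemma no_separation:
  assumes "i \<in> I" "j \<in> I" "K i \<inter> K j = {}"
  shows "\<not> separated (lo i) (hi i) (lo j) (hi j)"
proof
  assume s: "separated (lo i) (hi i) (lo j) (hi j)"
  have "K i \<inter> K j \<noteq> {}"
    by (rule paths_meet[OF s]) (use arc[OF assms(1)] arc[OF assms(2)] inS[OF assms(1)] inS[OF assms(2)] range[OF assms(1)] range[OF assms(2)] in \<open>auto simp: arc_imp_path\<close>)
  then show False using assms by simp
qed

lemma first_crossing_exists:
  assumes t: "is_end t i" and cr: "\<exists>j\<in>I. j \<noteq> i \<and> K i \<inter> K j \<noteq> {}"
  obtains x v where "first_crossing t i x v"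
proof -
  have i: "i \<in> I" using t end_I by auto
  let ?p = "inv_into {0..1} (d i)"
  define V where "V = (\<Union>j\<in>I - {i}. K i \<inter> K j)"
  have V: "finite V" "V \<noteq> {}"
  proof -
    show "finite V" unfolding V_def using fin cross2[OF i] by (intro finite_UN_I) auto
    obtain j z where "j \<in> I" "j \<noteq> i" "z \<in> K i \<inter> K j" using cr by blast
    then have "z \<in> V" unfolding V_def by blast
    then show "V \<noteq> {}" by blast
  qed
  obtain v where v: "is_arg_min (\<lambda>z. if t = hi i then - ?p z else ?p z) (\<lambda>z. z \<in> V) v"
    using ex_is_arg_min_if_finite[OF V] by blast
  have vV: "v \<in> V" using v by (simp add: is_arg_min_def)
  then obtain x where x: "x \<in> I" "x \<noteq> i" "v \<in> K i" "v \<in> K x" unfolding V_def by blast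
  have "(L i v t - {v}) \<inter> K j = {}" if j: "j \<in> I" "j \<noteq> i" for j
  proof -
    have "z = v" if z: "z \<in> L i v t" "z \<in> K j" for z
    proof -
      have ai: "arc (d i)" using arc[OF i] by auto
      have zi: "z \<in> K i" "if t = hi i then ?p v \<le> ?p z else ?p z \<le> ?p v"
        using z(1) leg_iff[OF ai x(3)] unfolding L_def by auto
      have "z \<in> V" unfolding V_def using zi j z by blast
      then have "\<not> (if t = hi i then - ?p z else ?p z) < (if t = hi i then - ?p v else ?p v)"
        using v by (auto simp: is_arg_min_def)
      then have "?p z = ?p v" using zi(2) by (auto split: if_splits)
      then show ?thesis using param_inj[OF ai zi(1) x(3)] by simp
    qed
    then show ?thesis by blast
  qed
  then show thesis using that[of x v] t x unfolding first_crossing_def by blast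
qed

text \<open>Take the first end \<open>zk\<close> whose crossed chord lies wholly to its left and the
  last end \<open>z0\<close> before it whose crossed chord lies wholly to its right. In between,
  every crossed chord straddles its end. \<open>shift_pair\<close> yields two ends whose crossed
  chords are shifted against each other, and planarity leaves only the case that the two chords
  cross each other first, in one point.\<close>

lemma crossed_triangle:
  assumes ne: "I \<noteq> {}" and cr: "\<And>i. i \<in> I \<Longrightarrow> \<exists>j\<in>I. j \<noteq> i \<and> K i \<inter> K j \<noteq> {}"
  shows "\<exists>p q a b v. p < q \<and> first_crossing p a b v \<and> first_crossing q b a v \<and> (\<forall>t i. is_end t i \<longrightarrow> \<not> (p < t \<and> t < q))"
proof -
  define E where "E = {t. \<exists>i. is_end t i}"
  have "E = lo ` I \<union> hi ` I" unfolding E_def is_end_def by auto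
  then have E: "finite E" "E \<noteq> {}" using fin ne by auto
  have "\<exists>ixv. first_crossing t (fst ixv) (fst (snd ixv)) (snd (snd ixv))" if tE: "t \<in> E" for t
  proof -
    obtain i where i: "is_end t i" using tE unfolding E_def by blast
    obtain x v where "first_crossing t i x v" using first_crossing_exists[OF i cr[OF end_I[OF i]]] .
    then show ?thesis by (intro exI[of _ "(i, x, v)"]) simp
  qed
  then obtain F where F: "\<And>t. t \<in> E \<Longrightarrow> first_crossing t (fst (F t)) (fst (snd (F t))) (snd (snd (F t)))" by metis
  define ow xx vv where "ow t = fst (F t)" and "xx t = fst (snd (F t))" and "vv t = snd (snd (F t))" for t
  have f: "first_crossing t (ow t) (xx t) (vv t)" if "t \<in> E" for t using F[OF that] unfolding ow_def xx_def vv_def .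
  define lw hg where "lw t = lo (xx t)" and "hg t = hi (xx t)" for t
  have lh: "is_end (lw t) (xx t)" "is_end (hg t) (xx t)" "lw t < hg t" "lw t \<in> E" "hg t \<in> E" "lw t \<noteq> t" "hg t \<noteq> t"
    "0 < lw t" "hg t < 1" if "t \<in> E" for t
  proof -
    note D = first_crossingD[OF f[OF that]]
    show a: "is_end (lw t) (xx t)" "is_end (hg t) (xx t)" using D(3) by (simp_all add: is_end_def lw_def hg_def)
    then show "lw t \<in> E" "hg t \<in> E" unfolding E_def by auto
    show "lw t \<noteq> t" "hg t \<noteq> t" using end_neq[OF a(1) D(1) D(4)] end_neq[OF a(2) D(1) D(4)] by auto
    show "lw t < hg t" "0 < lw t" "hg t < 1" using range[OF D(3)] by (auto simp: lw_def hg_def)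
  qed
  have EI: "0 < t \<and> t < 1" if "t \<in> E" for t using that end_range unfolding E_def by blast
  define LL where "LL = {t \<in> E. hg t < t}"
  have "Max E \<in> LL" unfolding LL_def using Max_in[OF E] lh[of "Max E"] Max_ge[OF E(1)] by (auto simp: less_le)
  then have LLne: "finite LL" "LL \<noteq> {}" using E(1) unfolding LL_def by (simp, blast)
  define zk where "zk = Min LL"
  have zkLL: "zk \<in> LL" unfolding zk_def using LLne by (intro Min_in) auto
  then have zk: "zk \<in> E" "hg zk < zk" unfolding LL_def by auto
  have notLL: "t < hg t" if "t \<in> E" "t < zk" for t
  proof (rule ccontr)
    assume "\<not> t < hg t"
    then have "t \<in> LL" unfolding LL_def using that lh(7)[OF that(1)] by auto
    then have "zk \<le> t" unfolding zk_def using LLne by auto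
    then show False using that by auto
  qed
  define RR where "RR = {t \<in> E. t < lw t \<and> t < zk}"
  have mE: "Min E \<in> E" using E by simp
  have mle: "Min E \<le> t" if "t \<in> E" for t using E that by simp
  have "Min E < zk" using mle[OF lh(5)[OF zk(1)]] zk(2) by linarith
  then have "Min E \<in> RR" unfolding RR_def using mE lh[OF mE] mle[OF lh(4)[OF mE]] by (auto simp: less_le)
  then have RRne: "finite RR" "RR \<noteq> {}" using E(1) unfolding RR_def by (simp, blast)
  define z0 where "z0 = Max RR"
  have "z0 \<in> RR" unfolding z0_def using RRne by (intro Max_in) auto
  then have z0: "z0 \<in> E" "z0 < lw z0" "z0 < zk" unfolding RR_def by auto
  have notRR: "lw t < t" if "t \<in> E" "z0 < t" "t < zk" for t
  proof (rule ccontr)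
    assume "\<not> lw t < t"
    then have "t \<in> RR" unfolding RR_def using that lh(6)[OF that(1)] by auto
    then have "t \<le> z0" unfolding z0_def using RRne by auto
    then show False using that by auto
  qed
  define W where "W = {t \<in> E. z0 \<le> t \<and> t \<le> zk}"
  \<comment> \<open>The ends \<open>z0\<close> and \<open>zk\<close> do not lie between the ends of
    their crossed chords. Read cyclically, the far end of such a chord lies beyond the cut, so
    \<open>-1\<close> or \<open>2\<close>, outside the range of parameters, stands in for
    it.\<close>
  define Lf where "Lf t = (if t = z0 then -1 else if t = zk then hg t else lw t)" for t
  define Rf where "Rf t = (if t = zk then 2 else if t = z0 then lw t else hg t)" for t
  have WE: "t \<in> E" "z0 \<le> t" "t \<le> zk" if "t \<in> W" for t using that unfolding W_def by auto
  have LE: "Lf t = -1 \<or> Lf t \<in> E" "Rf t = 2 \<or> Rf t \<in> E" if "t \<in> W" for t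
    using lh(4,5)[OF WE(1)[OF that]] unfolding Lf_def Rf_def by auto
  have LRt: "Lf t < t \<and> t < Rf t" if "t \<in> W" for t
  proof -
    note tE = WE[OF that]
    show ?thesis
    proof (cases "t = z0 \<or> t = zk")
      case True
      then show ?thesis using z0 zk EI[OF z0(1)] EI[OF zk(1)] unfolding Lf_def Rf_def by auto
    next
      case False
      then show ?thesis using notLL[of t] notRR[of t] tE unfolding Lf_def Rf_def by auto
    qed
  qed
  have "\<exists>i\<in>W. \<exists>j\<in>W. i < j \<and> j \<le> Rf i \<and> Lf j \<le> i \<and> Lf i < Lf j \<and> Rf i < Rf j"
  proof (rule shift_pair[where W = W and ?z0.0 = z0 and zk = zk])
    show "finite W" "z0 \<in> W" "zk \<in> W" unfolding W_def using E z0 zk by auto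
    show "z0 < zk" by (rule z0)
    show "z0 \<le> t" if "t \<in> W" for t using WE[OF that] by simp
    show "Lf t < t \<and> t < Rf t" if "t \<in> W" for t using LRt[OF that] .
    show "Rf t \<in> W" if "t \<in> W" "j \<in> W" "Rf t < j" for t j
      using LE(2)[OF that(1)] LRt[OF that(1)] WE[OF that(1)] WE[OF that(2)] that(3) EI[OF WE(1)[OF that(2)]] unfolding W_def by auto
    show "Lf j \<in> W" if "t \<in> W" "j \<in> W" "t < Lf j" for t j
      using LE(1)[OF that(2)] LRt[OF that(2)] WE[OF that(1)] WE[OF that(2)] that(3) EI[OF WE(1)[OF that(1)]] unfolding W_def by auto
    show "Lf z0 < Lf j" if "j \<in> W" "j \<noteq> z0" for j
      using lh(3,8,9)[OF WE(1)[OF that(1)]] that unfolding Lf_def by auto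
    show "Rf j < Rf zk" if "j \<in> W" "j \<noteq> zk" for j
      using lh(3,8,9)[OF WE(1)[OF that(1)]] that unfolding Rf_def by auto
  qed
  then obtain p q where pq: "p \<in> W" "q \<in> W" "p < q" "q \<le> Rf p" "Lf q \<le> p" "Lf p < Lf q" "Rf p < Rf q" by blast
  have pE: "p \<in> E" and qE: "q \<in> E" using pq WE by auto
  have pzk: "p \<noteq> zk" and qz0: "q \<noteq> z0" using pq WE by fastforce+
  define a b x y v w where "a = ow p" and "b = ow q" and "x = xx p" and "y = xx q" and "v = vv p" and "w = vv q"
  have f1: "first_crossing p a x v" and f2: "first_crossing q b y w" using f[OF pE] f[OF qE] unfolding a_def b_def x_def y_def v_def w_def by auto
  note F1 = first_crossingD[OF f1] note F2 = first_crossingD[OF f2]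
  define x2 x1 where "x2 = Rf p" and "x1 = (if p = z0 then hg p else lw p)"
  define y1 y2 where "y1 = Lf q" and "y2 = (if q = zk then lw q else hg q)"
  have xe: "is_end x1 x" "is_end x2 x" "x1 \<noteq> x2"
    using lh[OF pE] pzk unfolding x1_def x2_def Rf_def x_def by auto
  have ye: "is_end y1 y" "is_end y2 y" "y1 \<noteq> y2"
    using lh[OF qE] qz0 unfolding y1_def y2_def Lf_def y_def by auto
  have X: "x1 < y1 \<or> x2 < x1"
    using lh(3)[OF pE] pq(6) pzk unfolding x1_def x2_def y1_def Rf_def Lf_def by auto
  have Y: "x2 < y2 \<or> y2 < y1"
    using lh(3)[OF qE] pq(7) qz0 unfolding y1_def x2_def y2_def Rf_def Lf_def by (auto split: if_splits)
  have B: "y1 \<le> p" "p < q" "q \<le> x2" using pq unfolding x2_def y1_def by auto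
  have xy: "x \<noteq> y"
  proof
    assume "x = y"
    then have "x2 = y1 \<or> x2 = y2" using ends_two[OF ye(1,2,3)] xe by auto
    then show False using B Y by auto
  qed
  have x1y2: "x1 \<noteq> y2" "x2 \<noteq> y1" "x2 \<noteq> y2" "x1 \<noteq> y1" using end_neq[OF xe(1) ye(2) xy] end_neq[OF xe(2) ye(1) xy] end_neq[OF xe(2) ye(2) xy] end_neq[OF xe(1) ye(1) xy] by auto
  have pe: "x1 \<noteq> p" "x2 \<noteq> p" "y1 \<noteq> q" "y2 \<noteq> q"
    using end_neq[OF xe(1) F1(1) F1(4)] end_neq[OF xe(2) F1(1) F1(4)] end_neq[OF ye(1) F2(1) F2(4)] end_neq[OF ye(2) F2(1) F2(4)] by auto
  have xb_q: "x2 = q" "x1 \<noteq> q" if "x = b"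
    using ends_two[OF xe(1,2,3), of q] F2(1) that X B by auto
  have xnb: "x2 \<noteq> q" "x1 \<noteq> q" if "x \<noteq> b" using end_neq[OF xe(2) F2(1) that] end_neq[OF xe(1) F2(1) that] by auto
  have ya_p: "y1 = p" "y2 \<noteq> p" if "y = a"
    using ends_two[OF ye(1,2,3), of p] F1(1) that Y B by auto
  have yna: "y1 \<noteq> p" "y2 \<noteq> p" if "y \<noteq> a" using end_neq[OF ye(1) F1(1) that] end_neq[OF ye(2) F1(1) that] by auto
  have pqn: "p \<noteq> q" using B by simp
  \<comment> \<open>Unless \<open>x = b\<close> and \<open>y = a\<close>, the chords
    \<open>x\<close> and \<open>y\<close> would have too many common points:
    \<open>pattern_generic\<close> covers the case that both fail, \<open>pattern_special\<close>
    the two mixed cases.\<close>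
  have b: "x = b"
  proof (rule ccontr)
    assume xb: "x \<noteq> b"
    show False
    proof (cases "y = a")
      case False
      have "y1 < p" "q < x2" using B xnb[OF xb] yna[OF False] by auto
      note s1 = separated_generic[OF this(1) B(2) this(2) X Y]
      show False using pattern_generic[OF f1 f2 pqn False xb xy xe ye s1] .
    next
      case True
      have f2': "first_crossing q b a w" using f2 True by simp
      have "q < x2" using B xnb[OF xb] by auto
      note s1 = separated_left[OF B(2) this X[unfolded ya_p(1)[OF True]] Y[unfolded ya_p(1)[OF True]] x1y2(1)]
      show False using pattern_special[OF f2' f1 pqn[symmetric] xb _ ya_p(2)[OF True] xe(2,1) xe(3)[symmetric] s1] ye(2) True by simp
    qed
  qed
  have a: "y = a"
  proof (rule ccontr)
    assume ya: "y \<noteq> a"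
    have f1': "first_crossing p a b v" using f1 b by simp
    have "y1 < p" using B yna[OF ya] by auto
    note s1 = separated_right[OF this B(2) X[unfolded xb_q(1)[OF b]] Y[unfolded xb_q(1)[OF b]] x1y2(1)]
    show False using pattern_special[OF f1' f2 pqn ya _ xb_q(2)[OF b] ye s1] xe(1) b by simp
  qed
  have g1: "first_crossing p a b v" and g2: "first_crossing q b a w" using f1 f2 a b by auto
  have x1b: "is_end x1 b" "is_end x2 b" and y2a: "is_end y2 a" "is_end y1 a" using xe ye a b by auto
  note N = xb_q[OF b] ya_p[OF a]
  have vw: "v = w"
  proof (rule ccontr)
    assume "v \<noteq> w"
    then have "\<not> separated p x1 q y2" "\<not> separated p y2 q x1"
      using mutual_first[OF g1 g2 _ x1b(1) N(2) y2a(1) N(4)] by auto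
    moreover have "separated p x1 q y2 \<or> separated p y2 q x1"
      by (rule separated_both[OF B(2) X[unfolded N(1,3)] Y[unfolded N(1,3)] x1y2(1)])
    ultimately show False by blast
  qed
  have "\<not> (p < t \<and> t < q)" if "is_end t i" for t i
  proof
    assume t: "p < t \<and> t < q"
    define Z where "Z = {t \<in> E. p < t \<and> t < q}"
    have Z: "finite Z" "t \<in> Z" unfolding Z_def using E t that by (auto simp: E_def)
    \<comment> \<open>For the leftmost end between \<open>p\<close> and \<open>q\<close>, the left
      end of its straddling crossed chord can only be at \<open>p\<close> or further left. If it is
      at \<open>p\<close>, that chord is \<open>a\<close>, and its right end lies beyond
      \<open>q\<close>.\<close>
    define z where "z = Min Z"
    have zZ: "z \<in> Z" unfolding z_def using Z by (intro Min_in) auto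
    then have z: "z \<in> E" "p < z" "z < q" unfolding Z_def by auto
    have zmin: "s \<le> p" if "s \<in> E" "s < z" for s
    proof (rule ccontr)
      assume "\<not> s \<le> p"
      then have "s \<in> Z" unfolding Z_def using that z by auto
      then have "z \<le> s" unfolding z_def using Z by auto
      then show False using that by auto
    qed
    have mid: "lw z < z" "z < hg z" using notRR[OF z(1)] notLL[OF z(1)] z WE[OF pq(1)] WE[OF pq(2)] by auto
    note F3 = first_crossingD[OF f[OF z(1)]]
    have ca: "ow z \<noteq> a"
    proof
      assume "ow z = a"
      then have "z = y1 \<or> z = y2" using ends_two[OF y2a(2,1) ye(3)] F3(1) by auto
      then show False using N B X Y z by auto
    qed
    have cb: "ow z \<noteq> b"
    proof
      assume "ow z = b"
      then have "z = x1 \<or> z = x2" using ends_two[OF x1b xe(3)] F3(1) by auto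
      then show False using N B X Y z by auto
    qed
    note le = lh[OF z(1)]
    show False
    proof (cases "xx z = a")
      case False
      have "lw z \<noteq> p" using end_neq[OF le(1) F1(1) False] .
      then have lp: "lw z < p" using zmin[OF le(4) mid(1)] by auto
      have "separated p q z (lw z)" using lp z by (intro separatedI(1)) auto
      then show False using no_end_under_triangle[OF g1 g2[folded vw] f[OF z(1)] ca cb le(1)] lp B by auto
    next
      case True
      have "hg z = y1 \<or> hg z = y2" using ends_two[OF y2a(2,1) ye(3)] le(2) True by auto
      then have h: "hg z = y2" using mid z N by auto
      then have hq: "q < hg z" using Y N mid z B by auto
      have "separated p q z (hg z)" using hq z by (intro separatedI(2)) auto
      then show False using no_end_under_triangle[OF g1 g2[folded vw] f[OF z(1)] ca cb le(2)] hq B by auto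
    qed
  qed
  then show ?thesis using g1 g2 vw B(2) by blast
qed

text \<open>Among the chords without crossings take one of shortest span. If no chord ends under it,
  the first alternative holds. Otherwise the chords under it form a system closed under crossing,
  because leaving it would mean crossing the uncrossed chord, and by minimality each of them is
  crossed; so \<open>crossed_triangle\<close> applies to them.\<close>

lemma empty_region:
  assumes ne: "I \<noteq> {}"
  shows "(\<exists>i\<in>I. (\<forall>j\<in>I. j \<noteq> i \<longrightarrow> K i \<inter> K j = {}) \<and> (\<forall>t j. is_end t j \<longrightarrow> \<not> (lo i < t \<and> t < hi i))) \<or>
    (\<exists>p q a b v. p < q \<and> first_crossing p a b v \<and> first_crossing q b a v \<and> (\<forall>t i. is_end t i \<longrightarrow> \<not> (p < t \<and> t < q)))"
proof (cases "\<exists>i\<in>I. \<forall>j\<in>I. j \<noteq> i \<longrightarrow> K i \<inter> K j = {}")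
  case False
  then have "\<And>i. i \<in> I \<Longrightarrow> \<exists>j\<in>I. j \<noteq> i \<and> K i \<inter> K j \<noteq> {}" by blast
  from crossed_triangle[OF ne this] show ?thesis by blast
next
  case True
  define U where "U = {i\<in>I. \<forall>j\<in>I. j \<noteq> i \<longrightarrow> K i \<inter> K j = {}}"
  have U: "finite U" "U \<noteq> {}" using fin True unfolding U_def by auto
  obtain i where i: "is_arg_min (\<lambda>i. hi i - lo i) (\<lambda>i. i \<in> U) i"
    using ex_is_arg_min_if_finite[OF U] by blast
  then have iU: "i \<in> U" by (simp add: is_arg_min_def)
  then have iI: "i \<in> I" and un: "\<And>j. j \<in> I \<Longrightarrow> j \<noteq> i \<Longrightarrow> K i \<inter> K j = {}" unfolding U_def by auto
  define J where "J = {j\<in>I. lo i < lo j \<and> hi j < hi i}"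
  have JI: "J \<subseteq> I" unfolding J_def by auto
  have inJ: "j \<in> J" if t: "is_end t j" "lo i < t" "t < hi i" for t j
  proof -
    have jI: "j \<in> I" using t end_I by auto
    have ji: "j \<noteq> i" using t unfolding is_end_def by auto
    have "\<not> separated (lo i) (hi i) (lo j) (hi j)" using no_separation[OF iI jI un[OF jI ji]] .
    then show ?thesis
      using t ends_distinct[OF iI jI ji[symmetric]] range[OF iI] range[OF jI] jI
      unfolding is_end_def separated_def J_def by (auto simp: min_def max_def split: if_splits)
  qed
  have crossJ: "k \<in> J" if jk: "j \<in> J" "k \<in> I" "k \<noteq> j" "K j \<inter> K k \<noteq> {}" for j k
  proof (rule ccontr)
    assume kJ: "k \<notin> J"
    obtain z where z: "z \<in> K j" "z \<in> K k" using jk by blast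
    have jI: "j \<in> I" and ji: "j \<noteq> i" using jk unfolding J_def by auto
    have ki: "k \<noteq> i" using un[OF jI ji] jk(4) by (auto simp: Int_commute)
    have je: "is_end (lo j) j" and ke: "is_end (lo k) k" using jI jk by (auto simp: is_end_def)
    have "\<not> (lo i < lo k \<and> lo k < hi i)" using inJ[OF ke] kJ by auto
    moreover have "lo k \<noteq> lo i" "lo k \<noteq> hi i" using ends_distinct[OF iI jk(2) ki[symmetric]] by auto
    ultimately have sep: "separated (lo i) (hi i) (lo j) (lo k)"
      using jk(1) range[OF iI] range[OF jI] ends_distinct[OF iI jI ji[symmetric]] ends_distinct[OF jI jk(2) jk(3)[symmetric]]
      unfolding separated_def J_def by (auto simp: min_def max_def)
    obtain c where c: "path c" "pathstart c = g (lo j)" "pathfinish c = g (lo k)" "path_image c = L j z (lo j) \<union> L k z (lo k)"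
      "path_image c - {g (lo j), g (lo k)} \<subseteq> S"
      using bent_path[OF jI jk(2) jk(3)[symmetric] z je ke] .
    have "K i \<inter> path_image c \<noteq> {}"
      by (rule paths_meet[OF sep _ _ _ _ _ _ _ _ _ _ _ _ c(1-3,5)])
        (use arc[OF iI] inS[OF iI] range[OF iI] range[OF jI] range[OF jk(2)] in \<open>auto simp: arc_imp_path\<close>)
    then show False using c(4) L_sub[OF jI z(1)] L_sub[OF jk(2) z(2)] un[OF jI ji] un[OF jk(2) ki] by blast
  qed
  show ?thesis
  proof (cases "J = {}")
    case True
    then have "\<forall>t j. is_end t j \<longrightarrow> \<not> (lo i < t \<and> t < hi i)" using inJ by blast
    then show ?thesis using iI un by blast
  next
    case False
    interpret sub: chords g S J lo hi d
    proof unfold_locales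
      have JIs: "j \<in> I" if "j \<in> J" for j using JI that by auto
      show "finite J" using finite_subset[OF JI fin] .
      show "0 < lo i \<and> lo i < hi i \<and> hi i < 1" if "i \<in> J" for i using range[OF JIs[OF that]] .
      show "arc (d i) \<and> pathstart (d i) = g (lo i) \<and> pathfinish (d i) = g (hi i)" if "i \<in> J" for i using arc[OF JIs[OF that]] .
      show "K i - {g (lo i), g (hi i)} \<subseteq> S" if "i \<in> J" for i using inS[OF JIs[OF that]] .
      show "{lo i, hi i} \<inter> {lo j, hi j} = {}" if "i \<in> J" "j \<in> J" "i \<noteq> j" for i j
        using ends_distinct[OF JIs[OF that(1)] JIs[OF that(2)] that(3)] .
      show "finite (K i \<inter> K j) \<and> card (K i \<inter> K j) \<le> 2" if "i \<in> J" "j \<in> J" "i \<noteq> j" for i j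
        using cross2[OF JIs[OF that(1)] JIs[OF that(2)] that(3)] .
      show "card (K i \<inter> K j) \<le> 1" if "i \<in> J" "j \<in> J" "i \<noteq> j" "separated (lo i) (hi i) (lo j) (hi j)" for i j
        using cross1[OF JIs[OF that(1)] JIs[OF that(2)] that(3,4)] .
      show "K i \<inter> K j \<inter> K k = {}" if "i \<in> J" "j \<in> J" "k \<in> J" "i \<noteq> j" "i \<noteq> k" "j \<noteq> k" for i j k
        using triple[OF JIs[OF that(1)] JIs[OF that(2)] JIs[OF that(3)] that(4-6)] .
    qed
    have "\<exists>k\<in>J. k \<noteq> j \<and> K j \<inter> K k \<noteq> {}" if j: "j \<in> J" for j
    proof -
      have "hi j - lo j < hi i - lo i" using j unfolding J_def by auto
      then have "j \<notin> U" using i by (auto simp: is_arg_min_def)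
      then obtain k where "k \<in> I" "k \<noteq> j" "K j \<inter> K k \<noteq> {}" using j JI unfolding U_def by blast
      then show ?thesis using crossJ[OF j] by blast
    qed
    from sub.crossed_triangle[OF False this]
    obtain p q a b v where h: "p < q" "sub.first_crossing p a b v" "sub.first_crossing q b a v" "\<And>t i. sub.is_end t i \<Longrightarrow> \<not> (p < t \<and> t < q)" by blast
    \<comment> \<open>First crossings within the smaller system are first crossings in the whole
      one, since chords outside it meet none of its members.\<close>
    have tr: "first_crossing p' a' b' v" if s: "sub.first_crossing p' a' b' v" for p' a' b'
    proof -
      note D = sub.first_crossingD[OF s]
      have e: "is_end p' a'" using D(1) JI unfolding sub.is_end_def is_end_def by auto
      have aI: "a' \<in> I" "b' \<in> I" using D(2,3) JI by auto
      have "(L a' v p' - {v}) \<inter> K j = {}" if j: "j \<in> I" "j \<noteq> a'" for j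
      proof (cases "j \<in> J")
        case True
        then show ?thesis using D(7)[OF True j(2)] unfolding L_def sub.L_def by blast
      next
        case False
        then have "K a' \<inter> K j = {}" using crossJ[OF D(2) j] by blast
        then show ?thesis using L_sub[OF aI(1) D(5), of p'] by blast
      qed
      then show ?thesis unfolding first_crossing_def using e aI D(4,5,6) by blast
    qed
    have "\<not> (p < t \<and> t < q)" if t: "is_end t j" for t j
    proof
      assume b: "p < t \<and> t < q"
      have ab: "a \<in> J" "b \<in> J" using sub.first_crossingD(2)[OF h(2)] sub.first_crossingD(2)[OF h(3)] .
      have "p = lo a \<or> p = hi a" "q = lo b \<or> q = hi b"
        using sub.first_crossingD(1)[OF h(2)] sub.first_crossingD(1)[OF h(3)] unfolding sub.is_end_def by auto
      then have "lo i < p" "q < hi i" using ab sub.range[OF ab(1)] sub.range[OF ab(2)] unfolding J_def by auto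
      then have "j \<in> J" using inJ[OF t] b by auto
      then have "sub.is_end t j" using t unfolding sub.is_end_def is_end_def by auto
      then show False using h(4) b by blast
    qed
    then show ?thesis using h(1) tr[OF h(2)] tr[OF h(3)] by blast
  qed
qed

end

section \<open>Cells of an arrangement\<close>

lemma pseudocircle_at:
  assumes "pseudocircle C" "z \<in> C"
  obtains g :: "real \<Rightarrow> complex" where "simple_path g" "pathfinish g = pathstart g" "path_image g = C" "g 0 = z" "g 1 = z"
proof -
  obtain h :: "real \<Rightarrow> complex" where h: "simple_path h" "pathfinish h = pathstart h" "path_image h = C"
    using assms(1) unfolding pseudocircle_def by blast
  obtain u where u: "0 \<le> u" "u \<le> 1" "h u = z" using assms(2) h(3) by (auto simp: path_image_def)
  let ?g = "shiftpath u h"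
  have s: "pathstart ?g = z" "pathfinish ?g = z" using pathstart_shiftpath[of u h] pathfinish_shiftpath[of u h] u h by auto
  show thesis
    by (rule that[of ?g]) (use s h u in \<open>auto simp: simple_path_shiftpath path_image_shiftpath pathstart_def pathfinish_def\<close>)
qed

lemma pseudocircle_compact: "pseudocircle C \<Longrightarrow> compact C"
  unfolding pseudocircle_def using compact_simple_path_image by blast

lemma pseudocircle_infinite:
  assumes "pseudocircle C" shows "infinite C"
proof
  assume "finite C"
  obtain h :: "real \<Rightarrow> complex" where h: "simple_path h" "path_image h = C"
    using assms(1) unfolding pseudocircle_def by blast
  have "inj_on h {0<..<1}" using h(1) unfolding simple_path_def loop_free_def inj_on_def by force
  moreover have "h ` {0<..<1} \<subseteq> C" unfolding h(2)[symmetric] path_image_def by auto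
  ultimately have "finite {0<..<(1::real)}" using \<open>finite C\<close> by (meson finite_imageD finite_subset)
  then show False using infinite_Ioo[of 0 "1::real"] by simp
qed

text \<open>The two common points split \<open>D\<close> into two arcs, each contained in one side
  of \<open>C\<close>. Since \<open>cross_twice\<close> makes \<open>D\<close> meet both sides, the
  arcs lie on opposite sides, and each side contains exactly one.\<close>

lemma chord_exists:
  assumes C: "pseudocircle C" and D: "pseudocircle D" and ct: "cross_twice C D" and uw: "C \<inter> D = {u,w}" "u \<noteq> w"
    and S: "S = inside C \<or> S = outside C"
  obtains d :: "real \<Rightarrow> complex" where "arc d" "pathstart d = u" "pathfinish d = w" "path_image d = (D \<inter> S) \<union> {u,w}"
    "path_image d - {u,w} \<subseteq> S"
proof -
  obtain g :: "real \<Rightarrow> complex" where g: "simple_path g" "pathfinish g = pathstart g" "path_image g = C"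
    using C unfolding pseudocircle_def by blast
  obtain h :: "real \<Rightarrow> complex" where h: "simple_path h" "pathfinish h = pathstart h" "path_image h = D"
    using D unfolding pseudocircle_def by blast
  obtain e1 e2 where e: "arc e1" "arc e2" "pathstart e1 = u" "pathfinish e1 = w" "pathstart e2 = w" "pathfinish e2 = u"
    "path_image e1 \<inter> path_image e2 = {u,w}" "path_image e1 \<union> path_image e2 = D"
    using exists_double_arc[OF h(1,2), of u w] uw h(3) by blast
  have con: "connected (path_image e1 - {u,w})" "connected (path_image e2 - {u,w})"
    using connected_simple_path_endless[of e1] connected_simple_path_endless[of e2] e
    by (auto simp: arc_simple_path insert_commute)
  have dis: "(path_image e1 - {u,w}) \<inter> C = {}" "(path_image e2 - {u,w}) \<inter> C = {}" using e(8) uw(1) by blast+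
  note s1 = connected_sandwich[OF con(1) dis(1) g(3)[symmetric] g(1,2)]
  note s2 = connected_sandwich[OF con(2) dis(2) g(3)[symmetric] g(1,2)]
  have io: "inside C \<inter> outside C = {}" by simp
  have uwC: "u \<in> C" "w \<in> C" using uw by auto
  have uwn: "u \<notin> inside C" "u \<notin> outside C" "w \<notin> inside C" "w \<notin> outside C"
    using uwC inside_no_overlap[of C] outside_no_overlap[of C] by blast+
  have Dsub: "D - {u,w} \<subseteq> (path_image e1 - {u,w}) \<union> (path_image e2 - {u,w})" using e(8) by blast
  have ne: "D \<inter> inside C \<noteq> {}" "D \<inter> outside C \<noteq> {}" using ct unfolding cross_twice_def by auto
  have opp: "path_image e1 - {u,w} \<subseteq> inside C \<and> path_image e2 - {u,w} \<subseteq> outside C \<or>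
        path_image e1 - {u,w} \<subseteq> outside C \<and> path_image e2 - {u,w} \<subseteq> inside C"
  proof -
    obtain a where a: "a \<in> D" "a \<in> inside C" using ne by blast
    obtain b where b: "b \<in> D" "b \<in> outside C" using ne by blast
    have "a \<in> (path_image e1 - {u,w}) \<union> (path_image e2 - {u,w})" "b \<in> (path_image e1 - {u,w}) \<union> (path_image e2 - {u,w})"
      using Dsub a b uwn by blast+
    then show ?thesis using s1 s2 a(2) b(2) io by blast
  qed
  note result = that
  have key: thesis if k: "arc k" "pathstart k = u" "pathfinish k = w" "path_image k \<union> path_image l = D" "path_image k - {u,w} \<subseteq> S"
    "(path_image l - {u,w}) \<inter> S = {}" for k l :: "real \<Rightarrow> complex"
  proof -
    have "u \<in> path_image k" "w \<in> path_image k" using k(2,3) by (metis pathstart_in_path_image, metis pathfinish_in_path_image)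
    moreover have "u \<notin> S" "w \<notin> S" using S uwn by auto
    ultimately have "path_image k = (D \<inter> S) \<union> {u,w}" using k(4,5,6) by blast
    then show thesis using result[OF k(1-3) _ k(5)] by blast
  qed
  show thesis
  proof (cases "path_image e1 - {u,w} \<subseteq> S")
    case True
    have "path_image e1 - {u,w} \<noteq> {}" using nonempty_simple_path_endless[of e1] e(1,3,4) by (simp add: arc_imp_simple_path)
    then obtain x0 where x0: "x0 \<in> path_image e1 - {u,w}" by blast
    have io': "\<And>x. x \<in> inside C \<Longrightarrow> x \<in> outside C \<Longrightarrow> False" using io by blast
    have "(path_image e2 - {u,w}) \<inter> S = {}"
      using opp
    proof
      assume h: "path_image e1 - {u,w} \<subseteq> inside C \<and> path_image e2 - {u,w} \<subseteq> outside C"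
      then have "S = inside C" using S x0 True io' by auto
      then show ?thesis using h io' by (auto simp: disjoint_iff)
    next
      assume h: "path_image e1 - {u,w} \<subseteq> outside C \<and> path_image e2 - {u,w} \<subseteq> inside C"
      then have "S = outside C" using S x0 True io' by auto
      then show ?thesis using h io' by (auto simp: disjoint_iff)
    qed
    then show thesis using key[OF e(1,3,4,8) True] by blast
  next
    case False
    then have "path_image e2 - {u,w} \<subseteq> S" "(path_image e1 - {u,w}) \<inter> S = {}" using opp S io by blast+
    then show thesis using key[of "reversepath e2" e1] e by (simp add: arc_reversepath Un_commute)
  qed
qed

lemma card_components_le:
  assumes fin: "finite \<B>" and con: "\<And>B. B \<in> \<B> \<Longrightarrow> connected B" and un: "\<Union>\<B> = U"
  shows "finite (components U)" "card (components U) \<le> card \<B>"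
proof -
  have "\<exists>B\<in>\<B>. B \<subseteq> X \<and> B \<noteq> {}" if X: "X \<in> components U" for X
  proof -
    obtain x where x: "x \<in> X" using in_components_nonempty[OF X] by blast
    then obtain B where B: "B \<in> \<B>" "x \<in> B" using in_components_subset[OF X] un by blast
    have "B \<subseteq> X" using components_maximal[OF X con[OF B(1)]] B x un by blast
    then show ?thesis using B by blast
  qed
  then obtain f where f: "\<And>X. X \<in> components U \<Longrightarrow> f X \<in> \<B> \<and> f X \<subseteq> X \<and> f X \<noteq> {}" by metis
  have inj: "inj_on f (components U)"
  proof (rule inj_onI)
    fix X Y assume XY: "X \<in> components U" "Y \<in> components U" "f X = f Y"
    then have "X \<inter> Y \<noteq> {}" using f[OF XY(1)] f[OF XY(2)] by blast
    then show "X = Y" using components_eq[OF XY(1,2)] by blast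
  qed
  have sub: "f ` components U \<subseteq> \<B>" using f by blast
  show "finite (components U)" using inj sub fin by (meson finite_imageD finite_subset)
  show "card (components U) \<le> card \<B>" using card_inj_on_le[OF inj sub fin] .
qed

text \<open>\<open>D\<close> leaves a single crosscut on each side of \<open>C\<close>, which splits
  that side in two.\<close>

lemma two_curves_components:
  assumes C: "pseudocircle C" and D: "pseudocircle D" and ct: "cross_twice C D"
  shows "finite (components (- (C \<union> D)))" "card (components (- (C \<union> D))) \<le> 4"
proof -
  obtain u w where uw: "C \<inter> D = {u,w}" "u \<noteq> w" using ct unfolding cross_twice_def by (meson card_2_iff)
  obtain g :: "real \<Rightarrow> complex" where g: "simple_path g" "pathfinish g = pathstart g" "path_image g = C"
    using C unfolding pseudocircle_def by blast
  obtain e1 e2 where e: "arc e1" "arc e2" "pathstart e1 = u" "pathfinish e1 = w" "pathstart e2 = w" "pathfinish e2 = u"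
    "path_image e1 \<inter> path_image e2 = {u,w}" "path_image e1 \<union> path_image e2 = C"
    using exists_double_arc[OF g(1,2), of u w] uw g(3) by blast
  have half: "\<exists>D1 D2. connected D1 \<and> connected D2 \<and> D1 \<union> D2 = S - D" if S: "S = inside C \<or> S = outside C" for S
  proof -
    obtain d where d: "arc d" "pathstart d = u" "pathfinish d = w" "path_image d = (D \<inter> S) \<union> {u,w}" "path_image d - {u,w} \<subseteq> S"
      using chord_exists[OF C D ct uw S] .
    have SC: "S \<inter> C = {}" using Jordan_sides[OF g(1,2), unfolded g(3), OF S] by simp
    have e12: "path_image e1 \<inter> path_image (reversepath e2) = {u,w}" "path_image e1 \<union> path_image (reversepath e2) = C"
      "arc (reversepath e2)" "pathstart (reversepath e2) = u" "pathfinish (reversepath e2) = w"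
      using e by (auto simp: arc_reversepath)
    obtain D1 D2 where "connected D1" "connected D2" "D1 \<union> D2 = S - path_image d"
      using crosscut[OF e(1) e12(3) d(1) e(3,4) e12(4,5) d(2,3) e12(1) S[folded e12(2)] d(5)] by metis
    moreover have "S - path_image d = S - D" using d(4) SC uw by blast
    ultimately show ?thesis by metis
  qed
  obtain A1 A2 where A: "connected A1" "connected A2" "A1 \<union> A2 = inside C - D" using half[of "inside C"] by auto
  obtain B1 B2 where B: "connected B1" "connected B2" "B1 \<union> B2 = outside C - D" using half[of "outside C"] by auto
  have un: "\<Union>{A1,A2,B1,B2} = - (C \<union> D)"
  proof -
    have "\<Union>{A1,A2,B1,B2} = (A1 \<union> A2) \<union> (B1 \<union> B2)" by auto
    also have "\<dots> = (inside C \<union> outside C) - D" unfolding A(3) B(3) by blast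
    also have "\<dots> = - (C \<union> D)" by (simp add: Diff_eq)
    finally show ?thesis .
  qed
  have con: "\<And>B. B \<in> {A1,A2,B1,B2} \<Longrightarrow> connected B" using A(1,2) B(1,2) by auto
  have fin: "finite {A1,A2,B1,B2}" by simp
  show "finite (components (- (C \<union> D)))" by (rule card_components_le(1)[OF fin con un])
  have "card {A1,A2,B1,B2} \<le> 4" by (simp add: card_insert_if)
  then show "card (components (- (C \<union> D))) \<le> 4" using card_components_le(2)[OF fin con un] by linarith
qed

text \<open>A way to localise an arrangement at \<open>y\<close>: \<open>T\<close> carries the
  curves through \<open>y\<close> and \<open>K1\<close> what stays away from it. A small ball misses
  \<open>K1\<close>, so \<open>K1\<close> does not separate its points, and by Janiszewski's theorem
  the union separates them only if \<open>T\<close> does. The applications have to arrange that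
  \<open>K1 \<inter> T\<close> is connected.\<close>

lemma local_cell:
  fixes K1 T :: "complex set"
  assumes "compact K1" "closed T" "connected (K1 \<inter> T)" "y \<notin> K1"
  obtains e where "0 < e" "ball y e \<inter> K1 = {}"
    "\<And>x x'. x \<in> ball y e \<Longrightarrow> x' \<in> ball y e \<Longrightarrow> connected_component (- T) x x' \<Longrightarrow> connected_component (- (K1 \<union> T)) x x'"
proof -
  have "open (- K1)" using assms(1) by (simp add: compact_imp_closed open_Compl)
  then obtain e where e: "0 < e" "ball y e \<subseteq> - K1" using assms(4) by (meson ComplI open_contains_ball_eq)
  have "connected_component (- (K1 \<union> T)) x x'" if "x \<in> ball y e" "x' \<in> ball y e" "connected_component (- T) x x'" for x x'
  proof (rule Janiszewski[OF assms(1-3) _ that(3)])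
    have "connected (ball y e)" by simp
    then show "connected_component (- K1) x x'"
      unfolding connected_component_def using e(2) that(1,2) by blast
  qed
  moreover have "ball y e \<inter> K1 = {}" using e(2) by blast
  ultimately show thesis using that[OF e(1)] by blast
qed

text \<open>Supplies the connected set for \<open>local_cell\<close>: \<open>M\<close> is the closed
  curve without an open arc around its base point, short enough to keep all of
  \<open>P\<close>.\<close>

lemma closed_path_avoid:
  fixes g :: "real \<Rightarrow> complex"
  assumes g: "simple_path g" "g 0 = z" "g 1 = z" and P: "finite P" "P \<subseteq> path_image g" "z \<notin> P"
  obtains M where "M \<subseteq> path_image g" "P \<subseteq> M" "z \<notin> M" "compact M" "connected M"
proof -
  define Q where "Q = {t \<in> {0..1}. g t \<in> P}"
  have inj: "inj_on g {0<..<1}" using g(1) unfolding simple_path_def loop_free_def inj_on_def by force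
  have Q01: "Q \<subseteq> {0<..<1}" using P(3) g(2,3) unfolding Q_def by (force simp: less_le)
  have finQ: "finite Q"
  proof (rule finite_imageD)
    show "finite (g ` Q)" using P(1) by (rule finite_subset[rotated]) (auto simp: Q_def)
    show "inj_on g Q" using inj Q01 by (rule inj_on_subset)
  qed
  define e where "e = Min (insert (1/3) (Q \<union> (\<lambda>t. 1 - t) ` Q))"
  have finS: "finite (insert (1/3) (Q \<union> (\<lambda>t. 1 - t) ` Q))" using finQ by simp
  have e: "0 < e" "e \<le> 1/3" "\<And>t. t \<in> Q \<Longrightarrow> e \<le> t \<and> t \<le> 1 - e"
  proof -
    show "0 < e" unfolding e_def using finS Q01 by (subst Min_gr_iff) auto
    show "e \<le> 1/3" unfolding e_def using finS by (intro Min_le) auto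
    fix t assume "t \<in> Q"
    then have "e \<le> t" "e \<le> 1 - t" unfolding e_def using finS by (auto intro!: Min_le)
    then show "e \<le> t \<and> t \<le> 1 - e" by auto
  qed
  have "continuous_on {0..1} g" using g(1) by (simp add: simple_path_def path_def)
  then have cont: "continuous_on {e..1-e} g" by (rule continuous_on_subset) (use e(1,2) in auto)
  show thesis
  proof (rule that[of "g ` {e..1-e}"])
    show "g ` {e..1-e} \<subseteq> path_image g" unfolding path_image_def by (rule image_mono) (use e in auto)
    show "P \<subseteq> g ` {e..1-e}"
    proof
      fix x assume "x \<in> P"
      then obtain t where "t \<in> {0..1}" "g t = x" using P(2) unfolding path_image_def by blast
      then have "t \<in> Q" using \<open>x \<in> P\<close> unfolding Q_def by blast
      then show "x \<in> g ` {e..1-e}" using e(3) \<open>g t = x\<close> by auto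
    qed
    show "z \<notin> g ` {e..1-e}"
    proof
      assume "z \<in> g ` {e..1-e}"
      then obtain t where t: "t \<in> {e..1-e}" "g t = g 0" using g(2) by auto
      then have "t \<in> {0..1}" using e(1) by auto
      then have "t = 0 \<or> t = 1" using g(1) t(2) unfolding simple_path_def loop_free_def by force
      then show False using t(1) e(1) by auto
    qed
    show "compact (g ` {e..1-e})" "connected (g ` {e..1-e})"
      using cont by (auto intro: compact_continuous_image connected_continuous_image)
  qed
qed

section \<open>Local structure of an arrangement and the corners of its cells\<close>

locale arr =
  fixes A :: "complex set set"
  assumes arrangement: "arrangement A" and simple_arr: "simple_arr A" and pw: "pairwise_intersecting A" and n2: "2 \<le> card A"
begin

abbreviation U :: "complex set" where "U \<equiv> \<Union>A"
abbreviation cr :: "complex set" where "cr \<equiv> crossings A"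

lemma finA: "finite A" using arrangement by (simp add: arrangement_def)

lemma psc: "C \<in> A \<Longrightarrow> pseudocircle C" using arrangement by (simp add: arrangement_def)

lemma cross: "C \<in> A \<Longrightarrow> D \<in> A \<Longrightarrow> C \<noteq> D \<Longrightarrow> cross_twice C D"
proof -
  assume CD: "C \<in> A" "D \<in> A" "C \<noteq> D"
  have "C \<inter> D = {} \<or> cross_twice C D" using arrangement CD unfolding arrangement_def by auto
  moreover have "C \<inter> D \<noteq> {}" using pw CD unfolding pairwise_intersecting_def by auto
  ultimately show ?thesis by simp
qed

lemma cross_card: "C \<in> A \<Longrightarrow> D \<in> A \<Longrightarrow> C \<noteq> D \<Longrightarrow> finite (C \<inter> D) \<and> card (C \<inter> D) = 2"
  using cross unfolding cross_twice_def by (metis card.infinite zero_neq_numeral)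

lemma triple_empty: "C \<in> A \<Longrightarrow> D \<in> A \<Longrightarrow> E \<in> A \<Longrightarrow> C \<noteq> D \<Longrightarrow> C \<noteq> E \<Longrightarrow> D \<noteq> E \<Longrightarrow> C \<inter> D \<inter> E = {}"
  using simple_arr unfolding simple_arr_def by blast

lemma compactU: "compact U" using finA psc pseudocircle_compact by (intro compact_Union) auto

lemma closedU: "closed U" using compactU by (rule compact_imp_closed)

lemma cr_iff: "z \<in> cr \<longleftrightarrow> (\<exists>C\<in>A. \<exists>D\<in>A. C \<noteq> D \<and> z \<in> C \<and> z \<in> D)"
  unfolding crossings_def by blast

lemma crI: "C \<in> A \<Longrightarrow> D \<in> A \<Longrightarrow> C \<noteq> D \<Longrightarrow> z \<in> C \<Longrightarrow> z \<in> D \<Longrightarrow> z \<in> cr"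
  using cr_iff by blast

lemma other_curve: assumes "C \<in> A" obtains D where "D \<in> A" "D \<noteq> C"
proof -
  have "\<not> A \<subseteq> {C}" using n2 card_mono[of "{C}" A] by auto
  then show thesis using that by blast
qed

lemma cr_card: "finite cr \<and> card cr \<le> card A * (card A - 1)"
proof -
  define P where "P = {X. X \<subseteq> A \<and> card X = 2}"
  have P: "finite P" "card P = card A choose 2" unfolding P_def using finA n_subsets[OF finA, of 2] by auto
  have two: "finite (\<Inter>X) \<and> card (\<Inter>X) = 2" if X: "X \<in> P" for X
  proof -
    obtain C D where "X = {C,D}" "C \<noteq> D" using X unfolding P_def by (auto simp: card_2_iff)
    then show ?thesis using cross_card[of C D] X unfolding P_def by auto
  qed
  have "cr = (\<Union>X\<in>P. \<Inter>X)"
  proof (rule set_eqI)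
    fix z
    show "z \<in> cr \<longleftrightarrow> z \<in> (\<Union>X\<in>P. \<Inter>X)"
    proof
      assume "z \<in> cr"
      then obtain C D where "C \<in> A" "D \<in> A" "C \<noteq> D" "z \<in> C" "z \<in> D" unfolding cr_iff by blast
      then have "{C,D} \<in> P" "z \<in> \<Inter>{C,D}" unfolding P_def by auto
      then show "z \<in> (\<Union>X\<in>P. \<Inter>X)" by blast
    next
      assume "z \<in> (\<Union>X\<in>P. \<Inter>X)"
      then obtain X where X: "X \<in> P" "z \<in> \<Inter>X" by blast
      then obtain C D where "X = {C,D}" "C \<noteq> D" unfolding P_def by (auto simp: card_2_iff)
      then show "z \<in> cr" using X unfolding cr_iff P_def by auto
    qed
  qed
  moreover have "card (\<Union>X\<in>P. \<Inter>X) \<le> (\<Sum>X\<in>P. card (\<Inter>X))" using P(1) by (rule card_UN_le)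
  moreover have "(\<Sum>X\<in>P. card (\<Inter>X)) = 2 * card P" using two by simp
  moreover have "even (card A * (card A - 1))" by (cases "even (card A)") auto
  then have "2 * (card A choose 2) = card A * (card A - 1)" by (simp add: choose_two)
  ultimately show ?thesis using P two by auto
qed

lemma finite_cr: "finite cr" using cr_card by simp

lemma cell_facts:
  assumes F: "F \<in> cells A"
  shows "open F" "connected F" "F \<noteq> {}" "F \<inter> U = {}" "frontier F \<subseteq> U" "closure F = F \<union> frontier F"
    "\<And>x y. x \<in> F \<Longrightarrow> connected_component (- U) x y \<Longrightarrow> y \<in> F"
proof -
  have F': "F \<in> components (- U)" using F by (simp add: cells_def)
  show "open F" using open_components[OF _ F'] closedU by (simp add: open_Compl)
  show "connected F" using F' in_components_connected by blast
  show "F \<noteq> {}" using F' in_components_nonempty by blast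
  show "F \<inter> U = {}" using F' in_components_subset by blast
  show "frontier F \<subseteq> U" using frontier_of_components_closed_complement[OF closedU F'] .
  show "closure F = F \<union> frontier F" by (simp add: closure_Un_frontier)
  fix x y assume xF: "x \<in> F" and c: "connected_component (- U) x y"
  then obtain T where "connected T" "T \<subseteq> - U" "x \<in> T" "y \<in> T" unfolding connected_component_def by blast
  then show "y \<in> F" using components_maximal[OF F', of T] xF by blast
qed

lemma cells_disjoint: "F \<in> cells A \<Longrightarrow> G \<in> cells A \<Longrightarrow> F \<inter> G \<noteq> {} \<Longrightarrow> F = G"
  using components_eq unfolding cells_def by blast

lemma side_of_cell:
  assumes F: "F \<in> cells A" and C: "C \<in> A"
  obtains S where "S = inside C \<or> S = outside C" "F \<subseteq> S"
proof -
  obtain g :: "real \<Rightarrow> complex" where g: "simple_path g" "pathfinish g = pathstart g" "path_image g = C"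
    using psc[OF C] unfolding pseudocircle_def by blast
  have "F \<inter> C = {}" using cell_facts(4)[OF F] C by blast
  then show thesis using connected_sandwich[OF cell_facts(2)[OF F] _ g(3)[symmetric] g(1,2)] that by blast
qed

lemma local_edge:
  assumes C: "C \<in> A" and y: "y \<in> C" "y \<notin> cr"
  obtains e where "0 < e" "ball y e \<inter> U \<subseteq> C"
    "\<And>x x'. x \<in> ball y e \<Longrightarrow> x' \<in> ball y e \<Longrightarrow> connected_component (- C) x x' \<Longrightarrow> connected_component (- U) x x'"
proof -
  obtain g :: "real \<Rightarrow> complex" where g: "simple_path g" "pathfinish g = pathstart g" "path_image g = C" "g 0 = y" "g 1 = y"
    using pseudocircle_at[OF psc[OF C] y(1)] .
  define P where "P = C \<inter> cr"
  obtain M where M: "M \<subseteq> C" "P \<subseteq> M" "y \<notin> M" "compact M" "connected M"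
    using closed_path_avoid[OF g(1,4,5), of P] finite_cr y(2) unfolding g(3) P_def by auto
  \<comment> \<open>\<open>M\<close> joins the other curves so that their common part with
    \<open>C\<close> becomes connected; together with \<open>C\<close> the union is still the whole
    arrangement.\<close>
  define K1 where "K1 = \<Union>(A - {C}) \<union> M"
  have cK: "compact K1" unfolding K1_def using finA psc pseudocircle_compact M(4)
    by (intro compact_Un compact_Union) auto
  have "\<Union>(A - {C}) \<inter> C \<subseteq> M"
  proof
    fix z assume z: "z \<in> \<Union>(A - {C}) \<inter> C"
    then obtain D where "D \<in> A" "D \<noteq> C" "z \<in> D" by blast
    then have "z \<in> cr" using crI[OF C, of D z] z by auto
    then show "z \<in> M" using M(2) z unfolding P_def by auto
  qed
  then have "K1 \<inter> C = M" unfolding K1_def using M(1) by blast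
  then have con: "connected (K1 \<inter> C)" using M(5) by simp
  have "y \<notin> D" if "D \<in> A - {C}" for D using crI[OF C, of D y] y that by auto
  then have yK: "y \<notin> K1" unfolding K1_def using M(3) by auto
  have KU: "K1 \<union> C = U" unfolding K1_def using M(1) C by blast
  have clC: "closed C" using psc[OF C] pseudocircle_compact compact_imp_closed by blast
  obtain e where e: "0 < e" "ball y e \<inter> K1 = {}"
    "\<And>x x'. x \<in> ball y e \<Longrightarrow> x' \<in> ball y e \<Longrightarrow> connected_component (- C) x x' \<Longrightarrow> connected_component (- (K1 \<union> C)) x x'"
    using local_cell[OF cK clC con yK] by metis
  have "ball y e \<inter> U \<subseteq> C" using e(2) unfolding K1_def by blast
  then show thesis using that[of e] e KU by simp
qed

lemma local_vertex:
  assumes C: "C \<in> A" and D: "D \<in> A" and CD: "C \<noteq> D" and v: "v \<in> C" "v \<in> D"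
  obtains e where "0 < e"
    "\<And>x x'. x \<in> ball v e \<Longrightarrow> x' \<in> ball v e \<Longrightarrow> connected_component (- (C \<union> D)) x x' \<Longrightarrow> connected_component (- U) x x'"
proof -
  have av: "\<exists>M. M \<subseteq> E \<and> (E \<inter> cr) - {v} \<subseteq> M \<and> v \<notin> M \<and> compact M \<and> connected M" if E: "E \<in> A" "v \<in> E" for E
  proof -
    obtain g :: "real \<Rightarrow> complex" where g: "simple_path g" "pathfinish g = pathstart g" "path_image g = E" "g 0 = v" "g 1 = v"
      using pseudocircle_at[OF psc[OF E(1)] E(2)] .
    obtain M where "M \<subseteq> path_image g" "(E \<inter> cr) - {v} \<subseteq> M" "v \<notin> M" "compact M" "connected M"
      using closed_path_avoid[OF g(1,4,5), of "(E \<inter> cr) - {v}"] finite_cr g(3) by auto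
    then show ?thesis using g(3) by blast
  qed
  obtain M where M: "M \<subseteq> C" "(C \<inter> cr) - {v} \<subseteq> M" "v \<notin> M" "compact M" "connected M" using av[OF C v(1)] by blast
  obtain N where N: "N \<subseteq> D" "(D \<inter> cr) - {v} \<subseteq> N" "v \<notin> N" "compact N" "connected N" using av[OF D v(2)] by blast
  \<comment> \<open>The second common point of the two curves lies in both \<open>M\<close> and
    \<open>N\<close> and links them into one connected set.\<close>
  obtain v' where v': "v' \<in> C" "v' \<in> D" "v' \<noteq> v"
  proof -
    have "\<not> C \<inter> D \<subseteq> {v}" using cross_card[OF C D CD] card_mono[of "{v}" "C \<inter> D"] by auto
    then show thesis using that by blast
  qed
  have "v' \<in> cr" using crI[OF C D CD v'(1,2)] .
  then have v'MN: "v' \<in> M" "v' \<in> N" using M(2) N(2) v' by blast+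
  define K1 where "K1 = \<Union>(A - {C,D}) \<union> (M \<union> N)"
  have cK: "compact K1" unfolding K1_def using finA psc pseudocircle_compact M(4) N(4)
    by (intro compact_Un compact_Union) auto
  have vE: "v \<notin> E" if "E \<in> A - {C,D}" for E
    using triple_empty[OF C D, of E] CD v that by blast
  have sub: "\<Union>(A - {C,D}) \<inter> (C \<union> D) \<subseteq> M \<union> N"
  proof
    fix x assume x: "x \<in> \<Union>(A - {C,D}) \<inter> (C \<union> D)"
    then obtain E where E: "E \<in> A - {C,D}" "x \<in> E" by blast
    have "x \<noteq> v" using vE[OF E(1)] E(2) by blast
    moreover have "x \<in> cr" using crI[of E C x] crI[of E D x] E x C D by auto
    ultimately show "x \<in> M \<union> N" using x M(2) N(2) by blast
  qed
  then have "K1 \<inter> (C \<union> D) = M \<union> N" unfolding K1_def using M(1) N(1) by blast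
  then have con: "connected (K1 \<inter> (C \<union> D))" using connected_Un[OF M(5) N(5)] v'MN by auto
  have vK: "v \<notin> K1" unfolding K1_def using M(3) N(3) vE by blast
  have KU: "K1 \<union> (C \<union> D) = U" unfolding K1_def using M(1) N(1) C D by blast
  have cl: "closed (C \<union> D)" using psc C D pseudocircle_compact compact_imp_closed by blast
  obtain e where e: "0 < e" "ball v e \<inter> K1 = {}"
    "\<And>x x'. x \<in> ball v e \<Longrightarrow> x' \<in> ball v e \<Longrightarrow> connected_component (- (C \<union> D)) x x' \<Longrightarrow> connected_component (- (K1 \<union> (C \<union> D))) x x'"
    using local_cell[OF cK cl con vK] by metis
  show thesis using that[OF e(1)] e(3) unfolding KU by metis
qed

text \<open>Each cell at \<open>v\<close> lies in one component of the complement of the two curves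
  through \<open>v\<close>. This assignment is injective, because near \<open>v\<close> only these
  two curves separate, and there are at most four such components.\<close>

lemma cells_at_vertex:
  assumes v: "v \<in> cr"
  shows "finite {F \<in> cells A. v \<in> frontier F}" "card {F \<in> cells A. v \<in> frontier F} \<le> 4"
proof -
  obtain C D where CD: "C \<in> A" "D \<in> A" "C \<noteq> D" "v \<in> C" "v \<in> D" using v unfolding cr_iff by blast
  obtain e where e: "0 < e"
    "\<And>x x'. x \<in> ball v e \<Longrightarrow> x' \<in> ball v e \<Longrightarrow> connected_component (- (C \<union> D)) x x' \<Longrightarrow> connected_component (- U) x x'"
    using local_vertex[OF CD] by metis
  let ?X = "{F \<in> cells A. v \<in> frontier F}"
  have "\<exists>Y. Y \<in> components (- (C \<union> D)) \<and> F \<subseteq> Y" if F: "F \<in> cells A" for F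
  proof -
    have "F \<subseteq> - (C \<union> D)" using cell_facts(4)[OF F] CD by blast
    then show ?thesis using exists_component_superset[of F "- (C \<union> D)"] cell_facts(2,3)[OF F] by blast
  qed
  then obtain f where f: "\<And>F. F \<in> cells A \<Longrightarrow> f F \<in> components (- (C \<union> D)) \<and> F \<subseteq> f F" by metis
  have inj: "inj_on f ?X"
  proof (rule inj_onI)
    fix F G assume FG: "F \<in> ?X" "G \<in> ?X" "f F = f G"
    have near: "\<exists>x\<in>H. x \<in> ball v e" if H: "H \<in> ?X" for H
    proof -
      have "v \<in> closure H" using H cell_facts(6)[of H] by blast
      then have "ball v e \<inter> H \<noteq> {}" using e(1) by (metis centre_in_ball disjoint_iff open_Int_closure_eq_empty open_ball)
      then show ?thesis by blast
    qed
    obtain x y where xy: "x \<in> F" "x \<in> ball v e" "y \<in> G" "y \<in> ball v e" using near[OF FG(1)] near[OF FG(2)] by blast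
    have first_crossing: "f F \<in> components (- (C \<union> D))" "x \<in> f F" "y \<in> f F" using f[of F] f[of G] FG xy by auto
    have "connected_component (- (C \<union> D)) x y"
      unfolding connected_component_def
      using in_components_connected[OF first_crossing(1)] in_components_subset[OF first_crossing(1)] first_crossing by blast
    then have "y \<in> F" using e(2)[OF xy(2,4)] cell_facts(7)[of F x y] FG xy by blast
    then show "F = G" using cells_disjoint[of F G] FG xy by blast
  qed
  have sub: "f ` ?X \<subseteq> components (- (C \<union> D))" using f by blast
  note tc = two_curves_components[OF psc[OF CD(1)] psc[OF CD(2)] cross[OF CD(1-3)]]
  show "finite ?X" using inj sub tc(1) by (meson finite_imageD finite_subset)
  show "card ?X \<le> 4" using card_inj_on_le[OF inj sub tc(1)] tc(2) by linarith
qed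

text \<open>Near a point of an edge only \<open>C\<close> separates. So the cell fills one whole
  side of \<open>C\<close> there and has the entire nearby piece of \<open>C\<close> in its
  frontier.\<close>

lemma frontier_edge_open:
  assumes F: "F \<in> cells A" and C: "C \<in> A" and y: "y \<in> C" "y \<notin> cr" "y \<in> frontier F"
  obtains e where "0 < e" "C \<inter> ball y e \<subseteq> frontier F"
proof -
  obtain e where e: "0 < e" "ball y e \<inter> U \<subseteq> C"
    "\<And>x x'. x \<in> ball y e \<Longrightarrow> x' \<in> ball y e \<Longrightarrow> connected_component (- C) x x' \<Longrightarrow> connected_component (- U) x x'"
    using local_edge[OF C y(1,2)] by metis
  obtain S where S: "S = inside C \<or> S = outside C" "F \<subseteq> S" using side_of_cell[OF F C] .
  obtain g :: "real \<Rightarrow> complex" where g: "simple_path g" "pathfinish g = pathstart g" "path_image g = C"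
    using psc[OF C] unfolding pseudocircle_def by blast
  note J = Jordan_sides[OF g(1,2), unfolded g(3), OF S(1)]
  have "y \<in> closure F" using y(3) cell_facts(6)[OF F] by blast
  then have "ball y e \<inter> F \<noteq> {}" using e(1) by (metis centre_in_ball disjoint_iff open_Int_closure_eq_empty open_ball)
  then obtain x where x: "x \<in> F" "x \<in> ball y e" by blast
  have SF: "S \<inter> ball y e \<subseteq> F"
  proof
    fix x' assume x': "x' \<in> S \<inter> ball y e"
    have "connected_component (- C) x x'"
      unfolding connected_component_def using J(2,4) x S(2) x' by blast
    then show "x' \<in> F" using e(3) x x' cell_facts(7)[OF F x(1)] by blast
  qed
  have "C \<inter> ball y e \<subseteq> frontier F"
  proof
    fix z assume z: "z \<in> C \<inter> ball y e"
    have "z \<in> closure S" using z J(5) by (metis IntD1 UnCI closure_Un_frontier)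
    then have "z \<in> closure (S \<inter> ball y e)"
      using open_Int_closure_subset[of "ball y e" S] z by (auto simp: Int_commute)
    then have "z \<in> closure F" using closure_mono[OF SF] by blast
    moreover have "z \<notin> F" using cell_facts(4)[OF F] z C by blast
    ultimately show "z \<in> frontier F" using cell_facts(6)[OF F] by blast
  qed
  then show thesis using that e(1) by blast
qed

text \<open>The parameters before \<open>u\<close> whose points lie on the frontier form a set that
  is open by the previous lemma and also closed, hence everything; the endpoint \<open>u\<close>
  follows by taking closures.\<close>

lemma frontier_next_crossing:
  fixes g :: "real \<Rightarrow> complex"
  assumes F: "F \<in> cells A" and C: "C \<in> A"
    and g: "simple_path g" "path_image g = C" and g0: "g 0 \<notin> cr" "g 0 \<in> frontier F"
    and u: "0 < u" "u \<le> 1" "\<And>t. 0 \<le> t \<Longrightarrow> t < u \<Longrightarrow> g t \<notin> cr"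
  shows "g u \<in> frontier F"
proof -
  have "continuous_on {0..1} g" using g(1) by (simp add: simple_path_def path_def)
  then have cont: "continuous_on {0..u} g" by (rule continuous_on_subset) (use u(1,2) in auto)
  have cont': "continuous_on {0..<u} g" by (rule continuous_on_subset[OF cont]) auto
  have gC: "g t \<in> C" if "0 \<le> t" "t \<le> u" for t using that u(2) g(2) unfolding path_image_def by auto
  have "\<exists>e. 0 < e \<and> C \<inter> ball y e \<subseteq> frontier F" if "y \<in> C" "y \<notin> cr" "y \<in> frontier F" for y
    using frontier_edge_open[OF F C that] by blast
  then obtain r where r: "\<And>y. y \<in> C \<Longrightarrow> y \<notin> cr \<Longrightarrow> y \<in> frontier F \<Longrightarrow> 0 < r y \<and> C \<inter> ball y (r y) \<subseteq> frontier F"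
    by metis
  define W where "W = (\<Union>y\<in>{y \<in> C. y \<notin> cr \<and> y \<in> frontier F}. ball y (r y))"
  define T where "T = {0..<u} \<inter> g -` frontier F"
  have "T = {0..<u} \<inter> g -` W"
  proof (rule set_eqI)
    fix t
    show "t \<in> T \<longleftrightarrow> t \<in> {0..<u} \<inter> g -` W"
    proof
      assume t: "t \<in> T"
      then have "g t \<in> C" "g t \<notin> cr" "g t \<in> frontier F" using gC u(3) unfolding T_def by auto
      then have "g t \<in> W" unfolding W_def using r[of "g t"] by auto
      then show "t \<in> {0..<u} \<inter> g -` W" using t unfolding T_def by auto
    next
      assume t: "t \<in> {0..<u} \<inter> g -` W"
      then have tr: "0 \<le> t" "t < u" "g t \<in> W" by auto
      then obtain y where y: "y \<in> C" "y \<notin> cr" "y \<in> frontier F" "g t \<in> ball y (r y)" unfolding W_def by blast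
      then have "g t \<in> frontier F" using r[OF y(1-3)] gC[of t] tr by auto
      then show "t \<in> T" using tr unfolding T_def by auto
    qed
  qed
  moreover have "open W" unfolding W_def by auto
  ultimately have 1: "openin (top_of_set {0..<u}) T" using continuous_openin_preimage_gen[OF cont'] by simp
  have 2: "closedin (top_of_set {0..<u}) T" unfolding T_def by (rule continuous_closedin_preimage[OF cont']) simp
  have "connected {0..<u}" by simp
  then have "T = {} \<or> T = {0..<u}" using 1 2 connected_clopen by blast
  moreover have "0 \<in> T" unfolding T_def using g0 u(1) by simp
  ultimately have "T = {0..<u}" by blast
  then have sub: "g ` {0..<u} \<subseteq> frontier F" unfolding T_def by auto
  have cl: "closure {0..<u} = {0..u}" using u(1) by simp
  have "g ` closure {0..<u} \<subseteq> frontier F"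
    by (rule image_closure_subset) (use cont cl sub in auto)
  then show ?thesis unfolding cl using u(1) by auto
qed

text \<open>A frontier made of crossings only would be finite. Removing finitely many points does
  not disconnect the plane, so the cell would be dense and all the curves would lie in its finite
  frontier.\<close>

lemma cell_edge_point:
  assumes F: "F \<in> cells A"
  obtains C y where "C \<in> A" "y \<in> C" "y \<notin> cr" "y \<in> frontier F"
proof (rule ccontr)
  assume "\<not> thesis"
  then have "frontier F \<subseteq> cr" using that cell_facts(5)[OF F] by blast
  then have fin: "finite (frontier F)" using finite_cr finite_subset by blast
  have con: "connected (UNIV - frontier F)"
    by (rule connected_open_delete_finite) (use fin in auto)
  have eq: "UNIV - frontier F = F \<union> - closure F" and d: "F \<inter> (- closure F) = {}"
    using cell_facts(1,6)[OF F] by (auto simp: frontier_def interior_open)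
  have "F \<inter> (UNIV - frontier F) = {} \<or> (- closure F) \<inter> (UNIV - frontier F) = {}"
    by (rule connectedD[OF con]) (use cell_facts(1)[OF F] eq d in auto)
  then have "closure F = UNIV" using eq cell_facts(3)[OF F] closure_subset[of F] by blast
  then have "U \<subseteq> frontier F" using cell_facts(4,6)[OF F] by blast
  then have fU: "finite U" using fin finite_subset by blast
  obtain C where C: "C \<in> A" using n2 by fastforce
  show False using pseudocircle_infinite[OF psc[OF C]] finite_subset[OF _ fU, of C] C by blast
qed

text \<open>From a point inside an edge follow \<open>C\<close> in both directions to the nearest
  crossing. The two crossings differ because another curve meets \<open>C\<close> twice.\<close>

lemma cell_two_crossings:
  assumes F: "F \<in> cells A"
  shows "2 \<le> card (frontier F \<inter> cr)"
proof -
  obtain C y where y: "C \<in> A" "y \<in> C" "y \<notin> cr" "y \<in> frontier F" using cell_edge_point[OF F] .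
  obtain g :: "real \<Rightarrow> complex" where g: "simple_path g" "pathfinish g = pathstart g" "path_image g = C" "g 0 = y" "g 1 = y"
    using pseudocircle_at[OF psc[OF y(1)] y(2)] .
  define Q where "Q = {t \<in> {0..1}. g t \<in> cr}"
  have inj: "s = t" if "0 < s" "s < 1" "0 \<le> t" "t \<le> 1" "g s = g t" for s t
    using g(1) that unfolding simple_path_def loop_free_def by force
  have Q01: "0 < t \<and> t < 1" if "t \<in> Q" for t using that y(3) g(4,5) unfolding Q_def by (force simp: less_le)
  have finQ: "finite Q"
  proof (rule finite_imageD)
    show "finite (g ` Q)" using finite_cr by (rule finite_subset[rotated]) (auto simp: Q_def)
    show "inj_on g Q" using inj Q01 by (intro inj_onI) (meson less_imp_le)
  qed
  obtain D where D: "D \<in> A" "D \<noteq> C" using other_curve[OF y(1)] .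
  obtain v w where vw: "C \<inter> D = {v,w}" "v \<noteq> w" using cross_card[OF y(1) D(1) D(2)[symmetric]] by (meson card_2_iff)
  have "v \<in> C" "w \<in> C" "v \<in> D" "w \<in> D" using vw(1) by auto
  then have "v \<in> cr" "w \<in> cr" using crI[OF y(1) D(1) D(2)[symmetric]] by auto
  moreover have "v \<in> g ` {0..1}" "w \<in> g ` {0..1}" using \<open>v \<in> C\<close> \<open>w \<in> C\<close> g(3) unfolding path_image_def by auto
  then obtain s t where s: "s \<in> {0..1}" "v = g s" and t: "t \<in> {0..1}" "w = g t" by (elim imageE)
  ultimately have st: "s \<in> Q" "t \<in> Q" "s \<noteq> t" using vw(2) unfolding Q_def by auto
  define a b where "a = Min Q" and "b = Max Q"
  have ab: "a \<in> Q" "b \<in> Q" unfolding a_def b_def using finQ st by (auto intro: Min_in Max_in)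
  have le: "a \<le> x" "x \<le> b" if "x \<in> Q" for x unfolding a_def b_def using finQ that by auto
  have neq: "a < b" using le[OF st(1)] le[OF st(2)] st(3) by linarith
  have fa: "g a \<in> frontier F"
  proof (rule frontier_next_crossing[OF F y(1) g(1,3)])
    show "g t \<notin> cr" if "0 \<le> t" "t < a" for t using that le(1)[of t] Q01[OF ab(1)] unfolding Q_def by auto
  qed (use y g Q01[OF ab(1)] in auto)
  have fb: "reversepath g (1 - b) \<in> frontier F"
  proof (rule frontier_next_crossing[OF F y(1)])
    show "reversepath g t \<notin> cr" if "0 \<le> t" "t < 1 - b" for t using that le(2)[of "1 - t"] Q01[OF ab(2)] unfolding Q_def reversepath_def by auto
    show "simple_path (reversepath g)" using g(1) by (rule simple_path_reversepath)
    show "path_image (reversepath g) = C" using g(3) by simp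
    show "reversepath g 0 \<notin> cr" "reversepath g 0 \<in> frontier F" using y g(5) by (auto simp: reversepath_def)
  qed (use Q01[OF ab(2)] in auto)
  then have "g b \<in> frontier F" by (simp add: reversepath_def)
  moreover have "g a \<noteq> g b" using inj[of a b] Q01[OF ab(1)] Q01[OF ab(2)] neq by auto
  ultimately have "card {g a, g b} = 2" "{g a, g b} \<subseteq> frontier F \<inter> cr" using fa ab unfolding Q_def by auto
  then show ?thesis using card_mono[of "frontier F \<inter> cr" "{g a, g b}"] finite_cr by simp
qed

lemma finite_cells: "finite (cells A)"
proof -
  have "cells A \<subseteq> (\<Union>v\<in>cr. {F \<in> cells A. v \<in> frontier F})"
  proof
    fix F assume F: "F \<in> cells A"
    have "frontier F \<inter> cr \<noteq> {}" using cell_two_crossings[OF F] by auto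
    then show "F \<in> (\<Union>v\<in>cr. {F \<in> cells A. v \<in> frontier F})" using F by blast
  qed
  then show ?thesis using finite_cr cells_at_vertex(1) by (meson finite_UN_I finite_subset)
qed

lemma corner_count: "(\<Sum>F\<in>cells A. card (frontier F \<inter> cr)) \<le> 4 * (card A * (card A - 1))"
proof -
  have "(\<Sum>F\<in>cells A. card (frontier F \<inter> cr)) = (\<Sum>F\<in>cells A. \<Sum>v\<in>cr. if v \<in> frontier F then 1 else 0)"
    by (rule sum.cong) (simp_all add: finite_cr sum.If_cases Int_commute Int_def conj_commute)
  also have "\<dots> = (\<Sum>v\<in>cr. \<Sum>F\<in>cells A. if v \<in> frontier F then 1 else 0)" by (rule sum.swap)
  also have "\<dots> = (\<Sum>v\<in>cr. card {F \<in> cells A. v \<in> frontier F})"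
    by (rule sum.cong) (simp_all add: finite_cells sum.If_cases Int_def)
  also have "\<dots> \<le> (\<Sum>v\<in>cr. 4)" using cells_at_vertex(2) by (intro sum_mono) auto
  also have "\<dots> \<le> 4 * (card A * (card A - 1))" using cr_card by simp
  finally show ?thesis .
qed

end

section \<open>Four triangles along every pseudocircle\<close>

lemma arc_half_open:
  fixes c :: "real \<Rightarrow> complex"
  assumes "arc c"
  shows "connected (path_image c - {pathfinish c})" "pathfinish c \<in> closure (path_image c - {pathfinish c})"
proof -
  have cont: "continuous_on {0..1} c" and inj: "inj_on c {0..1}" using assms by (auto simp: arc_def path_def)
  have eq: "path_image c - {pathfinish c} = c ` {0..<1}"
  proof -
    have "c ` {0..1} - c ` {1} = c ` ({0..1} - {1})" using inj by (intro inj_on_image_set_diff[symmetric, of c "{0..1}"]) auto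
    moreover have "{0..1} - {1} = {0..<(1::real)}" by auto
    ultimately show ?thesis by (simp add: path_image_def pathfinish_def)
  qed
  have "continuous_on {0..<1} c" by (rule continuous_on_subset[OF cont]) auto
  then show "connected (path_image c - {pathfinish c})" unfolding eq by (intro connected_continuous_image) auto
  have "c ` closure {0..<1} \<subseteq> closure (c ` {0..<1})"
    by (rule image_closure_subset) (use cont closure_subset[of "c ` {0..<1}"] in auto)
  then show "pathfinish c \<in> closure (path_image c - {pathfinish c})" unfolding eq by (auto simp: pathfinish_def)
qed

lemma sum_card_swap:
  assumes "finite X" "finite Y"
  shows "(\<Sum>x\<in>X. card {y \<in> Y. P x y}) = (\<Sum>y\<in>Y. card {x \<in> X. P x y})"
proof -
  have "(\<Sum>x\<in>X. card {y \<in> Y. P x y}) = (\<Sum>x\<in>X. \<Sum>y\<in>Y. if P x y then 1 else 0)"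
    using assms by (simp add: sum.If_cases Int_def)
  also have "\<dots> = (\<Sum>y\<in>Y. \<Sum>x\<in>X. if P x y then 1 else 0)" by (rule sum.swap)
  also have "\<dots> = (\<Sum>y\<in>Y. card {x \<in> X. P x y})"
    using assms by (simp add: sum.If_cases Int_def)
  finally show ?thesis .
qed

context arr
begin

text \<open>A connected set that properly contains \<open>D\<close> meets the frontier of
  \<open>D\<close>, which lies on the curves; so \<open>D\<close> cannot be enlarged within the
  complement.\<close>

lemma component_of_frontier:
  assumes "connected D" "D \<noteq> {}" "D \<inter> U = {}" "frontier D \<subseteq> U"
  shows "D \<in> cells A"
proof -
  obtain Y where Y: "Y \<in> components (- U)" "D \<subseteq> Y"
    using exists_component_superset[of D "- U"] assms(1-3) by blast
  have "Y = D"
  proof (rule ccontr)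
    assume "Y \<noteq> D"
    then have "Y - D \<noteq> {}" using Y(2) by blast
    then have "Y \<inter> frontier D \<noteq> {}"
      using connected_Int_frontier[of Y D] in_components_connected[OF Y(1)] assms(2) Y(2) by blast
    then show False using in_components_subset[OF Y(1)] assms(4) by blast
  qed
  then show ?thesis using Y unfolding cells_def by simp
qed

text \<open>The arc \<open>c\<close> cuts off a region along the boundary piece from
  \<open>p\<close> to \<open>q\<close>. By \<open>reach\<close>, every curve point of
  \<open>S\<close> off \<open>c\<close> is connected, without touching \<open>c\<close>, to the
  remaining part of the boundary. So no curve enters the region, and its frontier consists of
  curves.\<close>

lemma region_cell:
  fixes g c :: "real \<Rightarrow> complex"
  assumes g: "simple_path g" "pathfinish g = pathstart g" "path_image g = C" and CA: "C \<in> A"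
    and S: "S = inside C \<or> S = outside C"
    and pq: "0 < p" "p < q" "q < 1"
    and c: "arc c" "pathstart c = g p" "pathfinish c = g q" "path_image c - {g p, g q} \<subseteq> S" "path_image c \<subseteq> U"
    and reach: "\<And>E x. E \<in> A - {C} \<Longrightarrow> x \<in> E \<Longrightarrow> x \<in> S \<Longrightarrow> x \<notin> path_image c \<Longrightarrow>
       \<exists>B t. connected B \<and> x \<in> B \<and> B \<subseteq> S \<and> B \<inter> path_image c = {} \<and> g t \<in> closure B \<and> 0 \<le> t \<and> t \<le> 1 \<and> (t < p \<or> q < t)"
  shows "\<exists>F\<in>cells A. F \<subseteq> S \<and> frontier F = g ` {p..q} \<union> path_image c"
proof -
  have S': "S = inside (path_image g) \<or> S = outside (path_image g)" using S g(3) by simp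
  interpret disc g S using g(1,2) S' by unfold_locales
  obtain c1 c2 where c12: "arc c1" "arc c2" "pathstart c1 = g p" "pathfinish c1 = g q"
    "pathstart c2 = g p" "pathfinish c2 = g q"
    "path_image c1 = g ` {p..q}" "path_image c2 = g ` ({0..p} \<union> {q..1})"
    "path_image c1 \<inter> path_image c2 = {g p, g q}" "path_image c1 \<union> path_image c2 = path_image g"
    using closed_path_split[OF g(1,2) pq] .
  obtain D1 D2 where D: "open D1" "open D2" "connected D1" "connected D2" "D1 \<noteq> {}" "D2 \<noteq> {}" "D1 \<inter> D2 = {}"
    "D1 \<union> D2 = S - path_image c"
    "frontier D1 = path_image c1 \<union> path_image c" "frontier D2 = path_image c2 \<union> path_image c"
    using crosscut[OF c12(1,2) c(1) c12(3-6) c(2,3) c12(9) S'[folded c12(10)] c(4)] .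
  have SC: "S \<inter> C = {}" using side_facts(3) g(3) by simp
  have "D1 \<inter> U = {}"
  proof (rule ccontr)
    assume "D1 \<inter> U \<noteq> {}"
    then obtain x E where xE: "x \<in> D1" "x \<in> E" "E \<in> A" by blast
    have xS: "x \<in> S" "x \<notin> path_image c" using xE(1) D(8) by blast+
    then have "E \<noteq> C" using SC xE(2) by blast
    then obtain B t where B: "connected B" "x \<in> B" "B \<subseteq> S" "B \<inter> path_image c = {}" "g t \<in> closure B" "0 \<le> t" "t \<le> 1" "t < p \<or> q < t"
      using reach[of E x] xE xS by blast
    have BD: "B \<subseteq> D1 \<union> D2" using B(3,4) D(8) by blast
    have "D1 \<inter> D2 \<inter> B = {}" using D(7) by simp
    then have "D1 \<inter> B = {} \<or> D2 \<inter> B = {}" using connectedD[OF B(1) D(1,2) _ BD] by simp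
    then have "B \<subseteq> D1" using xE(1) B(2) BD by blast
    then have "g t \<in> closure D1" using B(5) closure_mono by blast
    then have "g t \<in> D1 \<union> (g ` {p..q} \<union> path_image c)" using D(9) c12(7) closure_Un_frontier[of D1] by simp
    moreover have gC: "g t \<in> C" using g(3) B(6,7) g_mem by blast
    moreover have "g t \<notin> D1" using gC SC D(8) by blast
    ultimately have "g t \<in> g ` {p..q} \<or> g t \<in> path_image c" by blast
    then have "g t \<in> g ` {p..q}"
    proof
      assume "g t \<in> path_image c"
      then have "g t = g p \<or> g t = g q" using c(4) gC SC by blast
      then show ?thesis using pq by auto
    qed
    then obtain s where s: "s \<in> {p..q}" "g s = g t" by (metis imageE)
    then have "s = t" using g_inj[of s t] B(6,7) pq by auto
    then show False using s(1) B(8) by auto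
  qed
  moreover have "frontier D1 \<subseteq> U" using D(9) c(5) c12(10) g(3) CA by blast
  ultimately have "D1 \<in> cells A" using component_of_frontier[OF D(3,5)] by blast
  moreover have "D1 \<subseteq> S" using D(8) by blast
  ultimately show ?thesis using D(9) c12(7) by blast
qed

lemma curve_chords:
  fixes g :: "real \<Rightarrow> complex"
  assumes CA: "C \<in> A" and g: "simple_path g" "pathfinish g = pathstart g" "path_image g = C" "g 0 \<notin> cr" "g 1 \<notin> cr"
    and D: "D \<in> A" "D \<noteq> C"
  obtains s t where "0 < s" "s < t" "t < 1" "C \<inter> D = {g s, g t}" "g s \<noteq> g t"
proof -
  obtain u w where uw: "C \<inter> D = {u,w}" "u \<noteq> w" using cross_card[OF CA D(1) D(2)[symmetric]] by (meson card_2_iff)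
  have "u \<in> C" "w \<in> C" "u \<in> D" "w \<in> D" using uw(1) by auto
  then have cr: "u \<in> cr" "w \<in> cr" using crI[OF CA D(1) D(2)[symmetric]] by auto
  have "u \<in> g ` {0..1}" "w \<in> g ` {0..1}" using \<open>u \<in> C\<close> \<open>w \<in> C\<close> g(3) unfolding path_image_def by auto
  then obtain s t where s: "s \<in> {0..1}" "u = g s" and t: "t \<in> {0..1}" "w = g t" by (elim imageE)
  have "s \<noteq> 0" "s \<noteq> 1" "t \<noteq> 0" "t \<noteq> 1" using s t cr g(4,5) by metis+
  then have b: "0 < s" "s < 1" "0 < t" "t < 1" using s t by auto
  consider "s < t" | "t < s" using uw(2) s t by fastforce
  then show thesis
  proof cases
    case 1 then show thesis using that[of s t] b s t uw by auto
  next
    case 2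
    have "C \<inter> D = {g t, g s}" "g t \<noteq> g s" using uw s t by auto
    then show thesis using that[of t s] b 2 by auto
  qed
qed

lemma chord_system:
  fixes g :: "real \<Rightarrow> complex"
  assumes CA: "C \<in> A" and g: "simple_path g" "pathfinish g = pathstart g" "path_image g = C" "g 0 \<notin> cr" "g 1 \<notin> cr"
    and S: "S = inside C \<or> S = outside C"
  obtains lo hi :: "complex set \<Rightarrow> real" and d :: "complex set \<Rightarrow> real \<Rightarrow> complex"
  where "chords g S (A - {C}) lo hi d"
    "\<And>D. D \<in> A - {C} \<Longrightarrow> C \<inter> D = {g (lo D), g (hi D)}"
    "\<And>D. D \<in> A - {C} \<Longrightarrow> path_image (d D) = (D \<inter> S) \<union> {g (lo D), g (hi D)}"
proof -
  have "\<exists>f. 0 < fst f \<and> fst f < snd f \<and> snd f < 1 \<and> C \<inter> D = {g (fst f), g (snd f)} \<and> g (fst f) \<noteq> g (snd f)" if "D \<in> A - {C}" for D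
  proof -
    have D: "D \<in> A" "D \<noteq> C" using that by auto
    obtain s t where "0 < s" "s < t" "t < 1" "C \<inter> D = {g s, g t}" "g s \<noteq> g t" using curve_chords[OF CA g D] .
    then show ?thesis by (intro exI[of _ "(s,t)"]) simp
  qed
  then obtain f where f: "\<And>D. D \<in> A - {C} \<Longrightarrow> 0 < fst (f D) \<and> fst (f D) < snd (f D) \<and> snd (f D) < 1 \<and> C \<inter> D = {g (fst (f D)), g (snd (f D))} \<and> g (fst (f D)) \<noteq> g (snd (f D))" by metis
  define lo hi where "lo D = fst (f D)" and "hi D = snd (f D)" for D
  have lh: "0 < lo D" "lo D < hi D" "hi D < 1" "C \<inter> D = {g (lo D), g (hi D)}" "g (lo D) \<noteq> g (hi D)" if "D \<in> A - {C}" for D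
    using f[OF that] unfolding lo_def hi_def by auto
  have chord: "\<exists>d. arc d \<and> pathstart d = g (lo D) \<and> pathfinish d = g (hi D) \<and> path_image d = (D \<inter> S') \<union> {g (lo D), g (hi D)}
     \<and> path_image d - {g (lo D), g (hi D)} \<subseteq> S'" if D: "D \<in> A - {C}" and S': "S' = inside C \<or> S' = outside C" for D S'
  proof -
    have D': "D \<in> A" "C \<noteq> D" using D by auto
    show ?thesis using chord_exists[OF psc[OF CA] psc[OF D'(1)] cross[OF CA D'] lh(4)[OF D] lh(5)[OF D] S'] by metis
  qed
  obtain d where d: "\<And>D. D \<in> A - {C} \<Longrightarrow> arc (d D) \<and> pathstart (d D) = g (lo D) \<and> pathfinish (d D) = g (hi D) \<and> path_image (d D) = (D \<inter> S) \<union> {g (lo D), g (hi D)}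
     \<and> path_image (d D) - {g (lo D), g (hi D)} \<subseteq> S" using chord[OF _ S] by metis
  have endin: "g (lo D) \<in> C" "g (hi D) \<in> C" "g (lo D) \<in> D" "g (hi D) \<in> D" if "D \<in> A - {C}" for D
    using lh(4)[OF that] by auto
  have endnot: "g (lo D) \<notin> E" "g (hi D) \<notin> E" if "D \<in> A - {C}" "E \<in> A - {C}" "D \<noteq> E" for D E
    using triple_empty[OF CA, of D E] endin[OF that(1)] that by blast+
  have KS: "x \<in> T \<and> x \<in> D \<and> x \<in> E" if "D \<in> A - {C}" "E \<in> A - {C}" "D \<noteq> E" "x \<in> (D \<inter> T) \<union> {g (lo D), g (hi D)}" "x \<in> (E \<inter> T) \<union> {g (lo E), g (hi E)}" for D E x T
  proof -
    have xD: "x \<in> D" and xE: "x \<in> E" using that(4,5) endin[OF that(1)] endin[OF that(2)] by auto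
    have "x \<noteq> g (lo D)" "x \<noteq> g (hi D)" using endnot[OF that(1-3)] xE by auto
    then show ?thesis using that(4) xD xE by auto
  qed
  have KS2: "x \<in> S \<and> x \<in> D \<and> x \<in> E" if DE: "D \<in> A - {C}" "E \<in> A - {C}" "D \<noteq> E" and x: "x \<in> path_image (d D) \<inter> path_image (d E)" for D E x
  proof -
    have "path_image (d D) = (D \<inter> S) \<union> {g (lo D), g (hi D)}" "path_image (d E) = (E \<inter> S) \<union> {g (lo E), g (hi E)}"
      using d[OF DE(1)] d[OF DE(2)] by simp_all
    then show ?thesis using KS[OF DE, of x S] x by simp
  qed
  have Sg: "S = inside (path_image g) \<or> S = outside (path_image g)" using S g(3) by simp
  have ch: "chords g S (A - {C}) lo hi d"
  proof (unfold_locales)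
    show "simple_path g" "pathfinish g = pathstart g" "S = inside (path_image g) \<or> S = outside (path_image g)"
      using g Sg by auto
    show "finite (A - {C})" using finA by simp
    show "0 < lo i \<and> lo i < hi i \<and> hi i < 1" if "i \<in> A - {C}" for i using lh[OF that] by simp
    show "arc (d i) \<and> pathstart (d i) = g (lo i) \<and> pathfinish (d i) = g (hi i)" if "i \<in> A - {C}" for i using d[OF that] by simp
    show "path_image (d i) - {g (lo i), g (hi i)} \<subseteq> S" if "i \<in> A - {C}" for i using d[OF that] by blast
    show "{lo i, hi i} \<inter> {lo j, hi j} = {}" if "i \<in> A - {C}" "j \<in> A - {C}" "i \<noteq> j" for i j
      using endnot[OF that] endin[OF that(2)] by auto
    have sub: "path_image (d i) \<inter> path_image (d j) \<subseteq> i \<inter> j" if "i \<in> A - {C}" "j \<in> A - {C}" "i \<noteq> j" for i j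
      using KS2[OF that] by blast
    show "finite (path_image (d i) \<inter> path_image (d j)) \<and> card (path_image (d i) \<inter> path_image (d j)) \<le> 2"
      if "i \<in> A - {C}" "j \<in> A - {C}" "i \<noteq> j" for i j
    proof -
      have first_crossing: "finite (i \<inter> j)" "card (i \<inter> j) = 2" using cross_card[of i j] that by simp_all
      show ?thesis using finite_subset[OF sub[OF that] first_crossing(1)] card_mono[OF first_crossing(1) sub[OF that]] first_crossing(2) by simp
    qed
    show "card (path_image (d i) \<inter> path_image (d j)) \<le> 1"
      if ij: "i \<in> A - {C}" "j \<in> A - {C}" "i \<noteq> j" and sep: "separated (lo i) (hi i) (lo j) (hi j)" for i j
    proof -
      \<comment> \<open>On the opposite side the same two pseudocircles have chords with the same
        alternating ends, which must meet there; that crossing is missing in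
        \<open>S\<close>.\<close>
      obtain S' where S': "S' = inside C \<or> S' = outside C" "S' \<inter> S = {}" using other_side[OF S] by metis
      have Sg': "S' = inside (path_image g) \<or> S' = outside (path_image g)" using S' g(3) by simp
      interpret o: disc g S' using g(1,2) Sg' by unfold_locales
      obtain e where e: "arc e" "pathstart e = g (lo i)" "pathfinish e = g (hi i)" "path_image e = (i \<inter> S') \<union> {g (lo i), g (hi i)}"
         "path_image e - {g (lo i), g (hi i)} \<subseteq> S'" using chord[OF ij(1) S'(1)] by blast
      obtain e' where e': "arc e'" "pathstart e' = g (lo j)" "pathfinish e' = g (hi j)" "path_image e' = (j \<inter> S') \<union> {g (lo j), g (hi j)}"
         "path_image e' - {g (lo j), g (hi j)} \<subseteq> S'" using chord[OF ij(2) S'(1)] by blast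
      have "path_image e \<inter> path_image e' \<noteq> {}"
        by (rule o.paths_meet[OF sep]) (use lh[OF ij(1)] lh[OF ij(2)] e e' in \<open>auto simp: arc_imp_path\<close>)
      then obtain z where z: "z \<in> (i \<inter> S') \<union> {g (lo i), g (hi i)}" "z \<in> (j \<inter> S') \<union> {g (lo j), g (hi j)}" using e(4) e'(4) by blast
      have z': "z \<in> S'" "z \<in> i" "z \<in> j" using KS[OF ij z] by auto
      have "path_image (d i) \<inter> path_image (d j) \<subseteq> i \<inter> j - {z}"
      proof
        fix x assume "x \<in> path_image (d i) \<inter> path_image (d j)"
        then have "x \<in> S \<and> x \<in> i \<and> x \<in> j" using KS2[OF ij] by simp
        moreover have "x \<noteq> z" using calculation z'(1) S'(2) by blast
        ultimately show "x \<in> i \<inter> j - {z}" by simp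
      qed
      moreover have first_crossing: "finite (i \<inter> j)" "card (i \<inter> j) = 2" using cross_card[of i j] ij by auto
      moreover have "card (i \<inter> j - {z}) = 1" using first_crossing z' by (simp add: card_Diff_singleton)
      ultimately show ?thesis using card_mono[of "i \<inter> j - {z}"] by fastforce
    qed
    show "path_image (d i) \<inter> path_image (d j) \<inter> path_image (d k) = {}"
      if "i \<in> A - {C}" "j \<in> A - {C}" "k \<in> A - {C}" "i \<noteq> j" "i \<noteq> k" "j \<noteq> k" for i j k
      using sub[OF that(1,2,4)] sub[OF that(1,3,5)] triple_empty[of i j k] that by blast
  qed
  show thesis by (rule that[OF ch lh(4)]) (use d in auto)
qed

text \<open>The point \<open>z\<close> is where the curve is cut, so the triangle found keeps away
  from it. The noncrossing point of \<open>C\<close> on the frontier marks the place of the next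
  cut.\<close>

lemma curve_triangle:
  assumes CA: "C \<in> A" and S: "S = inside C \<or> S = outside C" and z: "z \<in> C" "z \<notin> cr"
    and nodigon: "\<And>F. F \<in> cells A \<Longrightarrow> card (frontier F \<inter> cr) \<noteq> 2"
  shows "\<exists>F\<in>cells A. F \<subseteq> S \<and> card (frontier F \<inter> cr) = 3 \<and> 2 \<le> card (C \<inter> (frontier F \<inter> cr)) \<and> z \<notin> frontier F
      \<and> (\<exists>y\<in>C \<inter> frontier F. y \<notin> cr)"
proof -
  obtain g :: "real \<Rightarrow> complex" where g: "simple_path g" "pathfinish g = pathstart g" "path_image g = C" "g 0 = z" "g 1 = z"
    using pseudocircle_at[OF psc[OF CA] z(1)] .
  have gz: "g 0 \<notin> cr" "g 1 \<notin> cr" using g z by auto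
  obtain lo hi :: "complex set \<Rightarrow> real" and d :: "complex set \<Rightarrow> real \<Rightarrow> complex"
    where ch: "chords g S (A - {C}) lo hi d"
    and CD: "\<And>D. D \<in> A - {C} \<Longrightarrow> C \<inter> D = {g (lo D), g (hi D)}"
    and Kd: "\<And>D. D \<in> A - {C} \<Longrightarrow> path_image (d D) = (D \<inter> S) \<union> {g (lo D), g (hi D)}"
    using chord_system[OF CA g(1-3) gz S] by metis
  interpret chords g S "A - {C}" lo hi d by (rule ch)
  have SC: "S \<inter> C = {}" using side_facts(3) g(3) by simp
  obtain D0 where "D0 \<in> A" "D0 \<noteq> C" using other_curve[OF CA] .
  then have ne: "A - {C} \<noteq> {}" by blast
  have KE: "x \<in> K E" if "E \<in> A - {C}" "x \<in> E" "x \<in> S" for E x using Kd[OF that(1)] that by blast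
  have KsubE: "K E \<subseteq> E" if "E \<in> A - {C}" for E using Kd[OF that] CD[OF that] by blast
  have end_cr: "g t \<in> cr" "g t \<in> E" "g t \<in> C" if "is_end t E" for t E
  proof -
    have E: "E \<in> A - {C}" using end_I[OF that] .
    show "g t \<in> E" "g t \<in> C" using that CD[OF E] unfolding is_end_def by auto
    then show "g t \<in> cr" using crI[OF CA, of E] E by auto
  qed
  have C_cr: "\<exists>E. is_end t E" if t: "0 < t" "t < 1" "g t \<in> cr" for t
  proof -
    obtain X Y where XY: "X \<in> A" "Y \<in> A" "X \<noteq> Y" "g t \<in> X" "g t \<in> Y" using t(3) cr_iff by blast
    have gC: "g t \<in> C" using g(3) g_mem t by auto
    obtain E where E: "E \<in> A - {C}" "g t \<in> E" using XY by blast
    have "g t = g (lo E) \<or> g t = g (hi E)" using CD[OF E(1)] E(2) gC by blast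
    then have "t = lo E \<or> t = hi E" using g_inj[of t "lo E"] g_inj[of t "hi E"] t range[OF E(1)] by auto
    then show ?thesis using E(1) unfolding is_end_def by blast
  qed
  have S_cr: "\<exists>E\<in>A - {C}. E \<noteq> D \<and> x \<in> K E" if xs: "x \<in> S" "x \<in> cr" for x D
  proof -
    obtain X Y where XY: "X \<in> A" "Y \<in> A" "X \<noteq> Y" "x \<in> X" "x \<in> Y" using xs(2) cr_iff by blast
    have "X \<noteq> C" "Y \<noteq> C" using XY xs(1) SC by blast+
    then show ?thesis using KE[of X x] KE[of Y x] XY xs(1) by (cases "X = D") auto
  qed
  have half: "\<exists>B s. connected B \<and> x \<in> B \<and> B \<subseteq> S \<and> B \<inter> P = {} \<and> g s \<in> closure B \<and> 0 \<le> s \<and> s \<le> 1 \<and> (s < p \<or> q < s)"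
    if h: "is_end t E" "x \<in> K E" "x \<in> S" "L E x t \<inter> P \<subseteq> {g t}" "t < p \<or> q < t" for t E x P p q
  proof -
    obtain c where c: "arc c" "pathstart c = x" "pathfinish c = g t" "path_image c = L E x t" "path_image c - {g t} \<subseteq> S"
      using L_arc[OF h(1-3)] .
    note ah = arc_half_open[OF c(1), unfolded c(3)]
    have "x \<noteq> g t" using h(3) g_end_notin_S[OF h(1)] by auto
    then have "x \<in> path_image c - {g t}" using c(2) pathstart_in_path_image[of c] by auto
    moreover have "(path_image c - {g t}) \<inter> P = {}" using h(4) c(4) by blast
    ultimately show ?thesis using ah c(5) h(5) end_range[OF h(1)] less_imp_le by blast
  qed
  have mid: "\<exists>y\<in>C \<inter> frontier F. y \<notin> cr" if F: "g ` {p..q} \<subseteq> frontier F" and pq: "0 < p" "p < q" "q < 1"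
    and none: "\<And>t i. is_end t i \<Longrightarrow> \<not> (p < t \<and> t < q)" for F p q
  proof -
    let ?m = "(p + q) / 2"
    have m: "p < ?m" "?m < q" using pq by auto
    then have "g ?m \<in> frontier F" using F by auto
    moreover have "g ?m \<in> C" using g(3) g_mem[of ?m] m pq by auto
    moreover have "g ?m \<notin> cr" using C_cr[of ?m] none m pq by fastforce
    ultimately show ?thesis by blast
  qed
  have seg: "g t = g p \<or> g t = g q" if tc: "g t \<in> cr" "p \<le> t" "t \<le> q" and pq: "0 < p" "p < q" "q < 1"
    and none: "\<And>t i. is_end t i \<Longrightarrow> \<not> (p < t \<and> t < q)" for t p q
  proof -
    have "0 < t" "t < 1" using tc pq by auto
    then obtain E where "is_end t E" using C_cr[of t] tc(1) by blast
    then have "t = p \<or> t = q" using none tc by fastforce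
    then show ?thesis by auto
  qed
  from empty_region[OF ne] show ?thesis
  proof (elim disjE bexE exE conjE)
    \<comment> \<open>An uncrossed chord with no chord end under it bounds a digon, which is
      excluded by \<open>nodigon\<close>.\<close>
    fix D assume D: "D \<in> A - {C}" and un: "\<forall>j\<in>A - {C}. j \<noteq> D \<longrightarrow> K D \<inter> K j = {}"
      and none: "\<forall>t j. is_end t j \<longrightarrow> \<not> (lo D < t \<and> t < hi D)"
    have rD: "0 < lo D" "lo D < hi D" "hi D < 1" using range[OF D] by auto
    have "\<exists>F\<in>cells A. F \<subseteq> S \<and> frontier F = g ` {lo D..hi D} \<union> K D"
    proof (rule region_cell[OF g(1-3) CA S rD])
      show "arc (d D)" "pathstart (d D) = g (lo D)" "pathfinish (d D) = g (hi D)" using arc[OF D] by auto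
      show "K D - {g (lo D), g (hi D)} \<subseteq> S" using inS[OF D] .
      show "K D \<subseteq> U" using KsubE[OF D] D by blast
      fix E x assume E: "E \<in> A - {C}" and x: "x \<in> E" "x \<in> S" "x \<notin> K D"
      have xK: "x \<in> K E" using KE[OF E x(1,2)] .
      have ED: "E \<noteq> D" using xK x(3) by blast
      have e: "is_end (lo E) E" using E by (simp add: is_end_def)
      have "L E x (lo E) \<inter> K D = {}" using L_sub[OF E xK] un E ED by blast
      moreover have "lo E < lo D \<or> hi D < lo E" using none e ends_distinct[OF D E ED[symmetric]] by fastforce
      ultimately show "\<exists>B t. connected B \<and> x \<in> B \<and> B \<subseteq> S \<and> B \<inter> K D = {} \<and> g t \<in> closure B \<and> 0 \<le> t \<and> t \<le> 1 \<and> (t < lo D \<or> hi D < t)"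
        using half[OF e xK x(2), of "K D" "lo D" "hi D"] by simp
    qed
    then obtain F where F: "F \<in> cells A" "frontier F = g ` {lo D..hi D} \<union> K D" by blast
    have "frontier F \<inter> cr = {g (lo D), g (hi D)}"
    proof
      show "frontier F \<inter> cr \<subseteq> {g (lo D), g (hi D)}"
      proof
        fix x assume x: "x \<in> frontier F \<inter> cr"
        show "x \<in> {g (lo D), g (hi D)}"
        proof (cases "x \<in> K D")
          case True
          have "x \<notin> S"
          proof
            assume "x \<in> S"
            then obtain E where "E \<in> A - {C}" "E \<noteq> D" "x \<in> K E" using S_cr[of x D] x by blast
            then show False using un True by blast
          qed
          then show ?thesis using K_cases[OF D True] by auto
        next
          case False
          then obtain t where "x = g t" "t \<in> {lo D..hi D}" using x F(2) by blast
          then show ?thesis using seg[of t "lo D" "hi D"] x rD none by auto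
        qed
      qed
      have e: "is_end (lo D) D" "is_end (hi D) D" using D by (auto simp: is_end_def)
      have "g (lo D) \<in> frontier F" "g (hi D) \<in> frontier F" unfolding F(2) using rD by auto
      then show "{g (lo D), g (hi D)} \<subseteq> frontier F \<inter> cr"
        using end_cr(1)[OF e(1)] end_cr(1)[OF e(2)] by blast
    qed
    moreover have "g (lo D) \<noteq> g (hi D)" using g_inj[of "lo D" "hi D"] rD by auto
    ultimately show ?thesis using nodigon[OF F(1)] by simp
  next
    fix p q a b v
    assume pq: "p < q" and f1: "first_crossing p a b v" and f2: "first_crossing q b a v" and none: "\<forall>t i. is_end t i \<longrightarrow> \<not> (p < t \<and> t < q)"
    note F1 = first_crossingD[OF f1] note F2 = first_crossingD[OF f2]
    have r: "0 < p" "q < 1" using end_range[OF F1(1)] end_range[OF F2(1)] by auto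
    have vS: "v \<in> S" using crossing_in_S[OF F1(2,3) F1(4)[symmetric] F1(5,6)] .
    obtain c1 where c1: "arc c1" "pathstart c1 = v" "pathfinish c1 = g p" "path_image c1 = L a v p" "path_image c1 - {g p} \<subseteq> S"
      using L_arc[OF F1(1,5) vS] .
    obtain c2 where c2: "arc c2" "pathstart c2 = v" "pathfinish c2 = g q" "path_image c2 = L b v q" "path_image c2 - {g q} \<subseteq> S"
      using L_arc[OF F2(1,5) vS] .
    have int: "L a v p \<inter> L b v q \<subseteq> {v}" using F1(7)[OF F2(2) F2(4)[symmetric]] L_sub[OF F2(2,5), of q] by blast
    define c where "c = reversepath c1 +++ c2"
    have ac: "arc c" unfolding c_def using c1 c2 int by (intro arc_join) (auto simp: arc_reversepath)
    have ic: "path_image c = L a v p \<union> L b v q" unfolding c_def using c1 c2 by (simp add: path_image_join)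
    have cc: "pathstart c = g p" "pathfinish c = g q" unfolding c_def using c1 c2 by auto
    have icS: "path_image c - {g p, g q} \<subseteq> S" unfolding ic using c1(4,5) c2(4,5) by blast
    \<comment> \<open>A point of a side chord that is off the triangle's boundary lies beyond
      \<open>v\<close>. The rest of that chord up to its far end avoids both legs, and this end is
      not between \<open>p\<close> and \<open>q\<close>. The primed names let the statement serve
      both sides.\<close>
    have sidecase: "\<exists>B t. connected B \<and> x \<in> B \<and> B \<subseteq> S \<and> B \<inter> path_image c = {} \<and> g t \<in> closure B \<and> 0 \<le> t \<and> t \<le> 1 \<and> (t < p \<or> q < t)"
      if h: "first_crossing p' a' b' v" "first_crossing q' b' a' v" "path_image c = L a' v p' \<union> L b' v q'" "x \<in> K a'" "x \<in> S" "x \<notin> path_image c" "{p,q} = {p',q'}"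
      for p' q' a' b' x
    proof -
      note H1 = first_crossingD[OF h(1)] note H2 = first_crossingD[OF h(2)]
      obtain t where t: "is_end t a'" "t \<noteq> p'" using other_end[OF H1(1)] .
      have xt: "x \<in> L a' v t" using L_total[OF H1(1) t(1) t(2)[symmetric] H1(5) h(4)] h(3,6) by blast
      have xv: "x \<noteq> v" using h(3,6) L_self[OF H1(2,5)] by blast
      have vn: "v \<notin> L a' x t"
      proof
        assume "v \<in> L a' x t"
        moreover have "v \<in> L a' x p'" using L_swap[OF t(1) H1(1) t(2) H1(5) xt] .
        ultimately have "v = x" using L_Int[OF H1(1) t(1) t(2)[symmetric] h(4)] by blast
        then show False using xv by simp
      qed
      have sub: "L a' x t \<subseteq> L a' v t" using L_mono[OF H1(2,5) xt] .
      have "y = v" if y: "y \<in> L a' x t" "y \<in> path_image c" for y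
      proof -
        consider "y \<in> L a' v p'" | "y \<in> L b' v q'" using y(2) h(3) by blast
        then show ?thesis
        proof cases
          case 1
          then show ?thesis using L_Int[OF H1(1) t(1) t(2)[symmetric] H1(5)] y(1) sub by blast
        next
          case 2
          have "y \<in> K a'" using y(1) L_sub[OF H1(2) h(4)] by blast
          then show ?thesis using H2(7)[OF H1(2) H1(4)[symmetric] 2] by blast
        qed
      qed
      then have d: "L a' x t \<inter> path_image c \<subseteq> {g t}" using vn by blast
      have "t \<noteq> q'" using end_neq[OF t(1) H2(1)] H1(4) by auto
      then have "t \<noteq> p" "t \<noteq> q" using t(2) h(7) by auto
      then have "t < p \<or> q < t" using none t(1) by fastforce
      then show ?thesis using half[OF t(1) h(4,5) d] by blast
    qed
    have "\<exists>F\<in>cells A. F \<subseteq> S \<and> frontier F = g ` {p..q} \<union> path_image c"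
    proof (rule region_cell[OF g(1-3) CA S r(1) pq r(2) ac cc icS])
      show "path_image c \<subseteq> U" unfolding ic using L_sub[OF F1(2,5), of p] L_sub[OF F2(2,5), of q] KsubE[OF F1(2)] KsubE[OF F2(2)] F1(2) F2(2) by blast
      fix E x assume E: "E \<in> A - {C}" and x: "x \<in> E" "x \<in> S" "x \<notin> path_image c"
      have xK: "x \<in> K E" using KE[OF E x(1,2)] .
      show "\<exists>B t. connected B \<and> x \<in> B \<and> B \<subseteq> S \<and> B \<inter> path_image c = {} \<and> g t \<in> closure B \<and> 0 \<le> t \<and> t \<le> 1 \<and> (t < p \<or> q < t)"
      proof -
        consider "E = a" | "E = b" | "E \<noteq> a" "E \<noteq> b" by blast
        then show ?thesis
        proof cases
          case 1
          then show ?thesis using sidecase[OF f1 f2 ic _ x(2,3)] xK by simp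
        next
          case 2
          have ic': "path_image c = L b v q \<union> L a v p" using ic by blast
          show ?thesis using sidecase[OF f2 f1 ic' _ x(2,3)] xK 2 by (simp add: insert_commute)
        next
          case 3
          have e: "is_end (lo E) E" using E by (simp add: is_end_def)
          have vE: "v \<notin> K E" using first_crossing_not_third[OF f1 E] 3 by blast
          have "y = v" if "y \<in> K E" "y \<in> path_image c" for y
            using F1(7)[OF E 3(1)] F2(7)[OF E 3(2)] that unfolding ic by blast
          then have "L E x (lo E) \<inter> path_image c \<subseteq> {g (lo E)}" using L_sub[OF E xK] vE by blast
          moreover have "lo E < p \<or> q < lo E" using none e end_neq[OF e F1(1) 3(1)] end_neq[OF e F2(1) 3(2)] by fastforce
          ultimately show ?thesis using half[OF e xK x(2)] by blast
        qed
      qed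
    qed
    then obtain F where F: "F \<in> cells A" "F \<subseteq> S" "frontier F = g ` {p..q} \<union> path_image c" by blast
    have gpq: "g p \<noteq> g q" using g_inj[of p q] pq r by auto
    have gpS: "g p \<notin> S" "g q \<notin> S" using g_end_notin_S[OF F1(1)] g_end_notin_S[OF F2(1)] by auto
    have vcr: "v \<in> cr" using crI[of a b v] F1 F2 KsubE[OF F1(2)] KsubE[OF F2(2)] by blast
    have fr: "frontier F \<inter> cr = {g p, g q, v}"
    proof
      show "frontier F \<inter> cr \<subseteq> {g p, g q, v}"
      proof
        fix x assume x: "x \<in> frontier F \<inter> cr"
        show "x \<in> {g p, g q, v}"
        proof (cases "x \<in> path_image c")
          case True
          show ?thesis
          proof (cases "x \<in> S")
            case xS: True
            consider "x \<in> L a v p" | "x \<in> L b v q" using True ic by blast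
            then have "x = v"
            proof cases
              case 1
              obtain E where "E \<in> A - {C}" "E \<noteq> a" "x \<in> K E" using S_cr[OF xS] x by blast
              then show ?thesis using F1(7)[OF _ _ 1] by blast
            next
              case 2
              obtain E where "E \<in> A - {C}" "E \<noteq> b" "x \<in> K E" using S_cr[OF xS] x by blast
              then show ?thesis using F2(7)[OF _ _ 2] by blast
            qed
            then show ?thesis by simp
          next
            case False
            then show ?thesis using True icS by blast
          qed
        next
          case False
          then obtain t where "x = g t" "t \<in> {p..q}" using x F(3) by blast
          then show ?thesis using seg[of t p q] x r pq none by auto
        qed
      qed
      have "g p \<in> frontier F" "g q \<in> frontier F" unfolding F(3) using pq by auto
      moreover have "v \<in> frontier F" unfolding F(3) ic using L_self[OF F1(2,5)] by blast
      ultimately show "{g p, g q, v} \<subseteq> frontier F \<inter> cr"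
        using end_cr(1)[OF F1(1)] end_cr(1)[OF F2(1)] vcr by blast
    qed
    have "g p \<noteq> v" "g q \<noteq> v" using gpS vS by metis+
    then have "card (frontier F \<inter> cr) = 3" unfolding fr using gpq by simp
    moreover have "2 \<le> card (C \<inter> (frontier F \<inter> cr))"
    proof -
      have "{g p, g q} \<subseteq> C \<inter> (frontier F \<inter> cr)" unfolding fr using end_cr(3)[OF F1(1)] end_cr(3)[OF F2(1)] by blast
      moreover have "finite (C \<inter> (frontier F \<inter> cr))" unfolding fr by simp
      ultimately have "card {g p, g q} \<le> card (C \<inter> (frontier F \<inter> cr))" by (intro card_mono) auto
      then show ?thesis using gpq by simp
    qed
    moreover have "z \<notin> frontier F"
    proof
      assume zF: "z \<in> frontier F"
      have "z \<notin> path_image c"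
      proof
        assume "z \<in> path_image c"
        then have "z = g p \<or> z = g q" using icS z(1) SC by blast
        then show False using end_cr(1)[OF F1(1)] end_cr(1)[OF F2(1)] z(2) by auto
      qed
      then obtain t where "z = g t" "t \<in> {p..q}" using zF F(3) by blast
      then have "t = 0" using g_inj[of t 0] g(4) r by auto
      then show False using \<open>t \<in> {p..q}\<close> r by auto
    qed
    moreover have "\<exists>y\<in>C \<inter> frontier F. y \<notin> cr" using mid[of p q F] F(3) r pq none by blast
    ultimately show ?thesis using F(1,2) by blast
  qed
qed

lemma triangles_at_side:
  assumes CA: "C \<in> A" and S: "S = inside C \<or> S = outside C"
    and nodigon: "\<And>F. F \<in> cells A \<Longrightarrow> card (frontier F \<inter> cr) \<noteq> 2"
  shows "2 \<le> card {F \<in> cells A. F \<subseteq> S \<and> card (frontier F \<inter> cr) = 3 \<and> 2 \<le> card (C \<inter> (frontier F \<inter> cr))}"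
proof -
  have "\<not> C \<subseteq> cr" using pseudocircle_infinite[OF psc[OF CA]] finite_cr finite_subset by blast
  then obtain z where z: "z \<in> C" "z \<notin> cr" by blast
  obtain F where F: "F \<in> cells A" "F \<subseteq> S" "card (frontier F \<inter> cr) = 3" "2 \<le> card (C \<inter> (frontier F \<inter> cr))"
    "\<exists>y\<in>C \<inter> frontier F. y \<notin> cr" using curve_triangle[OF CA S z nodigon] by blast
  then obtain y where y: "y \<in> C" "y \<in> frontier F" "y \<notin> cr" by blast
  obtain G where G: "G \<in> cells A" "G \<subseteq> S" "card (frontier G \<inter> cr) = 3" "2 \<le> card (C \<inter> (frontier G \<inter> cr))" "y \<notin> frontier G"
    using curve_triangle[OF CA S y(1,3) nodigon] by blast
  have "F \<noteq> G" using y G by blast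
  then have "card {F,G} = 2" by simp
  moreover have sub: "{F,G} \<subseteq> {F \<in> cells A. F \<subseteq> S \<and> card (frontier F \<inter> cr) = 3 \<and> 2 \<le> card (C \<inter> (frontier F \<inter> cr))}"
    using F G by blast
  ultimately show ?thesis using card_mono[OF _ sub] finite_cells by simp
qed

lemma triangles_at_curve:
  assumes CA: "C \<in> A" and nodigon: "\<And>F. F \<in> cells A \<Longrightarrow> card (frontier F \<inter> cr) \<noteq> 2"
  shows "4 \<le> card {F \<in> cells A. card (frontier F \<inter> cr) = 3 \<and> 2 \<le> card (C \<inter> (frontier F \<inter> cr))}"
proof -
  define X where "X S = {F \<in> cells A. F \<subseteq> S \<and> card (frontier F \<inter> cr) = 3 \<and> 2 \<le> card (C \<inter> (frontier F \<inter> cr))}" for S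
  have 2: "2 \<le> card (X (inside C))" "2 \<le> card (X (outside C))"
    unfolding X_def by (rule triangles_at_side[OF CA _ nodigon]; simp)+
  have fin: "finite (X S)" for S unfolding X_def using finite_cells by simp
  have "X (inside C) \<inter> X (outside C) = {}"
  proof (rule ccontr)
    assume "X (inside C) \<inter> X (outside C) \<noteq> {}"
    then obtain F where "F \<in> cells A" "F \<subseteq> inside C" "F \<subseteq> outside C" unfolding X_def by blast
    then have "F \<subseteq> inside C \<inter> outside C" "F \<noteq> {}" using cell_facts(3) by blast+
    then show False by simp
  qed
  then have "card (X (inside C) \<union> X (outside C)) = card (X (inside C)) + card (X (outside C))"
    using fin by (intro card_Un_disjoint) auto
  moreover have sub: "X (inside C) \<union> X (outside C) \<subseteq> {F \<in> cells A. card (frontier F \<inter> cr) = 3 \<and> 2 \<le> card (C \<inter> (frontier F \<inter> cr))}"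
    unfolding X_def by blast
  ultimately show ?thesis using 2 card_mono[OF _ sub] finite_cells by fastforce
qed

text \<open>Each of the three corners lies on at most two curves, which makes at most six
  incidences, and every curve counted here uses two of them.\<close>

lemma curves_at_triangle:
  assumes F: "card (frontier F \<inter> cr) = 3"
  shows "card {C \<in> A. 2 \<le> card (C \<inter> (frontier F \<inter> cr))} \<le> 3"
proof -
  let ?P = "frontier F \<inter> cr" let ?Y = "{C \<in> A. 2 \<le> card (C \<inter> ?P)}"
  have finP: "finite ?P" using finite_cr by simp
  have two: "card {C \<in> A. v \<in> C} \<le> 2" for v
  proof (rule ccontr)
    assume "\<not> ?thesis"
    then obtain T where T: "T \<subseteq> {C \<in> A. v \<in> C}" "card T = 3"
      using obtain_subset_with_card_n[of 3 "{C \<in> A. v \<in> C}"] by (metis not_less_eq_eq numeral_2_eq_2 numeral_3_eq_3)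
    then obtain X Y Z where "T = {X,Y,Z}" "X \<noteq> Y" "X \<noteq> Z" "Y \<noteq> Z" by (auto simp: card_3_iff)
    then show False using triple_empty[of X Y Z] T by blast
  qed
  have "2 * card ?Y = (\<Sum>C\<in>?Y. 2)" by simp
  also have "\<dots> \<le> (\<Sum>C\<in>?Y. card (C \<inter> ?P))" by (intro sum_mono) auto
  also have "\<dots> \<le> (\<Sum>C\<in>A. card (C \<inter> ?P))" using finA by (intro sum_mono2) auto
  also have "\<dots> = (\<Sum>C\<in>A. card {v \<in> ?P. v \<in> C})"
    by (intro sum.cong arg_cong[of _ _ card]) auto
  also have "\<dots> = (\<Sum>v\<in>?P. card {C \<in> A. v \<in> C})" by (rule sum_card_swap[OF finA finP])
  also have "\<dots> \<le> (\<Sum>v\<in>?P. 2)" using two by (intro sum_mono) auto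
  also have "\<dots> = 6" using F by simp
  finally show ?thesis by simp
qed

theorem triangle_bound:
  assumes nodigon: "\<And>F. F \<in> cells A \<Longrightarrow> card (frontier F \<inter> cr) \<noteq> 2"
  shows "4 * card A \<le> 3 * num_kcells 3 A"
proof -
  let ?T = "{F \<in> cells A. card (frontier F \<inter> cr) = 3}"
  have finT: "finite ?T" using finite_cells by simp
  have "4 * card A = (\<Sum>C\<in>A. 4)" by simp
  also have "\<dots> \<le> (\<Sum>C\<in>A. card {F \<in> ?T. 2 \<le> card (C \<inter> (frontier F \<inter> cr))})"
  proof (rule sum_mono)
    fix C assume "C \<in> A"
    then show "4 \<le> card {F \<in> ?T. 2 \<le> card (C \<inter> (frontier F \<inter> cr))}"
      using triangles_at_curve[OF _ nodigon, of C] by (simp add: conj_assoc)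
  qed
  also have "\<dots> = (\<Sum>F\<in>?T. card {C \<in> A. 2 \<le> card (C \<inter> (frontier F \<inter> cr))})"
    by (rule sum_card_swap[OF finA finT])
  also have "\<dots> \<le> (\<Sum>F\<in>?T. 3)" using curves_at_triangle by (intro sum_mono) auto
  also have "\<dots> = 3 * num_kcells 3 A" by (simp add: num_kcells_def)
  finally show ?thesis .
qed

end

section \<open>At least eight triangles\<close>

text \<open>A finite subfamily is requested because \<open>card\<close> of an infinite set is
  \<open>0\<close>; in this form a lower bound can be stated before the set of components is known
  to be finite.\<close>

definition many_regions :: "complex set \<Rightarrow> nat \<Rightarrow> bool" where
  "many_regions K N \<longleftrightarrow> (\<exists>\<F>. finite \<F> \<and> \<F> \<subseteq> components (- K) \<and> N \<le> card \<F>)"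

text \<open>A path in \<open>K\<close> closes \<open>c\<close> to a Jordan curve. Near an interior
  point of \<open>c\<close> both sides of that curve occur, so the region containing the interior of
  \<open>c\<close> falls into at least two, while all other regions persist.\<close>

lemma many_regions_add_arc:
  fixes c :: "real \<Rightarrow> complex"
  assumes many: "many_regions K N" and K: "compact K" "path_connected K"
    and c: "arc c" "pathstart c = a" "pathfinish c = b" "path_image c \<inter> K = {a,b}"
  shows "many_regions (K \<union> path_image c) (Suc N)"
proof -
  obtain \<F> where \<F>: "finite \<F>" "\<F> \<subseteq> components (- K)" "N \<le> card \<F>" using many unfolding many_regions_def by blast
  have ab: "a \<in> K" "b \<in> K" "a \<noteq> b" using c arc_distinct_ends[OF c(1)] by auto
  obtain \<beta>0 where b0: "path \<beta>0" "path_image \<beta>0 \<subseteq> K" "pathstart \<beta>0 = b" "pathfinish \<beta>0 = a"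
    using K(2) ab unfolding path_connected_def by metis
  obtain \<beta> where \<beta>: "arc \<beta>" "path_image \<beta> \<subseteq> path_image \<beta>0" "pathstart \<beta> = b" "pathfinish \<beta> = a"
    using path_contains_arc[OF b0(1,3,4)] ab by metis
  let ?j = "c +++ \<beta>" let ?J = "path_image c \<union> path_image \<beta>"
  have "path_image c \<inter> path_image \<beta> \<subseteq> {a,b}" using \<beta>(2) b0(2) c(4) by blast
  then have j: "simple_path ?j" "pathfinish ?j = pathstart ?j" "path_image ?j = ?J"
    using c(1-3) \<beta> by (auto intro!: simple_path_join_loop simp: path_image_join insert_commute)
  note J = Jordan_inside_outside[OF j(1,2), unfolded j(3)]
  have JK: "?J \<subseteq> K \<union> path_image c" using \<beta>(2) b0(2) by blast
  have closedK: "closed K" using K(1) compact_imp_closed by blast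
  let ?c0 = "path_image c - {a,b}"
  have c0: "connected ?c0" "?c0 \<noteq> {}" "?c0 \<subseteq> - K"
    using connected_simple_path_endless[of c] nonempty_simple_path_endless[of c] c by (auto simp: arc_imp_simple_path)
  obtain G where G: "G \<in> components (- K)" "?c0 \<subseteq> G" using exists_component_superset[OF c0(3)] c0 by blast
  have oG: "open G" using open_components[OF _ G(1)] closedK by (simp add: open_Compl)
  obtain x0 where x0: "x0 \<in> ?c0" using c0(2) by blast
  have "x0 \<in> closure (inside ?J)" "x0 \<in> closure (outside ?J)"
    using J x0 closure_Un_frontier[of "inside ?J"] closure_Un_frontier[of "outside ?J"] by auto
  moreover have "x0 \<in> G" using x0 G(2) by blast
  ultimately have "G \<inter> inside ?J \<noteq> {}" "G \<inter> outside ?J \<noteq> {}"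
    using oG by (metis disjoint_iff open_Int_closure_eq_empty)+
  then obtain p q where p: "p \<in> G" "p \<in> inside ?J" and q: "q \<in> G" "q \<in> outside ?J" by blast
  have GK: "G \<inter> K = {}" using in_components_subset[OF G(1)] by blast
  have pn: "p \<notin> K \<union> path_image c" using p GK inside_no_overlap[of ?J] by blast
  have qn: "q \<notin> K \<union> path_image c" using q GK outside_no_overlap[of ?J] by blast
  define P Q where "P = connected_component_set (- (K \<union> path_image c)) p" and "Q = connected_component_set (- (K \<union> path_image c)) q"
  have PQ: "P \<in> components (- (K \<union> path_image c))" "Q \<in> components (- (K \<union> path_image c))" "p \<in> P" "q \<in> Q"
    unfolding P_def Q_def components_def using pn qn by (auto simp: connected_component_refl)
  have PQG: "P \<subseteq> G" "Q \<subseteq> G"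
    using components_maximal[OF G(1), of P] components_maximal[OF G(1), of Q]
      in_components_connected[OF PQ(1)] in_components_connected[OF PQ(2)] in_components_subset[OF PQ(1)] in_components_subset[OF PQ(2)] PQ(3,4) p q by blast+
  have neq: "P \<noteq> Q"
  proof
    assume "P = Q"
    have d: "P \<inter> ?J = {}" using in_components_subset[OF PQ(1)] JK by blast
    have "P \<subseteq> inside ?J \<or> P \<subseteq> outside ?J"
      using connected_sandwich[OF in_components_connected[OF PQ(1)] d j(3)[symmetric] j(1,2)] .
    then have "p \<in> inside ?J \<inter> outside ?J \<or> q \<in> inside ?J \<inter> outside ?J" using p q PQ \<open>P = Q\<close> by blast
    then show False by simp
  qed
  define \<F>' where "\<F>' = insert P (insert Q (\<F> - {G}))"
  have other: "F \<inter> G = {}" if "F \<in> \<F> - {G}" for F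
    using components_eq[of F "- K" G] that \<F>(2) G(1) by blast
  have "F \<in> components (- (K \<union> path_image c))" if F: "F \<in> \<F> - {G}" for F
  proof (rule components_intermediate_subset[of F "- K"])
    show "F \<in> components (- K)" using F \<F>(2) by blast
    then have "F \<subseteq> - K" using in_components_subset by blast
    then show "F \<subseteq> - (K \<union> path_image c)" using other[OF F] G(2) ab by blast
  qed auto
  then have sub: "\<F>' \<subseteq> components (- (K \<union> path_image c))" unfolding \<F>'_def using PQ by blast
  have "P \<notin> \<F> - {G}" "Q \<notin> \<F> - {G}" using other PQG PQ(3,4) by blast+
  then have "card \<F>' = Suc (Suc (card (\<F> - {G})))" unfolding \<F>'_def using \<F>(1) neq by simp
  moreover have "card \<F> \<le> Suc (card (\<F> - {G}))" using card_Suc_Diff1[OF \<F>(1), of G] by (cases "G \<in> \<F>") auto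
  ultimately have "Suc N \<le> card \<F>'" using \<F>(3) by simp
  moreover have "finite \<F>'" unfolding \<F>'_def using \<F>(1) by simp
  ultimately show ?thesis unfolding many_regions_def using sub by blast
qed

text \<open>The curve is added arc by arc between consecutive visits to \<open>K\<close>. The
  parameters \<open>0\<close> and \<open>1\<close> of the base point both belong to
  \<open>T\<close>, so there are \<open>card T - 1\<close> arcs; three elements of \<open>T\<close>
  ensure that no arc is the whole closed curve.\<close>

lemma many_regions_add_curve:
  fixes g :: "real \<Rightarrow> complex"
  assumes many: "many_regions K N" and K: "compact K" "path_connected K"
    and g: "simple_path g" "pathfinish g = pathstart g"
    and T: "T = {t \<in> {0..1}. g t \<in> K}" "finite T" "0 \<in> T" "3 \<le> card T"
  shows "many_regions (K \<union> path_image g) (N + (card T - 1))"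
proof -
  have g01: "g 1 = g 0" using g(2) by (simp add: pathstart_def pathfinish_def)
  have T1: "1 \<in> T" using T(1,3) g01 by auto
  have Tb: "0 \<le> t" "t \<le> 1" "g t \<in> K" if "t \<in> T" for t using that T(1) by auto
  have inj: "x = y \<or> x = 0 \<and> y = 1 \<or> x = 1 \<and> y = 0" if "0 \<le> x" "x \<le> 1" "0 \<le> y" "y \<le> 1" "g x = g y" for x y
    using g(1) that unfolding simple_path_def loop_free_def by auto
  have cont: "continuous_on {0..1} g" using g(1) by (simp add: simple_path_def path_def)
  have claim: "many_regions (K \<union> g ` {0..s}) (N + card {t \<in> T. t < s})" if "s \<in> T" for s
    using that
  proof (induction "card {t \<in> T. t < s}" arbitrary: s rule: less_induct)
    case less
    show ?case
    proof (cases "{t \<in> T. t < s} = {}")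
      case True
      then have "s = 0" using T(3) Tb[OF less.prems] by force
      then have "K \<union> g ` {0..s} = K" using Tb(3)[OF T(3)] by auto
      then show ?thesis using many unfolding True by simp
    next
      case False
      define t' where "t' = Max {t \<in> T. t < s}"
      have fin: "finite {t \<in> T. t < s}" using T(2) by simp
      have "t' \<in> {t \<in> T. t < s}" unfolding t'_def using fin False by (rule Max_in)
      then have t': "t' \<in> T" "t' < s" by auto
      have gap: "t \<le> t'" if "t \<in> T" "t < s" for t unfolding t'_def using fin that by (intro Max_ge) auto
      have "{t \<in> T. t < s} = insert t' {t \<in> T. t < t'}" using t' gap by force
      moreover have "t' \<notin> {t \<in> T. t < t'}" by simp
      ultimately have cs: "card {t \<in> T. t < s} = Suc (card {t \<in> T. t < t'})" using T(2) by simp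
      have IH: "many_regions (K \<union> g ` {0..t'}) (N + card {t \<in> T. t < t'})"
        using less.hyps[of t'] cs t' by simp
      note b = Tb[OF t'(1)] Tb[OF less.prems]
      have not01: "\<not> (t' = 0 \<and> s = 1)"
      proof
        assume h: "t' = 0 \<and> s = 1"
        have "T \<subseteq> {0,1}" using gap h Tb by fastforce
        then have "card T \<le> card {0::real,1}" by (intro card_mono) auto
        then show False using T(4) by simp
      qed
      have gne: "g t' \<noteq> g s" using inj[of t' s] b t'(2) not01 by auto
      have arcs: "arc (subpath t' s g)"
        using arc_simple_path_subpath[OF g(1), of t' s] b gne by auto
      have im: "path_image (subpath t' s g) = g ` {t'..s}" using t'(2) by (simp add: path_image_subpath)
      have int: "g ` {t'..s} \<inter> (K \<union> g ` {0..t'}) = {g t', g s}"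
      proof
        show "{g t', g s} \<subseteq> g ` {t'..s} \<inter> (K \<union> g ` {0..t'})" using t'(2) b by auto
        show "g ` {t'..s} \<inter> (K \<union> g ` {0..t'}) \<subseteq> {g t', g s}"
        proof
          fix z assume z: "z \<in> g ` {t'..s} \<inter> (K \<union> g ` {0..t'})"
          obtain r where r: "r \<in> {t'..s}" "z = g r" using z by (meson IntD1 imageE)
          have r01: "0 \<le> r" "r \<le> 1" using r(1) b by auto
          show "z \<in> {g t', g s}"
          proof (cases "z \<in> K")
            case True
            then have "r \<in> T" using r(2) r01 T(1) by auto
            then have "r = t' \<or> r = s" using gap[of r] r(1) by force
            then show ?thesis using r(2) by auto
          next
            case False
            then obtain r' where r': "r' \<in> {0..t'}" "z = g r'" using z by blast
            have "r = r' \<or> r = 0 \<and> r' = 1 \<or> r = 1 \<and> r' = 0" using inj[of r r'] r r' r01 b by auto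
            then have "r = t' \<or> r = s" using r(1) r'(1) b by auto
            then show ?thesis using r(2) by auto
          qed
        qed
      qed
      have con0: "continuous_on {0..t'} g" by (rule continuous_on_subset[OF cont]) (use b in auto)
      have cK: "compact (K \<union> g ` {0..t'})"
        using K(1) compact_continuous_image[OF con0] by (intro compact_Un) auto
      have "path_connected (g ` {0..t'})" by (rule path_connected_continuous_image[OF con0]) (simp add: convex_imp_path_connected)
      moreover have "K \<inter> g ` {0..t'} \<noteq> {}" using b by auto
      ultimately have pK: "path_connected (K \<union> g ` {0..t'})" using K(2) by (intro path_connected_Un) auto
      have "many_regions (K \<union> g ` {0..t'} \<union> path_image (subpath t' s g)) (Suc (N + card {t \<in> T. t < t'}))"
        by (rule many_regions_add_arc[OF IH cK pK arcs, of "g t'" "g s"]) (use im int in auto)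
      moreover have "K \<union> g ` {0..t'} \<union> path_image (subpath t' s g) = K \<union> g ` {0..s}"
      proof -
        have "{0..s} = {0..t'} \<union> {t'..s}" using b t'(2) by auto
        then show ?thesis unfolding im by (simp add: image_Un Un_assoc)
      qed
      ultimately show ?thesis using cs by simp
    qed
  qed
  have "{t \<in> T. t < 1} = T - {1}" using Tb by force
  then have "card {t \<in> T. t < 1} = card T - 1" using T1 T(2) by simp
  then show ?thesis using claim[OF T1] by (simp add: path_image_def)
qed

context arr
begin

text \<open>A curve added to \<open>k\<close> others meets them in \<open>2 k\<close> distinct
  points, since no three curves share a point. It is thus cut into \<open>2 k\<close> arcs, each of
  which contributes a region, and \<open>k (k - 1) + 2 k = (k + 1) k\<close>.\<close>

lemma many_regions_subarrangement:
  assumes "B \<subseteq> A" "B \<noteq> {}"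
  shows "path_connected (\<Union>B) \<and> many_regions (\<Union>B) (2 + card B * (card B - 1))"
proof -
  have "finite B" using assms finA finite_subset by blast
  then show ?thesis using assms(2,1)
  proof (induction B rule: finite_ne_induct)
    case (singleton C)
    obtain g :: "real \<Rightarrow> complex" where g: "simple_path g" "pathfinish g = pathstart g" "path_image g = C"
      using psc[of C] singleton unfolding pseudocircle_def by blast
    note J = Jordan_inside_outside[OF g(1,2), unfolded g(3)]
    have "path_connected C" using g by (metis path_connected_path_image simple_path_imp_path)
    moreover have ne: "inside C \<noteq> outside C"
    proof
      assume h: "inside C = outside C"
      have "inside C \<inter> outside C = {}" by simp
      then have "inside C = {}" unfolding h by simp
      then show False using J by blast
    qed
    moreover have "{inside C, outside C} \<subseteq> components (- C)" using J by (simp add: inside_in_components outside_in_components)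
    moreover have "card {inside C, outside C} = 2" using ne by simp
    ultimately show ?case unfolding many_regions_def by (intro conjI exI[of _ "{inside C, outside C}"]) simp_all
  next
    case (insert D B)
    have IH: "path_connected (\<Union>B)" "many_regions (\<Union>B) (2 + card B * (card B - 1))" using insert by auto
    have DA: "D \<in> A" and BA: "B \<subseteq> A" using insert.prems by auto
    have cmp: "compact (\<Union>B)" using insert.hyps BA psc pseudocircle_compact by (intro compact_Union) auto
    have cc: "finite (C \<inter> D)" "card (C \<inter> D) = 2" if "C \<in> B" for C
      using cross_card[of C D] that BA DA insert.hyps(3) by blast+
    obtain C0 where C0: "C0 \<in> B" using insert.hyps by blast
    have "C0 \<inter> D \<noteq> {}" using cc(2)[OF C0] by auto
    then obtain z where z: "z \<in> C0" "z \<in> D" by blast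
    obtain g :: "real \<Rightarrow> complex" where g: "simple_path g" "pathfinish g = pathstart g" "path_image g = D" "g 0 = z" "g 1 = z"
      using pseudocircle_at[OF psc[OF DA] z(2)] .
    define T where "T = {t \<in> {0..1}. g t \<in> \<Union>B}"
    have inj: "inj_on g {0..<1}"
      using g(1) unfolding simple_path_def loop_free_def inj_on_def by force
    have eq: "g ` (T - {1}) = (\<Union>C\<in>B. C \<inter> D)"
    proof
      show "g ` (T - {1}) \<subseteq> (\<Union>C\<in>B. C \<inter> D)"
        using g(3) unfolding T_def path_image_def by blast
      show "(\<Union>C\<in>B. C \<inter> D) \<subseteq> g ` (T - {1})"
      proof
        fix x assume "x \<in> (\<Union>C\<in>B. C \<inter> D)"
        then have x: "x \<in> \<Union>B" "x \<in> D" by auto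
        then have "x \<in> g ` {0..1}" using g(3) unfolding path_image_def by simp
        then obtain t where t: "t \<in> {0..1}" "x = g t" by (rule imageE)
        show "x \<in> g ` (T - {1})"
        proof (cases "t = 1")
          case True
          then have "x = g 0" using t g by simp
          then show ?thesis using x unfolding T_def by auto
        next
          case False
          then show ?thesis using t x unfolding T_def by auto
        qed
      qed
    qed
    have disj: "(C \<inter> D) \<inter> (C' \<inter> D) = {}" if "C \<in> B" "C' \<in> B" "C \<noteq> C'" for C C'
      using triple_empty[of C C' D] that BA DA insert.hyps(3) by blast
    have "card (\<Union>C\<in>B. C \<inter> D) = (\<Sum>C\<in>B. card (C \<inter> D))"
      by (rule card_UN_disjoint) (use insert.hyps(1) cc disj in auto)
    then have c2: "card (\<Union>C\<in>B. C \<inter> D) = 2 * card B" using cc by simp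
    have finU: "finite (\<Union>C\<in>B. C \<inter> D)" using insert.hyps(1) cc(1) by (rule finite_UN_I)
    have T01: "T - {1} \<subseteq> {0..<1}" unfolding T_def by auto
    have injT: "inj_on g (T - {1})" using inj T01 by (rule inj_on_subset)
    have "finite (T - {1})" using finU eq injT finite_imageD by metis
    then have finT: "finite T" by simp
    have T1: "1 \<in> T" unfolding T_def using g(5) z C0 by auto
    have T0: "0 \<in> T" unfolding T_def using g(4) z C0 by auto
    have "card (T - {1}) = 2 * card B" using card_image[OF injT] eq c2 by simp
    then have cT: "card T = 2 * card B + 1" using T1 finT by (metis Suc_eq_plus1 card_Suc_Diff1)
    have cB: "1 \<le> card B" using insert.hyps(1,2) by (simp add: Suc_leI card_gt_0_iff)
    have "many_regions (\<Union>B \<union> path_image g) (2 + card B * (card B - 1) + (card T - 1))"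
      by (rule many_regions_add_curve[OF IH(2) cmp IH(1) g(1,2) T_def finT T0]) (use cT cB in simp)
    moreover have "2 + card B * (card B - 1) + (card T - 1) = 2 + card (insert D B) * (card (insert D B) - 1)"
      using cT insert.hyps cB by (cases "card B") (simp_all add: algebra_simps)
    moreover have "path_connected (\<Union>B \<union> D)"
    proof (rule path_connected_Un[OF IH(1)])
      show "path_connected D" using g by (metis path_connected_path_image simple_path_imp_path)
      show "\<Union>B \<inter> D \<noteq> {}" using z C0 by blast
    qed
    ultimately show ?case using g(3) by (simp add: Un_commute)
  qed
qed

lemma card_cells_ge: "2 + card A * (card A - 1) \<le> card (cells A)"
proof -
  have "A \<noteq> {}" using n2 by auto
  then obtain \<F> where "finite \<F>" "\<F> \<subseteq> components (- U)" "2 + card A * (card A - 1) \<le> card \<F>"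
    using many_regions_subarrangement[of A] unfolding many_regions_def by auto
  then show ?thesis using card_mono[OF finite_cells, of \<F>] unfolding cells_def by linarith
qed

theorem eight_triangles:
  assumes nodigon: "\<And>F. F \<in> cells A \<Longrightarrow> card (frontier F \<inter> cr) \<noteq> 2"
  shows "8 \<le> num_kcells 3 A"
proof -
  let ?k = "\<lambda>F. card (frontier F \<inter> cr)" let ?T = "{F \<in> cells A. ?k F = 3}"
  have "4 \<le> ?k F + (if ?k F = 3 then 1 else 0)" if "F \<in> cells A" for F
    using cell_two_crossings[OF that] nodigon[OF that] by auto
  then have "(\<Sum>F\<in>cells A. 4) \<le> (\<Sum>F\<in>cells A. ?k F + (if ?k F = 3 then 1 else 0))" by (rule sum_mono)
  also have "\<dots> = (\<Sum>F\<in>cells A. ?k F) + card ?T"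
    using finite_cells by (simp add: sum.distrib sum.If_cases Int_def)
  finally have "4 * card (cells A) \<le> 4 * (card A * (card A - 1)) + card ?T" using corner_count by simp
  then show ?thesis using card_cells_ge by (simp add: num_kcells_def)
qed

end

lemma admissible_bounds:
  assumes "admissible n A" "2 \<le> n"
  shows "4 * n \<le> 3 * num_kcells 3 A" "8 \<le> num_kcells 3 A"
proof -
  have A: "arrangement A" "simple_arr A" "pairwise_intersecting A" "card A = n" "num_kcells 2 A = 0"
    using assms(1) by (auto simp: admissible_def digon_free_def)
  interpret arr A by unfold_locales (use A assms(2) in auto)
  have "card (frontier F \<inter> cr) \<noteq> 2" if "F \<in> cells A" for F
  proof
    assume "card (frontier F \<inter> cr) = 2"
    then have "F \<in> {F \<in> cells A. card (frontier F \<inter> cr) = 2}" using that by simp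
    moreover have "finite {F \<in> cells A. card (frontier F \<inter> cr) = 2}" using finite_cells by simp
    ultimately show False using A(5) by (auto simp: num_kcells_def)
  qed
  then show "4 * n \<le> 3 * num_kcells 3 A" "8 \<le> num_kcells 3 A"
    using triangle_bound eight_triangles A(4) by auto
qed

section \<open>Wiring diagrams on a cylinder\<close>

text \<open>Piecewise linear interpolation of the values of \<open>F\<close> at the
  integers.\<close>

definition interp :: "(int \<Rightarrow> real) \<Rightarrow> real \<Rightarrow> real" where
  "interp F t = F \<lfloor>t\<rfloor> + (t - of_int \<lfloor>t\<rfloor>) * (F (\<lfloor>t\<rfloor> + 1) - F \<lfloor>t\<rfloor>)"

lemma interp_int [simp]: "interp F (of_int k) = F k"
  by (simp add: interp_def)

lemma interp_seg:
  assumes "of_int k \<le> t" "t \<le> of_int k + 1"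
  shows "interp F t = (1 - (t - of_int k)) * F k + (t - of_int k) * F (k + 1)"
proof (cases "t = of_int k + 1")
  case True
  then have "t = of_int (k + 1)" by simp
  then show ?thesis by (simp only: interp_int) simp
next
  case False
  then have "\<lfloor>t\<rfloor> = k" using assms by (intro floor_unique) auto
  then show ?thesis by (simp add: interp_def algebra_simps)
qed

lemma interp_isCont: "isCont (interp F) t"
proof -
  have seg: "continuous_on {of_int k..of_int k + 1} (interp F)" for k
    by (rule continuous_on_eq[where f = "\<lambda>t. (1 - (t - of_int k)) * F k + (t - of_int k) * F (k + 1)"])
      (auto intro!: continuous_intros simp: interp_seg)
  define k where "k = \<lfloor>t\<rfloor>"
  have "continuous_on ({of_int (k-1)..of_int (k-1) + 1} \<union> {of_int k..of_int k + 1}) (interp F)"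
    by (intro continuous_on_closed_Un seg) auto
  moreover have "{of_int (k-1)<..<of_int k + 1} \<subseteq> {of_int (k-1)..of_int (k-1) + 1} \<union> {of_int k..of_int k + (1::real)}" by auto
  ultimately have "continuous_on {of_int (k-1)<..<of_int k + 1} (interp F)" by (rule continuous_on_subset)
  moreover have "t \<in> {of_int (k-1)<..<of_int k + 1}" unfolding k_def by simp linarith
  ultimately show ?thesis by (simp add: continuous_on_eq_continuous_at)
qed

lemma interp_continuous: "continuous_on X (interp F)"
  using interp_isCont by (simp add: continuous_at_imp_continuous_on)

lemma interp_periodic:
  assumes "\<And>k. F (k + p) = F k"
  shows "interp F (t + of_int p) = interp F t"
proof -
  have "\<lfloor>t + of_int p\<rfloor> = \<lfloor>t\<rfloor> + p" by simp
  moreover have "F (\<lfloor>t\<rfloor> + p) = F \<lfloor>t\<rfloor>" "F (\<lfloor>t\<rfloor> + p + 1) = F (\<lfloor>t\<rfloor> + 1)"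
    using assms[of "\<lfloor>t\<rfloor>"] assms[of "\<lfloor>t\<rfloor> + 1"] by (auto simp: algebra_simps)
  ultimately show ?thesis by (simp add: interp_def)
qed

lemma periodic_shift:
  fixes f :: "'a::comm_ring_1 \<Rightarrow> 'b"
  assumes "\<And>t. f (t + p) = f t"
  shows "f (t + of_int m * p) = f t"
proof (induction m arbitrary: t rule: int_induct[where k = 0])
  case base then show ?case by simp
next
  case (step1 i)
  have "f (t + of_int (i + 1) * p) = f ((t + p) + of_int i * p)" by (simp add: algebra_simps)
  then show ?case using step1 assms by simp
next
  case (step2 i)
  have "f (t + of_int (i - 1) * p) = f ((t - p) + of_int i * p)" by (simp add: algebra_simps)
  also have "\<dots> = f (t - p)" using step2 by simp
  also have "\<dots> = f t" using assms[of "t - p"] by simp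
  finally show ?case .
qed

text \<open>A periodic wiring diagram: at time \<open>s\<close> the strands at positions \<open>W s\<close> and \<open>W s + 1\<close>
  cross. Step \<open>s\<close> is drawn over the interval from \<open>2 s\<close> to \<open>2 s + 2\<close>, with the crossing at \<open>2 s + 1\<close>.\<close>

locale wiring =
  fixes n N :: nat and W :: "int \<Rightarrow> nat" and P :: "'i \<Rightarrow> int \<Rightarrow> nat" and I :: "'i set"
  assumes N: "0 < N" and n2: "2 \<le> n" and Wb: "Suc (W s) < n" and Wper: "W (s + int N) = W s"
    and Pper: "i \<in> I \<Longrightarrow> P i (s + int N) = P i s"
    and bij: "bij_betw (\<lambda>i. P i s) I {..<n}"
    and stepP: "i \<in> I \<Longrightarrow> P i (s + 1) = (if P i s = W s then Suc (W s) else if P i s = Suc (W s) then W s else P i s)"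
    and pair: "i \<in> I \<Longrightarrow> j \<in> I \<Longrightarrow> i \<noteq> j \<Longrightarrow> \<exists>!s. s \<in> {0..<int N} \<and> P i s = W s \<and> P j s = Suc (W s)"
begin

definition Hv :: "'i \<Rightarrow> int \<Rightarrow> real" where
  "Hv i k = (if even k then real (P i (k div 2)) else (real (P i (k div 2)) + real (P i (k div 2 + 1))) / 2)"

text \<open>The same drawing read by levels and not by strands: at a crossing the two levels touch
  where the two strands change places. Levels stay ordered at all times, so cells become gaps
  between consecutive levels.\<close>

definition Lv :: "nat \<Rightarrow> int \<Rightarrow> real" where
  "Lv j k = (if odd k \<and> (j = W (k div 2) \<or> j = Suc (W (k div 2))) then real (W (k div 2)) + 1/2 else real j)"

definition h :: "'i \<Rightarrow> real \<Rightarrow> real" where "h i = interp (Hv i)"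
definition lv :: "nat \<Rightarrow> real \<Rightarrow> real" where "lv j = interp (Lv j)"
text \<open>The rounding makes a strand change its level exactly at the odd time of a crossing: the
  unit interval before it uses the old position, the one after it the new position.\<close>

definition Q :: "'i \<Rightarrow> int \<Rightarrow> nat" where "Q i k = P i ((k + 1) div 2)"
text \<open>The exponential map unrolls the punctured plane: \<open>x\<close> is the logarithm of
  the radius, and the time \<open>t\<close> has period \<open>2 N\<close>.\<close>

definition E :: "real \<Rightarrow> real \<Rightarrow> complex" where "E t x = exp (Complex x (pi * t / real N))"
definition curve :: "'i \<Rightarrow> complex set" where "curve i = range (\<lambda>t. E t (h i t))"
definition V :: "int \<Rightarrow> complex" where "V s = E (2 * of_int s + 1) (real (W s) + 1/2)"

lemma finI: "finite I" and cardI: "card I = n"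
  using bij_betw_finite[OF bij] bij_betw_same_card[OF bij] by auto

lemma P_inj: "i \<in> I \<Longrightarrow> j \<in> I \<Longrightarrow> P i s = P j s \<Longrightarrow> i = j"
  using bij[of s] unfolding bij_betw_def inj_on_def by blast

lemma P_less: "i \<in> I \<Longrightarrow> P i s < n"
  using bij[of s] unfolding bij_betw_def by blast

lemma P_surj: "p < n \<Longrightarrow> \<exists>i\<in>I. P i s = p"
  using bij[of s] unfolding bij_betw_def by (metis imageE lessThan_iff)

lemma Q_inj: "i \<in> I \<Longrightarrow> j \<in> I \<Longrightarrow> Q i k = Q j k \<Longrightarrow> i = j"
  unfolding Q_def by (rule P_inj)

lemma Q_less: "i \<in> I \<Longrightarrow> Q i k < n"
  unfolding Q_def by (rule P_less)

lemma h_seg: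
  assumes i: "i \<in> I" and t: "of_int k \<le> t" "t \<le> of_int k + 1"
  shows "h i t = lv (Q i k) t"
proof -
  have "Hv i k = Lv (Q i k) k \<and> Hv i (k + 1) = Lv (Q i k) (k + 1)"
  proof (cases "even k")
    case True
    then obtain s where s: "k = 2 * s" by (elim evenE)
    then show ?thesis using stepP[OF i, of s] unfolding Hv_def Lv_def Q_def by auto
  next
    case False
    then obtain s where s: "k = 2 * s + 1" by (elim oddE)
    then have "k div 2 = s" "(k + 1) div 2 = s + 1" "k + 1 = 2 * (s + 1)" by auto
    then show ?thesis using stepP[OF i, of s] s unfolding Hv_def Lv_def Q_def by (auto simp: add.commute[of 1])
  qed
  then show ?thesis unfolding h_def lv_def by (simp add: interp_seg[OF t])
qed

lemma h_floor: "i \<in> I \<Longrightarrow> h i t = lv (Q i \<lfloor>t\<rfloor>) t"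
  by (rule h_seg) linarith+

lemma lv_continuous: "continuous_on X (lv j)"
  unfolding lv_def by (rule interp_continuous)

lemma h_continuous: "continuous_on X (h i)"
  unfolding h_def by (rule interp_continuous)

lemma Lv_step: "Lv j k \<le> Lv (Suc j) k" "\<not> (odd k \<and> W (k div 2) = j) \<Longrightarrow> Lv j k < Lv (Suc j) k"
  unfolding Lv_def by auto

lemma lv_step: "lv j t \<le> lv (Suc j) t" "\<not> (\<exists>s. t = 2 * of_int s + 1 \<and> W s = j) \<Longrightarrow> lv j t < lv (Suc j) t"
proof -
  define k where "k = \<lfloor>t\<rfloor>" define u where "u = t - of_int k"
  have t: "of_int k \<le> t" "t \<le> of_int k + 1" unfolding k_def by linarith+
  have u: "0 \<le> u" "u < 1" unfolding u_def k_def by linarith+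
  have eq: "lv j' t = (1 - u) * Lv j' k + u * Lv j' (k + 1)" for j'
    unfolding lv_def u_def by (rule interp_seg[OF t])
  have le: "(1 - u) * Lv j k \<le> (1 - u) * Lv (Suc j) k" "u * Lv j (k + 1) \<le> u * Lv (Suc j) (k + 1)"
    using u Lv_step(1) by (auto intro: mult_left_mono)
  then show "lv j t \<le> lv (Suc j) t" unfolding eq by linarith
  assume no: "\<not> (\<exists>s. t = 2 * of_int s + 1 \<and> W s = j)"
  show "lv j t < lv (Suc j) t"
  proof (cases "odd k \<and> W (k div 2) = j")
    case False
    then have "(1 - u) * Lv j k < (1 - u) * Lv (Suc j) k" using u Lv_step(2)[of k j] by auto
    then show ?thesis unfolding eq using le by linarith
  next
    case True
    then obtain s where s: "k = 2 * s + 1" by (metis oddE)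
    then have "W s = j" using True by simp
    then have "u \<noteq> 0" using no s unfolding u_def by auto
    then have "0 < u" using u by auto
    moreover have "Lv j (k + 1) < Lv (Suc j) (k + 1)" using True by (intro Lv_step(2)) auto
    ultimately have "u * Lv j (k + 1) < u * Lv (Suc j) (k + 1)" by simp
    then show ?thesis unfolding eq using le by linarith
  qed
qed

lemma lv_mono: "j \<le> j' \<Longrightarrow> lv j t \<le> lv j' t"
  by (rule lift_Suc_mono_le[of "\<lambda>j. lv j t"]) (auto intro: lv_step)

lemma lv_eq:
  assumes "j < j'" "lv j t = lv j' t"
  shows "j' = Suc j" "\<exists>s. t = 2 * of_int s + 1 \<and> W s = j"
proof -
  have e: "lv j t = lv (Suc j) t" using lv_mono[of "Suc j" j' t] lv_step(1)[of j t] assms by auto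
  then show 1: "\<exists>s. t = 2 * of_int s + 1 \<and> W s = j" using lv_step(2)[of t j] by force
  show "j' = Suc j"
  proof (rule ccontr)
    assume "j' \<noteq> Suc j"
    then have "Suc (Suc j) \<le> j'" using assms by auto
    then have "lv (Suc j) t = lv (Suc (Suc j)) t" using lv_mono[of "Suc (Suc j)" j' t] lv_step(1)[of "Suc j" t] e assms by auto
    then obtain s' where "t = 2 * of_int s' + 1" "W s' = Suc j" using lv_step(2)[of t "Suc j"] by force
    moreover obtain s where "t = 2 * of_int s + 1" "W s = j" using 1 by blast
    ultimately show False by simp
  qed
qed

lemma P_before: assumes "i \<in> I" shows "P i (s + 1) = W s \<Longrightarrow> P i s = Suc (W s)" "P i (s + 1) = Suc (W s) \<Longrightarrow> P i s = W s"
  using stepP[OF assms, of s] by (auto split: if_splits)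

lemma h_eq_aux:
  assumes "i \<in> I" "j \<in> I" "h i t = h j t" "Q i \<lfloor>t\<rfloor> < Q j \<lfloor>t\<rfloor>"
  shows "\<exists>s. t = 2 * of_int s + 1 \<and> P i s = Suc (W s) \<and> P j s = W s"
proof -
  have e: "lv (Q i \<lfloor>t\<rfloor>) t = lv (Q j \<lfloor>t\<rfloor>) t" using assms h_floor by simp
  obtain s where s: "t = 2 * of_int s + 1" "W s = Q i \<lfloor>t\<rfloor>" using lv_eq(2)[OF assms(4) e] by blast
  have "t = of_int (2 * s + 1)" using s(1) by simp
  then have "\<lfloor>t\<rfloor> = 2 * s + 1" by (simp only: floor_of_int)
  then have Qs: "Q i \<lfloor>t\<rfloor> = P i (s + 1)" "Q j \<lfloor>t\<rfloor> = P j (s + 1)" unfolding Q_def by (auto simp: add.commute[of 1])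
  have "Q j \<lfloor>t\<rfloor> = Suc (Q i \<lfloor>t\<rfloor>)" using lv_eq(1)[OF assms(4) e] .
  then show ?thesis using P_before(1)[OF assms(1), of s] P_before(2)[OF assms(2), of s] s Qs by auto
qed

lemma Hv_cross: "i \<in> I \<Longrightarrow> P i s = W s \<or> P i s = Suc (W s) \<Longrightarrow> h i (2 * of_int s + 1) = real (W s) + 1/2"
proof -
  assume i: "i \<in> I" "P i s = W s \<or> P i s = Suc (W s)"
  have "h i (of_int (2 * s + 1)) = Hv i (2 * s + 1)" unfolding h_def by (rule interp_int)
  also have "\<dots> = real (W s) + 1/2" unfolding Hv_def using stepP[OF i(1), of s] i(2) by auto
  finally show ?thesis by simp
qed

lemma h_eq_iff:
  assumes "i \<in> I" "j \<in> I" "i \<noteq> j"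
  shows "h i t = h j t \<longleftrightarrow> (\<exists>s. t = 2 * of_int s + 1 \<and> (P i s = W s \<and> P j s = Suc (W s) \<or> P i s = Suc (W s) \<and> P j s = W s))"
proof
  assume e: "h i t = h j t"
  have "Q i \<lfloor>t\<rfloor> \<noteq> Q j \<lfloor>t\<rfloor>" using Q_inj assms by blast
  then consider "Q i \<lfloor>t\<rfloor> < Q j \<lfloor>t\<rfloor>" | "Q j \<lfloor>t\<rfloor> < Q i \<lfloor>t\<rfloor>" by linarith
  then show "\<exists>s. t = 2 * of_int s + 1 \<and> (P i s = W s \<and> P j s = Suc (W s) \<or> P i s = Suc (W s) \<and> P j s = W s)"
  proof cases
    case 1 then show ?thesis using h_eq_aux[OF assms(1,2) e] by blast
  next
    case 2 then show ?thesis using h_eq_aux[OF assms(2,1) e[symmetric]] by blast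
  qed
next
  assume "\<exists>s. t = 2 * of_int s + 1 \<and> (P i s = W s \<and> P j s = Suc (W s) \<or> P i s = Suc (W s) \<and> P j s = W s)"
  then show "h i t = h j t" using Hv_cross[OF assms(1)] Hv_cross[OF assms(2)] by auto
qed

lemma Hv_per: "i \<in> I \<Longrightarrow> Hv i (k + 2 * int N) = Hv i k"
proof -
  assume i: "i \<in> I"
  have "(k + 2 * int N) div 2 = k div 2 + int N" by simp
  moreover have "P i (k div 2 + 1 + int N) = P i (k div 2 + 1)" using Pper[OF i, of "k div 2 + 1"] by simp
  ultimately show ?thesis unfolding Hv_def using Pper[OF i, of "k div 2"] by (simp add: ac_simps)
qed

lemma h_per: assumes "i \<in> I" shows "h i (t + of_int m * (2 * real N)) = h i t"
  unfolding h_def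
proof (rule periodic_shift)
  show "interp (Hv i) (t + 2 * real N) = interp (Hv i) t" for t
    using interp_periodic[of "Hv i" "2 * int N" t] Hv_per[OF assms] by simp
qed

lemma W_per: "W (s + m * int N) = W s"
  using periodic_shift[of W "int N" s m] Wper by simp

lemma P_per: assumes "i \<in> I" shows "P i (s + m * int N) = P i s"
  using periodic_shift[of "P i" "int N" s m] Pper[OF assms] by simp

lemma E_eq_iff: "E t x = E t' x' \<longleftrightarrow> x = x' \<and> (\<exists>m::int. t = t' + of_int m * (2 * real N))"
proof -
  have "E t x = E t' x' \<longleftrightarrow> (\<exists>m::int. Complex x (pi * t / real N) = Complex x' (pi * t' / real N) + (of_int (2 * m) * pi) * \<i>)"
    unfolding E_def by (rule exp_eq)
  also have "\<dots> \<longleftrightarrow> x = x' \<and> (\<exists>m::int. pi * t / real N = pi * t' / real N + of_int (2 * m) * pi)"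
    by (auto simp: complex_eq_iff)
  also have "\<dots> \<longleftrightarrow> x = x' \<and> (\<exists>m::int. t = t' + of_int m * (2 * real N))"
  proof -
    have "pi * t / real N = pi * t' / real N + of_int (2 * m) * pi \<longleftrightarrow> t = t' + of_int m * (2 * real N)" for m :: int
    proof -
      have "pi * t / real N = pi * t' / real N + of_int (2 * m) * pi \<longleftrightarrow> pi * t = pi * (t' + of_int m * (2 * real N))"
        using N by (simp add: field_simps)
      then show ?thesis by simp
    qed
    then show ?thesis by simp
  qed
  finally show ?thesis .
qed

lemma E_surj: assumes "z \<noteq> 0" shows "\<exists>t x. z = E t x"
proof -
  have "Complex (Re (Ln z)) (pi * (Im (Ln z) * real N / pi) / real N) = Ln z" using N by (simp add: complex_eq_iff)
  then have "z = E (Im (Ln z) * real N / pi) (Re (Ln z))" unfolding E_def using exp_Ln[OF assms] by presburger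
  then show ?thesis by blast
qed

lemma E_continuous: "continuous_on X f \<Longrightarrow> continuous_on X k \<Longrightarrow> continuous_on X (\<lambda>p. E (f p) (k p))"
  unfolding E_def Complex_eq by (intro continuous_intros) (use N in auto)

lemma curve_iff: "i \<in> I \<Longrightarrow> E t x \<in> curve i \<longleftrightarrow> x = h i t"
proof -
  assume i: "i \<in> I"
  show ?thesis
  proof
    assume "E t x \<in> curve i"
    then obtain t' where "E t x = E t' (h i t')" unfolding curve_def by blast
    then show "x = h i t" using h_per[OF i] unfolding E_eq_iff by auto
  qed (auto simp: curve_def)
qed

lemma curve_path:
  assumes i: "i \<in> I"
  obtains g :: "real \<Rightarrow> complex" where "simple_path g" "pathfinish g = pathstart g" "path_image g = curve i"
proof -
  define g where "g u = E (2 * real N * u) (h i (2 * real N * u))" for u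
  have per: "h i (2 * real N) = h i 0" using h_per[OF i, of 0 1] by simp
  have g01: "g 1 = g 0" unfolding g_def E_eq_iff using per by (auto intro: exI[of _ 1])
  have "continuous_on {0..1} g"
    unfolding g_def by (intro E_continuous continuous_intros continuous_on_compose2[OF h_continuous[of UNIV]]) auto
  moreover have "x = y \<or> x = 0 \<and> y = 1 \<or> x = 1 \<and> y = 0" if xy: "x \<in> {0..1}" "y \<in> {0..1}" "g x = g y" for x y
  proof -
    obtain m :: int where "2 * real N * x = 2 * real N * y + of_int m * (2 * real N)" using xy(3) unfolding g_def E_eq_iff by blast
    then have "2 * real N * x = 2 * real N * (y + of_int m)" by (simp add: algebra_simps)
    then have e: "x = y + of_int m" using N by simp
    then have "- 1 \<le> real_of_int m" "real_of_int m \<le> 1" using xy by auto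
    then have "m = -1 \<or> m = 0 \<or> m = 1" by linarith
    then show ?thesis using e xy(1,2) by auto
  qed
  ultimately have sp: "simple_path g" unfolding simple_path_def loop_free_def path_def by blast
  have "path_image g = curve i"
  proof
    show "path_image g \<subseteq> curve i" unfolding path_image_def g_def curve_def by blast
    show "curve i \<subseteq> path_image g"
    proof
      fix z assume "z \<in> curve i"
      then obtain t where t: "z = E t (h i t)" unfolding curve_def by blast
      define q where "q = t / (2 * real N)" define u where "u = q - of_int \<lfloor>q\<rfloor>"
      have u: "0 \<le> u" "u \<le> 1" unfolding u_def by linarith+
      have tu: "t = 2 * real N * u + of_int \<lfloor>q\<rfloor> * (2 * real N)" unfolding u_def q_def using N by (simp add: field_simps)
      have "h i t = h i (2 * real N * u)" unfolding tu by (rule h_per[OF i])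
      then have "z = g u" unfolding t g_def E_eq_iff using tu by blast
      then show "z \<in> path_image g" using u unfolding path_image_def by auto
    qed
  qed
  then show thesis using that[of g] sp g01 by (simp add: pathstart_def pathfinish_def)
qed

lemma curve_pseudocircle: "i \<in> I \<Longrightarrow> pseudocircle (curve i)"
  using curve_path[of i] unfolding pseudocircle_def by blast

lemma connected_strip:
  assumes "continuous_on UNIV a" "continuous_on UNIV b" "connected X" "connected Y"
  shows "connected ((\<lambda>(t, x). E t (a t + x * b t)) ` (X \<times> Y))"
proof (rule connected_continuous_image)
  have "continuous_on (X \<times> Y) (\<lambda>p. E (fst p) (a (fst p) + snd p * b (fst p)))"
    by (intro E_continuous continuous_intros continuous_on_compose2[OF assms(1)] continuous_on_compose2[OF assms(2)]) auto
  then show "continuous_on (X \<times> Y) (\<lambda>(t, x). E t (a t + x * b t))" by (simp add: case_prod_beta)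
  show "connected (X \<times> Y)" using assms(3,4) by (rule connected_Times)
qed

lemma closure_strip:
  assumes "continuous_on UNIV a" "continuous_on UNIV b" "t \<in> closure X" "x \<in> closure Y"
  shows "E t (a t + x * b t) \<in> closure ((\<lambda>(t, x). E t (a t + x * b t)) ` (X \<times> Y))"
proof -
  have "continuous_on (closure (X \<times> Y)) (\<lambda>p. E (fst p) (a (fst p) + snd p * b (fst p)))"
    by (intro E_continuous continuous_intros continuous_on_compose2[OF assms(1)] continuous_on_compose2[OF assms(2)]) auto
  then have "continuous_on (closure (X \<times> Y)) (\<lambda>(t, x). E t (a t + x * b t))" by (simp add: case_prod_beta)
  then have "(\<lambda>(t, x). E t (a t + x * b t)) ` closure (X \<times> Y) \<subseteq> closure ((\<lambda>(t, x). E t (a t + x * b t)) ` (X \<times> Y))"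
    by (rule image_closure_subset) (auto simp: closure_subset)
  moreover have "(t, x) \<in> closure (X \<times> Y)" using assms(3,4) by (simp add: closure_Times)
  ultimately show ?thesis by (metis (no_types, lifting) case_prod_conv image_subset_iff)
qed

text \<open>The region above the curve is unbounded, hence outside. If the region below were outside
  as well, only the origin could be inside, and a single point is not open.\<close>

lemma curve_sides:
  assumes i: "i \<in> I"
  shows "x < h i t \<Longrightarrow> E t x \<in> inside (curve i)" "h i t < x \<Longrightarrow> E t x \<in> outside (curve i)"
proof -
  obtain g :: "real \<Rightarrow> complex" where g: "simple_path g" "pathfinish g = pathstart g" "path_image g = curve i"
    using curve_path[OF i] .
  note J0 = Jordan_inside_outside[OF g(1,2), unfolded g(3)]
  have J: "bounded (inside (curve i))" "open (inside (curve i))" "inside (curve i) \<noteq> {}"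
    using J0 by blast+
  have io: "z \<notin> outside (curve i)" if z: "z \<in> inside (curve i)" for z
  proof -
    have "inside (curve i) \<inter> outside (curve i) = {}" by (rule inside_Int_outside)
    then show ?thesis using z by (meson disjoint_iff)
  qed
  define A where "A = (\<lambda>(t, x). E t (h i t + x * 1)) ` (UNIV \<times> {0<..})"
  define B where "B = (\<lambda>(t, x). E t (h i t + x * 1)) ` (UNIV \<times> {..<0})"
  have con: "connected A" "connected B" unfolding A_def B_def
    by (rule connected_strip; (intro h_continuous continuous_intros)?; simp)+
  have Am: "E t x \<in> A" if "h i t < x" for t x
    unfolding A_def using that by (intro image_eqI[of _ _ "(t, x - h i t)"]) auto
  have Bm: "E t x \<in> B" if "x < h i t" for t x
    unfolding B_def using that by (intro image_eqI[of _ _ "(t, x - h i t)"]) auto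
  have dis: "A \<inter> curve i = {}" "B \<inter> curve i = {}"
    unfolding A_def B_def using curve_iff[OF i] by auto
  note sA = connected_sandwich[OF con(1) dis(1) g(3)[symmetric] g(1,2)]
  note sB = connected_sandwich[OF con(2) dis(2) g(3)[symmetric] g(1,2)]
  have "\<not> bounded A"
  proof
    assume "bounded A"
    then obtain b where b: "\<And>z. z \<in> A \<Longrightarrow> norm z \<le> b" unfolding bounded_iff by blast
    define x where "x = max (h i 0 + 1) b"
    have "norm (E 0 x) \<le> b" using b[OF Am[of 0 x]] unfolding x_def by simp
    moreover have "norm (E 0 x) = exp x" unfolding E_def by simp
    ultimately have "exp x \<le> x" unfolding x_def by simp
    then show False using exp_ge_add_one_self[of x] by linarith
  qed
  then have A: "A \<subseteq> outside (curve i)" using sA bounded_subset[OF J(1)] by metis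
  then show "h i t < x \<Longrightarrow> E t x \<in> outside (curve i)" using Am by blast
  have "\<not> B \<subseteq> outside (curve i)"
  proof
    assume B: "B \<subseteq> outside (curve i)"
    have "inside (curve i) \<subseteq> {0}"
    proof
      fix z assume z: "z \<in> inside (curve i)"
      have zc: "z \<notin> curve i" using z inside_no_overlap[of "curve i"] by blast
      show "z \<in> {0}"
      proof (rule ccontr)
        assume "z \<notin> {0}"
        then obtain t x where tx: "z = E t x" using E_surj by blast
        then have ne: "x \<noteq> h i t" using zc curve_iff[OF i] by auto
        then have "z \<in> A \<or> z \<in> B" using Am[of t x] Bm[of x t] ne unfolding tx by linarith
        then show False using A B io[OF z] by blast
      qed
    qed
    then have "inside (curve i) = {0}" using J(3) by blast
    then show False using J(2) not_open_singleton[of "0::complex"] by metis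
  qed
  then have "B \<subseteq> inside (curve i)" using sB by metis
  then show "x < h i t \<Longrightarrow> E t x \<in> inside (curve i)" using Bm by blast
qed

lemma V_eq_iff: "V s = V s' \<longleftrightarrow> (\<exists>m. s = s' + m * int N)"
proof
  assume "V s = V s'"
  then obtain m :: int where "2 * real_of_int s + 1 = 2 * real_of_int s' + 1 + of_int m * (2 * real N)"
    unfolding V_def E_eq_iff by blast
  then have "real_of_int s = real_of_int (s' + m * int N)" by simp
  then show "\<exists>m. s = s' + m * int N" by (metis of_int_eq_iff)
next
  assume "\<exists>m. s = s' + m * int N"
  then obtain m where m: "s = s' + m * int N" by blast
  then have "2 * real_of_int s + 1 = 2 * real_of_int s' + 1 + of_int m * (2 * real N)" by simp
  then show "V s = V s'" unfolding V_def E_eq_iff using m W_per by auto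
qed

lemma V_inj: assumes "V s = V s'" "s \<le> s'" "s' < s + int N" shows "s = s'"
proof -
  obtain m where m: "s' = s + m * int N" using assms(1) V_eq_iff[of s' s] by metis
  then have "0 \<le> m * int N" "m * int N < 1 * int N" using assms by auto
  then have "0 \<le> m" "m < 1" using N by (simp_all add: zero_le_mult_iff mult_less_cancel_right)
  then show ?thesis using m by simp
qed

definition meets :: "'i \<Rightarrow> 'i \<Rightarrow> int \<Rightarrow> bool" where
  "meets i j s \<longleftrightarrow> P i s = W s \<and> P j s = Suc (W s)"

lemma curve_inter:
  assumes "i \<in> I" "j \<in> I" "i \<noteq> j"
  shows "z \<in> curve i \<inter> curve j \<longleftrightarrow> (\<exists>s. z = V s \<and> (meets i j s \<or> meets j i s))"
proof
  assume z: "z \<in> curve i \<inter> curve j"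
  then obtain t where t: "z = E t (h i t)" unfolding curve_def by blast
  then have "h i t = h j t" using z curve_iff[OF assms(2)] by auto
  then obtain s where s: "t = 2 * of_int s + 1" "meets i j s \<or> meets j i s"
    using h_eq_iff[OF assms] unfolding meets_def by blast
  have "h i t = real (W s) + 1/2" using Hv_cross[OF assms(1), of s] s unfolding meets_def by auto
  then show "\<exists>s. z = V s \<and> (meets i j s \<or> meets j i s)" using t s unfolding V_def by auto
next
  assume "\<exists>s. z = V s \<and> (meets i j s \<or> meets j i s)"
  then obtain s where s: "z = V s" "meets i j s \<or> meets j i s" by blast
  show "z \<in> curve i \<inter> curve j"
    using Hv_cross[OF assms(1), of s] Hv_cross[OF assms(2), of s] curve_iff[OF assms(1)] curve_iff[OF assms(2)] s
    unfolding V_def meets_def by auto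
qed

lemma meets_unique:
  assumes "i \<in> I" "j \<in> I" "i \<noteq> j"
  obtains s where "0 \<le> s" "s < int N" "meets i j s" "\<And>s'. meets i j s' \<Longrightarrow> V s' = V s"
proof -
  obtain s where s: "s \<in> {0..<int N}" "meets i j s" "\<And>s'. s' \<in> {0..<int N} \<Longrightarrow> meets i j s' \<Longrightarrow> s' = s"
    using pair[OF assms] unfolding meets_def by blast
  have all: "V s' = V s" if c: "meets i j s'" for s'
  proof -
    have e: "s' = s' mod int N + (s' div int N) * int N" by simp
    have "meets i j (s' mod int N)" using c W_per[of "s' mod int N" "s' div int N"] P_per[OF assms(1), of "s' mod int N" "s' div int N"]
        P_per[OF assms(2), of "s' mod int N" "s' div int N"] unfolding meets_def e[symmetric] by auto
    then have "s' mod int N = s" using s(3) N by simp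
    then show ?thesis using V_eq_iff e by metis
  qed
  have "0 \<le> s" "s < int N" using s(1) by auto
  then show thesis using that[OF _ _ s(2) all] by blast
qed

lemma curve_inter_two:
  assumes "i \<in> I" "j \<in> I" "i \<noteq> j"
  shows "card (curve i \<inter> curve j) = 2"
proof -
  obtain s where s: "0 \<le> s" "s < int N" "meets i j s" "\<And>s'. meets i j s' \<Longrightarrow> V s' = V s" using meets_unique[OF assms] by metis
  obtain u where u: "0 \<le> u" "u < int N" "meets j i u" "\<And>s'. meets j i s' \<Longrightarrow> V s' = V u" using meets_unique[OF assms(2,1) assms(3)[symmetric]] by metis
  have "curve i \<inter> curve j = {V s, V u}"
  proof (rule set_eqI)
    fix z show "z \<in> curve i \<inter> curve j \<longleftrightarrow> z \<in> {V s, V u}"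
      unfolding curve_inter[OF assms] using s(3,4) u(3,4) by (metis insert_iff empty_iff)
  qed
  moreover have "V s \<noteq> V u"
  proof
    assume e: "V s = V u"
    have "s = u" using V_inj[OF e] V_inj[OF e[symmetric]] s u by linarith
    then show False using s(3) u(3) unfolding meets_def by auto
  qed
  ultimately show ?thesis by simp
qed

lemma h_even: "h i (2 * of_int s) = real (P i s)"
proof -
  have "h i (of_int (2 * s)) = Hv i (2 * s)" unfolding h_def by (rule interp_int)
  then show ?thesis unfolding Hv_def by simp
qed

text \<open>At the even time before a meeting the two strands are in opposite order for the two
  kinds of meetings, so \<open>curve j\<close> has points on both sides of
  \<open>curve i\<close>.\<close>

lemma curve_cross_twice:
  assumes "i \<in> I" "j \<in> I" "i \<noteq> j"
  shows "cross_twice (curve i) (curve j)"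
proof -
  obtain s where s: "meets i j s" using meets_unique[OF assms] by metis
  obtain u where u: "meets j i u" using meets_unique[OF assms(2,1) assms(3)[symmetric]] by metis
  let ?p = "\<lambda>s. E (2 * of_int s) (h j (2 * of_int s))"
  have "h i (2 * of_int s) < h j (2 * of_int s)" "h j (2 * of_int u) < h i (2 * of_int u)"
    using s u unfolding meets_def h_even by auto
  then have "?p s \<in> outside (curve i)" "?p u \<in> inside (curve i)" using curve_sides[OF assms(1)] by blast+
  moreover have "?p s \<in> curve j" "?p u \<in> curve j" unfolding curve_def by blast+
  ultimately show ?thesis unfolding cross_twice_def using curve_inter_two[OF assms] by blast
qed

lemma curve_inj: "inj_on curve I"
proof (rule inj_onI, rule ccontr)
  fix i j assume ij: "i \<in> I" "j \<in> I" "curve i = curve j" "i \<noteq> j"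
  have "card (curve i) = 2" using curve_inter_two[OF ij(1,2,4)] ij(3) by simp
  then have "finite (curve i)" by (metis card.infinite zero_neq_numeral)
  then show False using pseudocircle_infinite[OF curve_pseudocircle[OF ij(1)]] by simp
qed

definition A :: "complex set set" where "A = curve ` I"

lemma card_A: "card A = n"
  unfolding A_def using card_image[OF curve_inj] cardI by simp

lemma arrangement_A: "arrangement A"
  unfolding arrangement_def A_def using finI curve_pseudocircle curve_cross_twice by auto

lemma pairwise_A: "pairwise_intersecting A"
  unfolding pairwise_intersecting_def A_def
proof (clarsimp)
  fix i j assume "i \<in> I" "j \<in> I" "curve i \<noteq> curve j" "curve i \<inter> curve j = {}"
  then show False using curve_inter_two[of i j] by fastforce
qed

lemma simple_A: "simple_arr A"
  unfolding simple_arr_def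
proof (intro ballI impI)
  fix C D F assume CDF: "C \<in> A" "D \<in> A" "F \<in> A" "C \<noteq> D \<and> C \<noteq> F \<and> D \<noteq> F"
  then obtain i j k where ijk: "i \<in> I" "j \<in> I" "k \<in> I" "C = curve i" "D = curve j" "F = curve k"
    unfolding A_def by blast
  then have ne: "i \<noteq> j" "i \<noteq> k" "j \<noteq> k" using CDF(4) by auto
  show "C \<inter> D \<inter> F = {}"
  proof (rule ccontr)
    assume "C \<inter> D \<inter> F \<noteq> {}"
    then obtain z where z: "z \<in> curve i \<inter> curve j" "z \<in> curve i \<inter> curve k" using ijk by blast
    obtain s where s: "z = V s" "meets i j s \<or> meets j i s" using z(1) curve_inter[OF ijk(1,2) ne(1)] by blast
    obtain u where u: "z = V u" "meets i k u \<or> meets k i u" using z(2) curve_inter[OF ijk(1,3) ne(2)] by blast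
    obtain m where "s = u + m * int N" using s(1) u(1) V_eq_iff by metis
    then have "meets i k s \<or> meets k i s" using u(2) W_per P_per[OF ijk(1)] P_per[OF ijk(3)] unfolding meets_def by simp
    then have "P j s = P k s" using s(2) unfolding meets_def by auto
    then show False using P_inj[OF ijk(2,3)] ne by blast
  qed
qed

lemma arr_A: "arr A"
  by unfold_locales (use arrangement_A simple_A pairwise_A card_A n2 in auto)

lemma V_crossing: "V s \<in> crossings A"
proof -
  obtain i where i: "i \<in> I" "P i s = W s" using P_surj[of "W s" s] Wb[of s] by auto
  obtain j where j: "j \<in> I" "P j s = Suc (W s)" using P_surj[OF Wb] by auto
  have "i \<noteq> j" using i j by auto
  then have "V s \<in> curve i \<inter> curve j" "curve i \<noteq> curve j"
    using curve_inter[OF i(1) j(1)] i j curve_inj[THEN inj_onD, OF _ i(1) j(1)] unfolding meets_def by blast+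
  then show ?thesis unfolding crossings_def A_def using i j by blast
qed

lemma stay_low:
  assumes "i \<in> I" "P i a \<le> r" "a \<le> b" "\<And>s. a \<le> s \<Longrightarrow> s < b \<Longrightarrow> W s \<noteq> r"
  shows "P i b \<le> r"
  using assms(3,4)
proof (induction b rule: int_ge_induct)
  case base then show ?case using assms(2) by simp
next
  case (step b)
  then have "P i b \<le> r" "W b \<noteq> r" by auto
  then show ?case using stepP[OF assms(1), of b] by auto
qed

lemma stay_high:
  assumes "i \<in> I" "r < P i a" "a \<le> b" "\<And>s. a \<le> s \<Longrightarrow> s < b \<Longrightarrow> W s \<noteq> r"
  shows "r < P i b"
  using assms(3,4)
proof (induction b rule: int_ge_induct)
  case base then show ?case using assms(2) by simp
next
  case (step b)
  then have "r < P i b" "W b \<noteq> r" by auto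
  then show ?case using stepP[OF assms(1), of b] by auto
qed

text \<open>Otherwise the upper of two strands separated by level \<open>r\<close> could never get
  directly below the lower one, although every ordered pair of strands meets.\<close>

lemma level_occurs:
  assumes "Suc r < n" shows "\<exists>s. W s = r"
proof (rule ccontr)
  assume no: "\<nexists>s. W s = r"
  obtain i where i: "i \<in> I" "P i 0 = r" using P_surj[of r 0] assms by auto
  obtain j where j: "j \<in> I" "P j 0 = Suc r" using P_surj[OF assms, of 0] by auto
  have "i \<noteq> j" using i j by auto
  then obtain s where s: "0 \<le> s" "meets j i s" using meets_unique[OF j(1) i(1)] by metis
  have "P i s \<le> r" using stay_low[OF i(1), of 0 r s] i(2) s(1) no by auto
  moreover have "r < P j s" using stay_high[OF j(1), of r 0 s] j(2) s(1) no by auto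
  ultimately show False using s(2) unfolding meets_def by auto
qed

text \<open>The strand lifted above level \<open>r\<close> at \<open>s1\<close> is back at position
  \<open>r\<close> one period later, so level \<open>r\<close> must occur again in between. This is
  what makes the first and the last corner of a cell different points of the plane.\<close>

lemma next_level_bound:
  assumes "s1 < m" "W s1 = r" "\<And>s. s1 < s \<Longrightarrow> s < m \<Longrightarrow> W s \<noteq> r"
  shows "m < s1 + int N"
proof (rule ccontr)
  assume "\<not> m < s1 + int N"
  then have no: "W s \<noteq> r" if "s1 + 1 \<le> s" "s < s1 + int N" for s using assms(3)[of s] that by auto
  obtain i where i: "i \<in> I" "P i s1 = r" using P_surj[of r s1] Wb[of s1] assms(2) by auto
  have "r < P i (s1 + 1)" using stepP[OF i(1), of s1] i(2) assms(2) by simp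
  then have "r < P i (s1 + int N)" using stay_high[OF i(1), of r "s1 + 1" "s1 + int N"] no N by auto
  then show False using Pper[OF i(1)] i(2) by simp
qed

lemma level_neighbours:
  assumes "Suc r < n"
  obtains s1 m where "s1 \<le> e" "e < m" "W s1 = r" "W m = r" "\<And>s. s1 < s \<Longrightarrow> s < m \<Longrightarrow> W s \<noteq> r"
proof -
  obtain q where q: "W q = r" using level_occurs[OF assms(1)] by blast
  define k where "k = (e - q) div int N"
  have qm: "(e - q) mod int N < int N" "0 \<le> (e - q) mod int N" using N by auto
  have eq: "e = q + k * int N + (e - q) mod int N" unfolding k_def using div_mult_mod_eq[of "e - q" "int N"] by linarith
  define lo where "lo = q + k * int N"
  have lo: "W lo = r" "W (lo + int N) = r" unfolding lo_def using W_per[of q k] Wper q by auto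
  have lo': "lo \<le> e" "e < lo + int N" using eq qm unfolding lo_def by linarith+
  define S where "S = {s \<in> {lo..e}. W s = r}" define M where "M = {s \<in> {e+1..lo + int N}. W s = r}"
  have fin: "finite S" "finite M" unfolding S_def M_def by (auto intro: finite_subset[OF _ finite_atLeastAtMost_int])
  have "lo \<in> S" "lo + int N \<in> M" unfolding S_def M_def using lo lo' by auto
  then have a: "Max S \<in> S" "Min M \<in> M" using fin Max_in Min_in by blast+
  show thesis
  proof (rule that[of "Max S" "Min M"])
    show "Max S \<le> e" "e < Min M" "W (Max S) = r" "W (Min M) = r" using a unfolding S_def M_def by auto
    fix s assume s: "Max S < s" "s < Min M"
    show "W s \<noteq> r"
    proof
      assume W: "W s = r"
      have "lo \<le> Max S" "Min M \<le> lo + int N" using a unfolding S_def M_def by auto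
      then have "s \<in> S \<or> s \<in> M" using s W unfolding S_def M_def by auto
      then show False using s Max_ge[OF fin(1)] Min_le[OF fin(2)] by force
    qed
  qed
qed

end

section \<open>Cells between consecutive levels and their corners\<close>

context wiring
begin

text \<open>A cell is named by the step \<open>m\<close> that closes it. The set collects the
  transpositions at the two neighbouring levels since the previous one at its own level: all corners
  of the cell other than its first and its last.\<close>

definition side_swaps :: "int \<Rightarrow> int set" where
  "side_swaps m = {s. s < m \<and> (W s = Suc (W m) \<or> Suc (W s) = W m) \<and> (\<forall>s'. s \<le> s' \<and> s' < m \<longrightarrow> W s' \<noteq> W m)}"

definition corners :: "complex set \<Rightarrow> nat" where "corners F = card (frontier F \<inter> crossings A)"

text \<open>A marker for the cell closed by step \<open>m\<close>: half a step before the closing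
  crossing, midway between the two levels.\<close>

definition cell_point :: "int \<Rightarrow> complex" where "cell_point m = E (2 * of_int m) (real (W m) + 1/2)"

lemma side_swaps_shift: "card (side_swaps (m + k * int N)) = card (side_swaps m)"
proof -
  have sub: "(\<lambda>s. s + k * int N) ` side_swaps m \<subseteq> side_swaps (m + k * int N)" for m k
  proof
    fix u assume "u \<in> (\<lambda>s. s + k * int N) ` side_swaps m"
    then obtain s where s: "s \<in> side_swaps m" "u = s + k * int N" by blast
    have "W s' \<noteq> W m" if "u \<le> s'" "s' < m + k * int N" for s'
    proof -
      have "W (s' - k * int N) \<noteq> W m" using s that unfolding side_swaps_def by auto
      moreover have "W (s' - k * int N) = W s'" using W_per[of "s' - k * int N" k] by simp
      ultimately show ?thesis by simp
    qed
    then show "u \<in> side_swaps (m + k * int N)" using s unfolding side_swaps_def by (auto simp: W_per)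
  qed
  have "side_swaps (m + k * int N) = (\<lambda>s. s + k * int N) ` side_swaps m"
  proof
    show "side_swaps (m + k * int N) \<subseteq> (\<lambda>s. s + k * int N) ` side_swaps m"
    proof
      fix u assume u: "u \<in> side_swaps (m + k * int N)"
      have "u - k * int N \<in> side_swaps m" using sub[of "- k" "m + k * int N"] u by force
      then show "u \<in> (\<lambda>s. s + k * int N) ` side_swaps m" by force
    qed
  qed (rule sub)
  then show ?thesis by (simp add: card_image inj_on_def)
qed

lemma cell_point_shift: "cell_point (m + k * int N) = cell_point m"
  unfolding cell_point_def E_eq_iff W_per by (auto simp: algebra_simps intro!: exI[of _ k])

lemma cell_corner:
  assumes F: "F \<in> cells A" and R: "R \<subseteq> F" and c: "V s \<in> closure R"
  shows "V s \<in> frontier F \<inter> crossings A"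
proof -
  interpret arr: arr A by (rule arr_A)
  have "V s \<in> closure F" using closure_mono[OF R] c by blast
  moreover have "V s \<notin> F" using arr.cell_facts(4)[OF F] V_crossing[of s] unfolding crossings_def by blast
  ultimately show ?thesis using arr.cell_facts(1)[OF F] V_crossing by (simp add: frontier_def interior_open)
qed

lemma corners_ge:
  assumes F: "F \<in> cells A" and R: "R \<subseteq> F" and S: "finite S" "\<And>s. s \<in> S \<Longrightarrow> V s \<in> closure R"
    and inj: "inj_on V S"
  shows "card S \<le> corners F"
proof -
  interpret arr: arr A by (rule arr_A)
  have "V ` S \<subseteq> frontier F \<inter> crossings A" using cell_corner[OF F R S(2)] by blast
  then have "card (V ` S) \<le> corners F" unfolding corners_def using arr.finite_cr by (intro card_mono) auto
  then show ?thesis using card_image[OF inj] by simp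
qed

lemma region_in_cell:
  assumes F: "F \<in> cells A" "z \<in> F" and R: "connected R" "z \<in> R" "R \<inter> \<Union>A = {}"
  shows "R \<subseteq> F"
  using components_maximal[OF F(1)[unfolded cells_def] R(1)] R F(2) by blast

lemma not_on_curves:
  assumes "\<And>q. q < n \<Longrightarrow> x \<noteq> lv q t" shows "E t x \<notin> \<Union>A"
  using assms Q_less curve_iff h_floor unfolding A_def by fastforce

lemma on_level:
  assumes "E t x \<notin> \<Union>A" "q < n" shows "x \<noteq> lv q t"
proof -
  obtain i where i: "i \<in> I" "P i ((\<lfloor>t\<rfloor> + 1) div 2) = q" using P_surj[OF assms(2)] by blast
  then have "h i t = lv q t" using h_floor[OF i(1)] unfolding Q_def by simp
  then show ?thesis using assms(1) curve_iff[OF i(1)] i(1) unfolding A_def by auto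
qed

lemma lv_crossing: "lv (W s) (2 * of_int s + 1) = real (W s) + 1/2" "lv (Suc (W s)) (2 * of_int s + 1) = real (W s) + 1/2"
proof -
  have "lv q (of_int (2 * s + 1)) = Lv q (2 * s + 1)" for q unfolding lv_def by (rule interp_int)
  then have "lv q (2 * of_int s + 1) = Lv q (2 * s + 1)" for q by simp
  then show "lv (W s) (2 * of_int s + 1) = real (W s) + 1/2" "lv (Suc (W s)) (2 * of_int s + 1) = real (W s) + 1/2"
    unfolding Lv_def by auto
qed

lemma lv_even: "lv q (2 * of_int s) = real q"
proof -
  have "lv q (of_int (2 * s)) = Lv q (2 * s)" unfolding lv_def by (rule interp_int)
  then show ?thesis unfolding Lv_def by simp
qed

text \<open>The strip between the levels \<open>r\<close> and \<open>r + 1\<close>, from one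
  transposition at level \<open>r\<close> to the next, lies in \<open>F\<close> and has the expected
  corners in its closure. The strip is shorter than a period, so different steps give different
  points.\<close>

lemma middle_cell:
  assumes F: "F \<in> cells A" "E t x \<in> F" and r: "Suc r < n" "lv r t < x" "x < lv (Suc r) t"
  shows "\<exists>m\<in>{0..<int N}. cell_point m \<in> F \<and> 2 + card (side_swaps m) \<le> corners F"
proof -
  \<comment> \<open>Crossings are drawn at odd times, and \<open>2 e + 1\<close> is the last odd
    time not after \<open>t\<close>.\<close>
  define e where "e = \<lfloor>(t - 1) / 2\<rfloor>"
  have e: "2 * of_int e + 1 \<le> t" "t < 2 * of_int e + 3"
    using of_int_floor_le[of "(t - 1) / 2"] real_of_int_floor_add_one_gt[of "(t - 1) / 2"]
    unfolding e_def[symmetric] by (auto simp: field_simps)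
  obtain s1 m where sm: "s1 \<le> e" "e < m" "W s1 = r" "W m = r" "\<And>s. s1 < s \<Longrightarrow> s < m \<Longrightarrow> W s \<noteq> r"
    using level_neighbours[OF r(1), of e] by metis
  have mN: "m < s1 + int N" using next_level_bound[of s1 m r] sm by auto
  have t1: "2 * of_int s1 + 1 < t"
  proof -
    have "t \<noteq> 2 * of_int s1 + 1" using lv_crossing[of s1] sm(3) r by auto
    moreover have "real_of_int s1 \<le> of_int e" using sm(1) by simp
    ultimately show ?thesis using e by linarith
  qed
  have "real_of_int e + 1 \<le> of_int m" using sm(2) by linarith
  then have t2: "t < 2 * of_int m + 1" using e by linarith
  have s1m: "real_of_int s1 + 1 \<le> of_int m" using sm(1,2) by linarith
  define X where "X = {2 * real_of_int s1 + 1 <..< 2 * of_int m + 1}"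
  define b where "b = (\<lambda>t. lv (Suc r) t - lv r t)"
  define R where "R = (\<lambda>(t, x). E t (lv r t + x * b t)) ` (X \<times> {0<..<1})"
  have cont: "continuous_on UNIV (lv r)" "continuous_on UNIV b"
    unfolding b_def by (auto intro!: continuous_intros lv_continuous)
  have bpos: "0 < b t" if "t \<in> X" for t
  proof -
    have "\<not> (\<exists>s. t = 2 * of_int s + 1 \<and> W s = r)"
    proof
      assume "\<exists>s. t = 2 * of_int s + 1 \<and> W s = r"
      then obtain s where s: "t = 2 * of_int s + 1" "W s = r" by blast
      then have "s1 < s" "s < m" using that unfolding X_def by auto
      then show False using sm(5) s by blast
    qed
    then show ?thesis unfolding b_def using lv_step(2)[of t r] by simp
  qed
  have inR: "E t x \<in> R" if tx: "t \<in> X" "lv r t < x" "x < lv (Suc r) t" for t x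
  proof -
    have "(x - lv r t) / b t \<in> {0<..<1}" "x = lv r t + (x - lv r t) / b t * b t"
      using bpos[OF tx(1)] tx unfolding b_def by auto
    then show ?thesis unfolding R_def using tx(1) by (intro image_eqI[of _ _ "(t, (x - lv r t) / b t)"]) auto
  qed
  have con: "connected R" unfolding R_def by (rule connected_strip) (use cont X_def in auto)
  have dis: "R \<inter> \<Union>A = {}"
  proof -
    have "z \<notin> \<Union>A" if z: "z \<in> R" for z
    proof -
      obtain t x where tx: "t \<in> X" "x \<in> {0<..<1}" "z = E t (lv r t + x * b t)" using z unfolding R_def by auto
      have "0 < x * b t" "x * b t < 1 * b t" using tx(2) bpos[OF tx(1)] by auto
      then have "lv r t < lv r t + x * b t" "lv r t + x * b t < lv (Suc r) t"
        using b_def[THEN fun_cong, of t] by linarith+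
      moreover have "lv q t \<le> lv r t \<or> lv (Suc r) t \<le> lv q t" for q
        using lv_mono[of q r t] lv_mono[of "Suc r" q t] by linarith
      ultimately have "lv r t + x * b t \<noteq> lv q t" for q using less_le_trans by (metis order_less_irrefl order_less_le_trans)
      then show ?thesis unfolding tx(3) by (intro not_on_curves) auto
    qed
    then show ?thesis by blast
  qed
  have tX: "t \<in> X" unfolding X_def using t1 t2 by simp
  have RF: "R \<subseteq> F" using region_in_cell[OF F con inR[OF tX r(2,3)] dis] .
  have clX: "closure X = {2 * real_of_int s1 + 1 .. 2 * of_int m + 1}" unfolding X_def using s1m by (intro closure_greaterThanLessThan) linarith
  have clY: "closure {0<..<1::real} = {0..1}" by (intro closure_greaterThanLessThan) simp
  have cl: "E t (lv r t + x * b t) \<in> closure R" if "t \<in> closure X" "0 \<le> x" "x \<le> 1" for t x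
    unfolding R_def by (rule closure_strip[OF cont that(1)]) (use clY that in auto)
  have cl0: "V s \<in> closure R" if s: "s1 \<le> s" "s \<le> m" "W s = r \<or> W s = Suc r \<or> Suc (W s) = r" for s
  proof -
    have "real_of_int s1 \<le> of_int s" "real_of_int s \<le> of_int m" using s by simp_all
    then have c: "2 * of_int s + 1 \<in> closure X" unfolding clX by simp
    show ?thesis
    proof (cases "W s = Suc r")
      case True then show ?thesis using cl[OF c, of 1] lv_crossing(1)[of s] unfolding V_def b_def by simp
    next
      case False then show ?thesis using cl[OF c, of 0] lv_crossing[of s] s(3) unfolding V_def by auto
    qed
  qed
  have xsub: "s1 < s \<and> s < m \<and> (W s = Suc r \<or> Suc (W s) = r)" if "s \<in> side_swaps m" for s
    using that sm(2,3,4) sm(1) unfolding side_swaps_def by (auto simp: not_le[symmetric] dest: spec[of _ s1])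
  have fx: "finite (side_swaps m)" using xsub by (intro finite_subset[OF _ finite_greaterThanLessThan_int[of s1 m]]) auto
  define S where "S = insert s1 (insert m (side_swaps m))"
  have Sb: "s1 \<le> s \<and> s \<le> m \<and> (W s = r \<or> W s = Suc r \<or> Suc (W s) = r)" if "s \<in> S" for s
    using that xsub[of s] sm unfolding S_def by auto
  have "inj_on V S"
  proof (rule inj_onI)
    fix s s' assume a: "s \<in> S" "s' \<in> S" "V s = V s'"
    show "s = s'" using V_inj[OF a(3)] V_inj[OF a(3)[symmetric]] Sb[OF a(1)] Sb[OF a(2)] mN by linarith
  qed
  then have "card S \<le> corners F" using corners_ge[OF F(1) RF, of S] fx cl0 Sb unfolding S_def by blast
  moreover have "card S = 2 + card (side_swaps m)"
  proof -
    have "m \<notin> side_swaps m" "s1 \<notin> insert m (side_swaps m)" using xsub[of s1] xsub[of m] sm(1,2) by auto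
    then show ?thesis unfolding S_def using fx by simp
  qed
  moreover have "cell_point m \<in> F"
  proof -
    have "2 * real_of_int m \<in> X" unfolding X_def using s1m by auto
    then have "E (2 * of_int m) (real r + 1/2) \<in> R" by (intro inR) (simp_all add: lv_even)
    then show ?thesis unfolding cell_point_def sm(4) using RF by blast
  qed
  moreover have "cell_point (m mod int N) = cell_point m" "card (side_swaps (m mod int N)) = card (side_swaps m)"
    using cell_point_shift[of "m mod int N" "m div int N"] side_swaps_shift[of "m mod int N" "m div int N"] by simp_all
  ultimately show ?thesis using N by (intro bexI[of _ "m mod int N"]) auto
qed

lemma V_inj_period: "inj_on V {0..<int N}"
proof (rule inj_onI)
  fix s s' assume a: "s \<in> {0..<int N}" "s' \<in> {0..<int N}" "V s = V s'"
  show "s = s'" using V_inj[OF a(3)] V_inj[OF a(3)[symmetric]] a(1,2) by auto linarith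
qed

text \<open>Serves the innermost and the outermost cell alike: \<open>Y\<close> is the negative
  half-line with the lowest position \<open>q\<close>, or the positive half-line with the
  highest.\<close>

lemma outer_cell:
  assumes F: "F \<in> cells A" "E t x \<in> F" and Y: "connected Y" "0 \<in> closure Y" "E t x \<in> (\<lambda>(t, x). E t (lv q t + x * 1)) ` (UNIV \<times> Y)"
    "\<And>t y q'. y \<in> Y \<Longrightarrow> q' < n \<Longrightarrow> lv q t + y \<noteq> lv q' t"
    and y: "y \<in> Y"
  shows "E 0 (real q + y) \<in> F \<and> card {s\<in>{0..<int N}. W s = q \<or> Suc (W s) = q} \<le> corners F"
proof -
  define R where "R = (\<lambda>(t, x). E t (lv q t + x * 1)) ` (UNIV \<times> Y)"
  have cont: "continuous_on UNIV (lv q)" "continuous_on UNIV (\<lambda>t::real. 1::real)" by (auto intro: lv_continuous)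
  have con: "connected R" unfolding R_def by (rule connected_strip) (use cont Y(1) in auto)
  have "z \<notin> \<Union>A" if "z \<in> R" for z
    using that not_on_curves Y(4) unfolding R_def by auto
  then have RF: "R \<subseteq> F" using region_in_cell[OF F con] Y(3) unfolding R_def by blast
  have "E 0 (real q + y) \<in> R" unfolding R_def using y lv_even[of q 0] by (intro image_eqI[of _ _ "(0, y)"]) auto
  moreover have "V s \<in> closure R" if "W s = q \<or> Suc (W s) = q" for s
    using closure_strip[OF cont, of "2 * of_int s + 1" UNIV 0 Y] Y(2) lv_crossing[of s] that unfolding R_def V_def by auto
  then have "card {s\<in>{0..<int N}. W s = q \<or> Suc (W s) = q} \<le> corners F"
    by (intro corners_ge[OF F(1) RF]) (auto intro: inj_on_subset[OF V_inj_period] finite_subset[OF _ finite_atLeastLessThan_int])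
  ultimately show ?thesis using RF by blast
qed

lemma cell_cases:
  assumes F: "F \<in> cells A"
  shows "(\<exists>m\<in>{0..<int N}. cell_point m \<in> F \<and> 2 + card (side_swaps m) \<le> corners F)
    \<or> E 0 (-1) \<in> F \<and> card {s\<in>{0..<int N}. W s = 0} \<le> corners F
    \<or> E 0 (real n) \<in> F \<and> card {s\<in>{0..<int N}. Suc (Suc (W s)) = n} \<le> corners F"
proof -
  interpret arr: arr A by (rule arr_A)
  \<comment> \<open>The origin is the only point that \<open>E\<close> does not reach; an open cell
    contains other points, and one of these is used to locate it.\<close>
  have "F \<noteq> {0}" using arr.cell_facts(1)[OF F] not_open_singleton[of "0::complex"] by metis
  then obtain z where z: "z \<in> F" "z \<noteq> 0" using arr.cell_facts(3)[OF F] by blast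
  obtain t x where tx: "z = E t x" using E_surj[OF z(2)] by blast
  have zF: "E t x \<in> F" using z tx by simp
  have "E t x \<notin> \<Union>A" using arr.cell_facts(4)[OF F] zF by blast
  then have ne: "x \<noteq> lv q t" if "q < n" for q using on_level that by blast
  define T where "T = {q. q < n \<and> lv q t < x}"
  have "finite T" unfolding T_def by simp
  show ?thesis
  proof (cases "T = {}")
    case True
    then have "x < lv 0 t" using ne[of 0] n2 unfolding T_def by force
    then have "E t x \<in> (\<lambda>(t, x). E t (lv 0 t + x * 1)) ` (UNIV \<times> {..<0})"
      by (intro image_eqI[of _ _ "(t, x - lv 0 t)"]) auto
    then have "E 0 (real 0 + (-1)) \<in> F \<and> card {s\<in>{0..<int N}. W s = 0 \<or> Suc (W s) = 0} \<le> corners F"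
    proof (intro outer_cell[OF F zF])
      show "lv 0 t + y \<noteq> lv q' t" if "y \<in> {..<0}" for t y q' using lv_mono[of 0 q' t] that by auto
    qed auto
    then show ?thesis by simp
  next
    case False
    define r where "r = Max T"
    have r: "r \<in> T" "\<And>q. q \<in> T \<Longrightarrow> q \<le> r" unfolding r_def using \<open>finite T\<close> False by auto
    show ?thesis
    proof (cases "Suc r < n")
      case True
      then have "Suc r \<notin> T" using r(2)[of "Suc r"] by auto
      then have "x < lv (Suc r) t" using True ne[OF True] unfolding T_def by auto
      then show ?thesis using middle_cell[OF F zF True] r(1) unfolding T_def by blast
    next
      case False
      then have rn: "Suc r = n" using r(1) unfolding T_def by auto
      have "E t x \<in> (\<lambda>(t, x). E t (lv r t + x * 1)) ` (UNIV \<times> {0<..})"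
        using r(1) unfolding T_def by (intro image_eqI[of _ _ "(t, x - lv r t)"]) auto
      then have "E 0 (real r + 1) \<in> F \<and> card {s\<in>{0..<int N}. W s = r \<or> Suc (W s) = r} \<le> corners F"
      proof (intro outer_cell[OF F zF])
        show "lv r t + y \<noteq> lv q' t" if "y \<in> {0<..}" "q' < n" for t y q' using lv_mono[of q' r t] that rn by auto
      qed auto
      moreover have "real r + 1 = real n" using rn by simp
      moreover have "(W s = r \<or> Suc (W s) = r) = (Suc (Suc (W s)) = n)" for s using Wb[of s] rn by auto
      ultimately show ?thesis by simp
    qed
  qed
qed

text \<open>The corner counts are lower bounds, so a cell with exactly three corners must be one
  whose bound is three, and it contains one of the marked points. Choosing such a point is injective
  because cells are disjoint.\<close>

lemma cylinder_triangles:
  assumes inner: "\<And>m. 0 \<le> m \<Longrightarrow> m < int N \<Longrightarrow> side_swaps m \<noteq> {}"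
    and bot: "3 \<le> card {s\<in>{0..<int N}. W s = 0}" and top: "3 \<le> card {s\<in>{0..<int N}. Suc (Suc (W s)) = n}"
  shows "admissible n A" "num_kcells 3 A \<le> card {m\<in>{0..<int N}. card (side_swaps m) = 1}
    + (if card {s\<in>{0..<int N}. W s = 0} = 3 then 1 else 0)
    + (if card {s\<in>{0..<int N}. Suc (Suc (W s)) = n} = 3 then 1 else 0)" (is "_ \<le> card ?M + ?b + ?t")
proof -
  interpret arr: arr A by (rule arr_A)
  have fx: "finite (side_swaps m)" for m
  proof -
    have "side_swaps m \<subseteq> {m - int N..<m}"
    proof
      fix s assume s: "s \<in> side_swaps m"
      have "W (m - int N) = W m" using Wper[of "m - int N"] by simp
      then have "\<not> s \<le> m - int N" using s N unfolding side_swaps_def by auto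
      then show "s \<in> {m - int N..<m}" using s unfolding side_swaps_def by auto
    qed
    then show ?thesis by (rule finite_subset) simp
  qed
  have x1: "1 \<le> card (side_swaps m)" if "m \<in> {0..<int N}" for m using inner[of m] that fx[of m] by (simp add: Suc_le_eq card_gt_0_iff)
  have ge3: "3 \<le> corners F" if F: "F \<in> cells A" for F
    using cell_cases[OF F] bot top x1 by fastforce
  have "{F \<in> cells A. corners F = 2} = {}" using ge3 by fastforce
  then have "num_kcells 2 A = 0" unfolding num_kcells_def corners_def[symmetric] by (simp only: card.empty)
  then show "admissible n A"
    unfolding admissible_def digon_free_def using arrangement_A card_A simple_A pairwise_A by simp
  define Z where "Z = cell_point ` ?M \<union> (if ?b = 1 then {E 0 (-1)} else {}) \<union> (if ?t = 1 then {E 0 (real n)} else {})"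
  have finM: "finite ?M" by (auto intro: finite_subset[OF _ finite_atLeastLessThan_int])
  have finZ: "finite Z" unfolding Z_def using finM by auto
  have Zx: "\<exists>z. z \<in> F \<and> z \<in> Z" if F: "F \<in> cells A" "corners F = 3" for F
    using cell_cases[OF F(1)]
  proof (elim disjE)
    assume "\<exists>m\<in>{0..<int N}. cell_point m \<in> F \<and> 2 + card (side_swaps m) \<le> corners F"
    then obtain m where m: "m \<in> {0..<int N}" "cell_point m \<in> F" "2 + card (side_swaps m) \<le> corners F" by blast
    then have "m \<in> ?M" using x1[OF m(1)] F(2) by simp
    then show ?thesis using m(2) unfolding Z_def by blast
  qed (use bot top F(2) in \<open>auto simp: Z_def\<close>)
  define f where "f F = (SOME z. z \<in> F \<and> z \<in> Z)" for F
  have f: "f F \<in> F \<and> f F \<in> Z" if "F \<in> cells A" "corners F = 3" for F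
    unfolding f_def using someI_ex[OF Zx[OF that]] .
  have "num_kcells 3 A \<le> card Z"
    unfolding num_kcells_def corners_def[symmetric]
  proof (rule card_inj_on_le[where f = f])
    show "inj_on f {F \<in> cells A. corners F = 3}"
    proof (rule inj_onI)
      fix F G assume "F \<in> {F \<in> cells A. corners F = 3}" "G \<in> {F \<in> cells A. corners F = 3}" "f F = f G"
      then show "F = G" using f[of F] f[of G] arr.cells_disjoint[of F G] by auto
    qed
  qed (use f finZ in auto)
  also have "card Z \<le> card ?M + ?b + ?t"
  proof -
    have "card (cell_point ` ?M) \<le> card ?M" by (rule card_image_le[OF finM])
    moreover have "card Z \<le> card (cell_point ` ?M) + card (if ?b = 1 then {E 0 (-1)} else {}) + card (if ?t = 1 then {E 0 (real n)} else {})"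
      unfolding Z_def by (intro order_trans[OF card_Un_le] add_mono card_Un_le order_refl)
    moreover have "card (if ?b = 1 then {E 0 (-1)} else {}) = ?b" "card (if ?t = 1 then {E 0 (real n)} else {}) = ?t" by auto
    ultimately show ?thesis by linarith
  qed
  finally show "num_kcells 3 A \<le> card ?M + ?b + ?t" .
qed

end

section \<open>Words of adjacent transpositions\<close>

definition swap_at :: "nat \<Rightarrow> nat \<Rightarrow> nat" where
  "swap_at l p = (if p = l then Suc l else if p = Suc l then l else p)"

text \<open>Strands are named by their positions at the start of the word. Only exchanges with
  \<open>i\<close> as the lower strand count, so the two orders of a pair are counted
  separately.\<close>

fun crossing_count :: "nat list \<Rightarrow> nat \<Rightarrow> nat \<Rightarrow> nat" where
  "crossing_count [] i j = 0"
| "crossing_count (l # w) i j = (if i = l \<and> j = Suc l then 1 else 0) + crossing_count w (swap_at l i) (swap_at l j)"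

definition closed_word :: "nat \<Rightarrow> nat list \<Rightarrow> bool" where
  "closed_word n w \<longleftrightarrow> (\<forall>l\<in>set w. Suc l < n) \<and> (\<forall>i<n. fold swap_at w i = i) \<and> (\<forall>i<n. \<forall>j<n. i \<noteq> j \<longrightarrow> crossing_count w i j = 1)"

text \<open>The state \<open>c k\<close> counts the corners found so far of the cell that is open between the strands at
  positions \<open>k - 1\<close> and \<open>k\<close>. Letter \<open>l\<close> is the last corner of the open cell \<open>l + 1\<close>, which then has
  \<open>c (l + 1) + 1\<close> corners, and the first corner of the cell that opens in its place.\<close>

definition step :: "nat \<Rightarrow> (nat \<Rightarrow> nat) \<Rightarrow> nat \<Rightarrow> nat" where
  "step l c = c(l := c l + 1, Suc l := 1, Suc (Suc l) := c (Suc (Suc l)) + 1)"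

text \<open>The threshold is \<open>2\<close> because the closing letter contributes the last
  corner. Cells \<open>0\<close> and \<open>n\<close> are never closed by a letter, so the innermost
  and the outermost cell enter separately.\<close>

fun triangle_count :: "nat list \<Rightarrow> (nat \<Rightarrow> nat) \<Rightarrow> nat" where
  "triangle_count [] c = 0"
| "triangle_count (l # w) c = (if c (Suc l) \<le> 2 then 1 else 0) + triangle_count w (step l c)"

fun no_digons :: "nat list \<Rightarrow> (nat \<Rightarrow> nat) \<Rightarrow> bool" where
  "no_digons [] c = True"
| "no_digons (l # w) c = (2 \<le> c (Suc l) \<and> no_digons w (step l c))"

abbreviation run :: "nat list \<Rightarrow> (nat \<Rightarrow> nat) \<Rightarrow> nat \<Rightarrow> nat" where "run \<equiv> fold step"

lemma swap_at_swap_at [simp]: "swap_at l (swap_at l p) = p"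
  by (auto simp: swap_at_def)

lemma swap_at_less: "Suc l < n \<Longrightarrow> swap_at l p < n \<longleftrightarrow> p < n"
  by (auto simp: swap_at_def)

lemma fold_swap_at_less: "\<forall>l\<in>set w. Suc l < n \<Longrightarrow> fold swap_at w p < n \<longleftrightarrow> p < n"
  by (induction w arbitrary: p) (auto simp: swap_at_less)

lemma inj_fold_swap_at: "inj (fold swap_at w)"
proof (induction w)
  case (Cons l w)
  have "inj (swap_at l)" by (metis injI swap_at_swap_at)
  then have "inj (fold swap_at w \<circ> swap_at l)" using Cons by (rule inj_compose[rotated])
  then show ?case by (simp add: comp_def)
qed (auto intro: injI)

lemma crossing_count_append: "crossing_count (u @ v) i j = crossing_count u i j + crossing_count v (fold swap_at u i) (fold swap_at u j)"
  by (induction u arbitrary: i j) auto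

lemma triangle_count_append: "triangle_count (u @ v) c = triangle_count u c + triangle_count v (run u c)"
  by (induction u arbitrary: c) auto

lemma no_digons_append: "no_digons (u @ v) c \<longleftrightarrow> no_digons u c \<and> no_digons v (run u c)"
  by (induction u arbitrary: c) auto

lemma crossing_count_refl: "crossing_count w i i = 0"
  by (induction w arbitrary: i) auto

lemma crossing_count_card: "crossing_count w i j = card {s. s < length w \<and> fold swap_at (take s w) i = w ! s \<and> fold swap_at (take s w) j = Suc (w ! s)}"
proof (induction w rule: rev_induct)
  case (snoc l w)
  let ?S = "\<lambda>w. {s. s < length w \<and> fold swap_at (take s w) i = w ! s \<and> fold swap_at (take s w) j = Suc (w ! s)}"
  have "?S (w @ [l]) = ?S w \<union> (if fold swap_at w i = l \<and> fold swap_at w j = Suc l then {length w} else {})"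
    by (auto simp: nth_append less_Suc_eq)
  moreover have "finite (?S w)" by simp
  ultimately have "card (?S (w @ [l])) = card (?S w) + (if fold swap_at w i = l \<and> fold swap_at w j = Suc l then 1 else 0)"
    by auto
  then show ?case using snoc by (simp add: crossing_count_append)
qed simp

lemma triangle_count_card: "triangle_count w c = card {s. s < length w \<and> run (take s w) c (Suc (w ! s)) \<le> 2}"
proof (induction w rule: rev_induct)
  case (snoc l w)
  let ?S = "\<lambda>w. {s. s < length w \<and> run (take s w) c (Suc (w ! s)) \<le> 2}"
  have "?S (w @ [l]) = ?S w \<union> (if run w c (Suc l) \<le> 2 then {length w} else {})"
    by (auto simp: nth_append less_Suc_eq)
  moreover have "finite (?S w)" by simp
  ultimately have "card (?S (w @ [l])) = card (?S w) + (if run w c (Suc l) \<le> 2 then 1 else 0)"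
    by auto
  then show ?case using snoc by (simp add: triangle_count_append)
qed simp

lemma no_digons_nth: "no_digons w c \<Longrightarrow> s < length w \<Longrightarrow> 2 \<le> run (take s w) c (Suc (w ! s))"
proof (induction w rule: rev_induct)
  case (snoc l w)
  then show ?case by (cases "s = length w") (auto simp: no_digons_append nth_append)
qed simp

lemma count_list_card: "count_list w l = card {s. s < length w \<and> w ! s = l}"
  by (simp add: count_list_eq_length_filter length_filter_conv_card eq_commute)

text \<open>A cell open at the start of the word already has corners from the end of the previous
  period, which a single run does not see. The condition on \<open>c\<close> settles this: once a
  level has occurred, the simulated count is exact whatever the start was, so the final state is the
  true periodic one, and \<open>c\<close> stays below it.\<close>

theorem word_arrangement:
  assumes n: "2 \<le> n" and w: "closed_word n w" and c: "\<And>k. 0 < k \<Longrightarrow> k < n \<Longrightarrow> c k \<le> run w c k" and no_digons: "no_digons w c"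
    and bot: "3 \<le> count_list w 0" and top: "3 \<le> count_list w (n - 2)"
  shows "\<exists>A. admissible n A \<and> num_kcells 3 A \<le> triangle_count w c + (if count_list w 0 = 3 then 1 else 0) + (if count_list w (n - 2) = 3 then 1 else 0)"
proof -
  define N where "N = length w"
  have N: "0 < N" using bot unfolding N_def by (cases w) auto
  define W where "W s = w ! nat (s mod int N)" for s
  define P where "P i s = fold swap_at (take (nat (s mod int N)) w) i" for i s
  have wl: "\<And>l. l \<in> set w \<Longrightarrow> Suc l < n" and wi: "\<And>i. i < n \<Longrightarrow> fold swap_at w i = i"
    and wx: "\<And>i j. i < n \<Longrightarrow> j < n \<Longrightarrow> i \<noteq> j \<Longrightarrow> crossing_count w i j = 1"
    using w unfolding closed_word_def by auto
  have md: "nat (s mod int N) < N" "0 \<le> s mod int N" "s mod int N < int N" for s using N by (auto simp: nat_less_iff)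
  have Wnat: "W (int s) = w ! s" "P i (int s) = fold swap_at (take s w) i" if "s < N" for s i
    unfolding W_def P_def using that by (auto simp flip: of_nat_mod)
  have next_mod: "(s + 1) mod int N = (if s mod int N + 1 = int N then 0 else s mod int N + 1)" for s
  proof -
    have "(s + 1) mod int N = (s mod int N + 1) mod int N" by (simp add: mod_add_left_eq)
    then show ?thesis using md(2,3)[of s] by auto
  qed
  have take_next: "fold swap_at (take (Suc k) w) i = swap_at (w ! k) (fold swap_at (take k w) i)" if "k < N" for k i
    using that unfolding N_def by (simp add: take_Suc_conv_app_nth)
  have less: "i < n \<Longrightarrow> P i s < n" for i s
    unfolding P_def using fold_swap_at_less[of "take (nat (s mod int N)) w" n i] wl by (auto dest: in_set_takeD)
  interpret wiring n N W P "{..<n}"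
  proof
    show "0 < N" "2 \<le> n" using N n by auto
    show "Suc (W s) < n" for s unfolding W_def using wl md(1)[of s] unfolding N_def by simp
    show "W (s + int N) = W s" "P i (s + int N) = P i s" for s i unfolding W_def P_def by auto
    show "bij_betw (\<lambda>i. P i s) {..<n} {..<n}" for s
    proof -
      have inj: "inj_on (\<lambda>i. P i s) {..<n}" unfolding P_def using inj_fold_swap_at by (simp add: inj_on_def inj_def)
      have "(\<lambda>i. P i s) ` {..<n} \<subseteq> {..<n}" using less by auto
      then have "(\<lambda>i. P i s) ` {..<n} = {..<n}" using endo_inj_surj[of "{..<n}"] inj by blast
      then show ?thesis using inj unfolding bij_betw_def by blast
    qed
    show "P i (s + 1) = (if P i s = W s then Suc (W s) else if P i s = Suc (W s) then W s else P i s)" if i: "i \<in> {..<n}" for i s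
    proof -
      define k where "k = nat (s mod int N)"
      have k: "k < N" "s mod int N = int k" using md[of s] unfolding k_def by auto
      have "P i (s + 1) = fold swap_at (take (Suc k) w) i"
      proof (cases "Suc k = N")
        case True
        then have "(s + 1) mod int N = 0" using next_mod[of s] k by auto
        then show ?thesis unfolding P_def using True wi[of i] i unfolding N_def by simp
      next
        case False
        then have "(s + 1) mod int N = int (Suc k)" using next_mod[of s] k by auto
        then show ?thesis unfolding P_def by (simp only: nat_int)
      qed
      then have "P i (s + 1) = swap_at (W s) (P i s)" unfolding take_next[OF k(1)] P_def[of i s] W_def k_def[symmetric] .
      then show ?thesis by (simp add: swap_at_def)
    qed
    show "\<exists>!s. s \<in> {0..<int N} \<and> P i s = W s \<and> P j s = Suc (W s)" if ij: "i \<in> {..<n}" "j \<in> {..<n}" "i \<noteq> j" for i j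
    proof -
      let ?S = "{s. s < length w \<and> fold swap_at (take s w) i = w ! s \<and> fold swap_at (take s w) j = Suc (w ! s)}"
      have "card ?S = 1" using wx ij crossing_count_card[of w i j] by simp
      then obtain a where a: "?S = {a}" using card_1_singletonE by blast
      then have "a \<in> ?S" by blast
      then have aS: "a < N" "P i (int a) = W (int a)" "P j (int a) = Suc (W (int a))" using Wnat unfolding N_def by auto
      show ?thesis
      proof (rule ex1I[of _ "int a"])
        fix s assume s: "s \<in> {0..<int N} \<and> P i s = W s \<and> P j s = Suc (W s)"
        then obtain b where b: "s = int b" "b < N" by (metis atLeastLessThan_iff nonneg_int_cases of_nat_less_iff)
        then have "b \<in> ?S" using s Wnat unfolding N_def by auto
        then show "s = int a" using a b by simp
      qed (use aS in auto)
    qed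
  qed
  \<comment> \<open>\<open>side_swaps\<close> with the level as a separate argument, so that it also
    describes cells that are still open at time \<open>m\<close>.\<close>
  define S where "S l m = {s. s < m \<and> (W s = Suc l \<or> Suc (W s) = l) \<and> (\<forall>s'. s \<le> s' \<and> s' < m \<longrightarrow> W s' \<noteq> l)}" for l and m :: int
  have lev: "\<exists>m<N. W (int m) = l" if l: "Suc l < n" for l
  proof -
    obtain s where s: "W s = l" using level_occurs[OF l] by blast
    then have "W (int (nat (s mod int N))) = l" using md[of s] unfolding W_def by simp
    then show ?thesis using md by blast
  qed
  have finS: "finite (S l m)" if l: "Suc l < n" for l m
  proof -
    obtain s1 where s1: "s1 < m" "W s1 = l" using level_neighbours[OF l, of "m - 1"] by (metis zle_diff1_eq)
    have "S l m \<subseteq> {s1..<m}"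
    proof
      fix s assume "s \<in> S l m"
      then have "s < m" "s \<le> s1 \<Longrightarrow> W s1 \<noteq> l" using s1(1) unfolding S_def by auto
      then show "s \<in> {s1..<m}" using s1(2) by (cases "s \<le> s1") auto
    qed
    then show ?thesis by (rule finite_subset) simp
  qed
  have S_step: "S l (m + 1) = (if W m = l then {} else if W m = Suc l \<or> Suc (W m) = l then insert m (S l m) else S l m)" for l m
  proof -
    have less: "s < m + 1 \<longleftrightarrow> s < m \<or> s = m" for s by auto
    have key: "(\<forall>s'. s \<le> s' \<and> s' < m + 1 \<longrightarrow> W s' \<noteq> l) \<longleftrightarrow> (\<forall>s'. s \<le> s' \<and> s' < m \<longrightarrow> W s' \<noteq> l) \<and> (s \<le> m \<longrightarrow> W m \<noteq> l)" for s
      unfolding less by blast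
    show ?thesis unfolding S_def key unfolding less by auto
  qed
  have cS: "card (S l (m + 1)) = (if W m = l then 0 else if W m = Suc l \<or> Suc (W m) = l then Suc (card (S l m)) else card (S l m))"
    if "Suc l < n" for l m
    unfolding S_step using finS[OF that, of m] by (auto simp: S_def)
  have run_next: "run (take (Suc m) w) c = step (w ! m) (run (take m w) c)" if "m < N" for m
    using that unfolding N_def by (simp add: take_Suc_conv_app_nth)
  have stepv: "step l' d (Suc l) = (if l' = l then 1 else if l' = Suc l \<or> Suc l' = l then Suc (d (Suc l)) else d (Suc l))" for l l' d
    unfolding step_def by auto
  have rs: "run (take (Suc m) w) c (Suc l) = (if W (int m) = l then 1 else if W (int m) = Suc l \<or> Suc (W (int m)) = l
      then Suc (run (take m w) c (Suc l)) else run (take m w) c (Suc l))" if "m < N" for l m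
    unfolding run_next[OF that] stepv Wnat(1)[OF that] ..
  have ex_Suc: "(\<exists>s<Suc m. Q s) \<longleftrightarrow> (\<exists>s<m. Q s) \<or> Q m" for m and Q :: "nat \<Rightarrow> bool" by (auto simp: less_Suc_eq)
  \<comment> \<open>The first occurrence of level \<open>l\<close> resets the counter of its cell to
    \<open>1\<close>; from then on the initial guess \<open>c\<close> has no influence on
    it.\<close>
  have exact: "(\<exists>s<m. W (int s) = l) \<Longrightarrow> m \<le> N \<Longrightarrow> run (take m w) c (Suc l) = 1 + card (S l (int m))" if l: "Suc l < n" for l m
  proof (induction m)
    case (Suc m)
    have m: "m < N" "int (Suc m) = int m + 1" using Suc.prems by auto
    have "W (int m) = l \<or> run (take m w) c (Suc l) = 1 + card (S l (int m))" using Suc unfolding ex_Suc by auto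
    then show ?case unfolding m(2) cS[OF l] rs[OF m(1)] by auto
  qed simp
  have shift: "card (S l 0) = card (S l (int N))" if l: "Suc l < n" for l
  proof -
    have "S l (int N) = (\<lambda>s. s + int N) ` S l 0"
    proof (intro set_eqI iffI)
      fix s assume s: "s \<in> S l (int N)"
      have "s - int N \<in> S l 0"
        unfolding S_def
      proof (intro CollectI conjI allI impI)
        show "s - int N < 0" using s unfolding S_def by simp
        show "W (s - int N) = Suc l \<or> Suc (W (s - int N)) = l" using s Wper[of "s - int N"] unfolding S_def by simp
        fix s' assume "s - int N \<le> s' \<and> s' < 0"
        then show "W s' \<noteq> l" using s Wper[of s'] unfolding S_def by auto
      qed
      then show "s \<in> (\<lambda>s. s + int N) ` S l 0" by force
    next
      fix s assume "s \<in> (\<lambda>s. s + int N) ` S l 0"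
      then obtain u where u: "u \<in> S l 0" "s = u + int N" by blast
      show "s \<in> S l (int N)"
        unfolding S_def
      proof (intro CollectI conjI allI impI)
        show "s < int N" using u unfolding S_def by simp
        show "W s = Suc l \<or> Suc (W s) = l" using u Wper[of u] unfolding S_def by simp
        fix s' assume "s \<le> s' \<and> s' < int N"
        then show "W s' \<noteq> l" using u Wper[of "s' - int N"] unfolding S_def by auto
      qed
    qed
    then show ?thesis by (simp add: card_image inj_on_def)
  qed
  have lower: "m \<le> N \<Longrightarrow> run (take m w) c (Suc l) \<le> 1 + card (S l (int m))" if l: "Suc l < n" for l m
  proof (induction m)
    case 0
    have "c (Suc l) \<le> run w c (Suc l)" using c[of "Suc l"] l by simp
    also have "\<dots> = 1 + card (S l (int N))" using exact[OF l, of N] lev[OF l] unfolding N_def by simp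
    finally show ?case using shift[OF l] by simp
  next
    case (Suc m)
    then have m: "m < N" "int (Suc m) = int m + 1" by auto
    show ?case unfolding m(2) cS[OF l] rs[OF m(1)] using Suc by simp
  qed
  have xsS: "side_swaps m = S (W m) m" for m unfolding side_swaps_def S_def by blast
  have low: "run (take m w) c (Suc (w ! m)) \<le> 1 + card (side_swaps (int m))" if "m < N" for m
    using lower[of "w ! m" m] wl[of "w ! m"] that unfolding xsS Wnat(1)[OF that] N_def by simp
  have cnt: "card {s\<in>{0..<int N}. W s = l} = count_list w l" for l
  proof -
    have "{s\<in>{0..<int N}. W s = l} = int ` {s. s < length w \<and> w ! s = l}"
    proof (intro set_eqI iffI)
      fix s assume s: "s \<in> {s\<in>{0..<int N}. W s = l}"
      then obtain b where b: "s = int b" "b < N" by (auto simp: zero_le_imp_eq_int elim: nonneg_int_cases)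
      then show "s \<in> int ` {s. s < length w \<and> w ! s = l}" using s Wnat unfolding N_def by auto
    qed (use Wnat in \<open>auto simp: N_def\<close>)
    then show ?thesis unfolding count_list_card by (simp add: card_image)
  qed
  have top_eq: "(Suc (Suc (W s)) = n) = (W s = n - 2)" for s using n by auto
  have 1: "side_swaps m \<noteq> {}" if m: "0 \<le> m" "m < int N" for m
  proof -
    obtain b where b: "m = int b" using m(1) by (rule nonneg_int_cases)
    have "2 \<le> run (take b w) c (Suc (w ! b))" using no_digons_nth[OF no_digons, of b] m b unfolding N_def by simp
    then have "2 \<le> 1 + card (side_swaps m)" using low[of b] m b by simp
    then show ?thesis by auto
  qed
  note ct = cylinder_triangles[OF 1, unfolded top_eq cnt, OF _ _ bot top]
  have "card {m\<in>{0..<int N}. card (side_swaps m) = 1} \<le> triangle_count w c"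
  proof -
    have "{m\<in>{0..<int N}. card (side_swaps m) = 1} \<subseteq> int ` {s. s < length w \<and> run (take s w) c (Suc (w ! s)) \<le> 2}"
    proof
      fix m assume m: "m \<in> {m\<in>{0..<int N}. card (side_swaps m) = 1}"
      then obtain b where b: "m = int b" "b < N" by (auto elim: nonneg_int_cases)
      then show "m \<in> int ` {s. s < length w \<and> run (take s w) c (Suc (w ! s)) \<le> 2}" using low[of b] m unfolding N_def by auto
    qed
    then have "card {m\<in>{0..<int N}. card (side_swaps m) = 1} \<le> card (int ` {s. s < length w \<and> run (take s w) c (Suc (w ! s)) \<le> 2})"
      by (intro card_mono) auto
    also have "\<dots> = triangle_count w c" unfolding triangle_count_card by (simp add: card_image)
    finally show ?thesis .
  qed
  then show ?thesis using ct by (intro exI[of _ A]) auto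
qed

section \<open>Replacing a strand by a bundle\<close>

text \<open>\<open>pass p m l\<close> performs letter \<open>l\<close> when the strand at position \<open>p\<close> has been replaced by \<open>m\<close> parallel
  strands.\<close>

definition pass :: "nat \<Rightarrow> nat \<Rightarrow> nat \<Rightarrow> nat list" where
  "pass p m l = (if Suc l = p then [l..<l + m] else if l = p then rev [p..<p + m] else if l < p then [l] else [l + m - 1])"

fun expand :: "nat \<Rightarrow> nat \<Rightarrow> nat list \<Rightarrow> nat list" where
  "expand p m [] = []"
| "expand p m (l # w) = pass p m l @ expand (swap_at l p) m w"

text \<open>The index \<open>x\<close> is the place within the bundle and matters for
  \<open>i = p\<close> only; for other strands it is a dummy that lets all strands be treated
  uniformly.\<close>

definition bundle_pos :: "nat \<Rightarrow> nat \<Rightarrow> nat \<Rightarrow> nat \<Rightarrow> nat" where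
  "bundle_pos p m i x = (if i < p then i else if i = p then p + x else i + m - 1)"

lemma fold_swap_at_up: "fold swap_at [l..<l + m] q = (if q = l then l + m else if l < q \<and> q \<le> l + m then q - 1 else q)"
  by (induction m) (auto simp: swap_at_def)

lemma fold_swap_at_down: "fold swap_at (rev [p..<p + m]) q = (if q = p + m then p else if p \<le> q \<and> q < p + m then Suc q else q)"
  by (induction m arbitrary: q) (auto simp: swap_at_def)

lemma crossing_count_up: "crossing_count [l..<l + m] a b = (if a = l \<and> l < b \<and> b \<le> l + m then 1 else 0)"
  by (induction m) (auto simp: crossing_count_append fold_swap_at_up)

lemma crossing_count_down: "crossing_count (rev [p..<p + m]) a b = (if b = p + m \<and> p \<le> a \<and> a < p + m then 1 else 0)"
  by (induction m arbitrary: a b) (auto simp: swap_at_def)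

lemma pass_cases:
  obtains (up) "p = Suc l" "pass p m l = [l..<l + m]" "swap_at l p = l"
  | (down) "p = l" "pass p m l = rev [l..<l + m]" "swap_at l p = Suc l"
  | (low) "Suc l < p" "pass p m l = [l]" "swap_at l p = p"
  | (high) "p < l" "pass p m l = [l + m - 1]" "swap_at l p = p"
proof -
  consider "Suc l = p" | "l = p" | "Suc l < p" | "p < l" by linarith
  then show thesis by cases (use that in \<open>auto simp: pass_def swap_at_def\<close>)
qed

lemma pass_swap_at:
  assumes "x < m" shows "fold swap_at (pass p m l) (bundle_pos p m i x) = bundle_pos (swap_at l p) m (swap_at l i) x"
proof (cases rule: pass_cases[where p = p and l = l and m = m])
  case up
  consider "i < l" | "i = l" | "i = Suc l" | "Suc l < i" by linarith
  then show ?thesis unfolding up(2,3) fold_swap_at_up by cases (use assms up(1) in \<open>auto simp: bundle_pos_def swap_at_def\<close>)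
next
  case down
  consider "i < l" | "i = l" | "i = Suc l" | "Suc l < i" by linarith
  then show ?thesis unfolding down(2,3) fold_swap_at_down by cases (use assms down(1) in \<open>auto simp: bundle_pos_def swap_at_def\<close>)
next
  case low
  consider "i < l" | "i = l" | "i = Suc l" | "Suc l < i" "i < p" | "i = p" | "p < i" using low(1) by linarith
  then show ?thesis unfolding low(2,3) by cases (use assms low(1) in \<open>auto simp: bundle_pos_def swap_at_def\<close>)
next
  case high
  consider "i < p" | "i = p" | "p < i" "i < l" | "i = l" | "i = Suc l" | "Suc l < i" using high(1) by linarith
  then show ?thesis unfolding high(2,3) by cases (use assms high(1) in \<open>auto simp: bundle_pos_def swap_at_def\<close>)
qed

lemma pass_crossing_count:
  assumes "x < m" "y < m"
  shows "crossing_count (pass p m l) (bundle_pos p m i x) (bundle_pos p m j y) = (if i = l \<and> j = Suc l then 1 else 0)"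
proof (cases rule: pass_cases[where p = p and l = l and m = m])
  case up
  have "bundle_pos (Suc l) m i x = l \<longleftrightarrow> i = l" "l < bundle_pos (Suc l) m j y \<and> bundle_pos (Suc l) m j y \<le> l + m \<longleftrightarrow> j = Suc l"
    using assms unfolding bundle_pos_def by presburger+
  then show ?thesis unfolding up(2) crossing_count_up by (simp add: up(1))
next
  case down
  have "bundle_pos l m j y = l + m \<longleftrightarrow> j = Suc l" "l \<le> bundle_pos l m i x \<and> bundle_pos l m i x < l + m \<longleftrightarrow> i = l"
    using assms unfolding bundle_pos_def by presburger+
  then show ?thesis unfolding down(2) crossing_count_down by (simp add: down(1))
next
  case low
  have "bundle_pos p m i x = l \<longleftrightarrow> i = l" "bundle_pos p m j y = Suc l \<longleftrightarrow> j = Suc l"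
    using assms low(1) unfolding bundle_pos_def by presburger+
  then show ?thesis unfolding low(2) by simp
next
  case high
  have "bundle_pos p m i x = l + m - 1 \<longleftrightarrow> i = l" "bundle_pos p m j y = Suc (l + m - 1) \<longleftrightarrow> j = Suc l"
    using assms high(1) unfolding bundle_pos_def by auto
  then show ?thesis unfolding high(2) by simp
qed

lemma expand_swap_at: "x < m \<Longrightarrow> fold swap_at (expand p m w) (bundle_pos p m i x) = bundle_pos (fold swap_at w p) m (fold swap_at w i) x"
  by (induction w arbitrary: p i) (auto simp: pass_swap_at)

lemma expand_crossing_count: "x < m \<Longrightarrow> y < m \<Longrightarrow> crossing_count (expand p m w) (bundle_pos p m i x) (bundle_pos p m j y) = crossing_count w i j"
  by (induction w arbitrary: p i j) (auto simp: pass_swap_at pass_crossing_count crossing_count_append)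

lemma expand_letters:
  assumes "\<forall>l\<in>set w. Suc l < n" "p < n" "0 < m" "l \<in> set (expand p m w)"
  shows "Suc l < n + m - 1"
  using assms
proof (induction w arbitrary: p)
  case (Cons a w)
  have "l \<in> set (pass p m a) \<Longrightarrow> Suc l < n + m - 1" using Cons.prems by (auto simp: pass_def split: if_splits)
  moreover have "swap_at a p < n" using Cons.prems by (simp add: swap_at_less)
  ultimately show ?case using Cons.IH[of "swap_at a p"] Cons.prems by (simp del: One_nat_def) blast
qed simp

lemma expand_count:
  assumes "\<forall>l\<in>set w. Suc l < n" "p < n" "0 < m"
  shows "count_list w 0 \<le> count_list (expand p m w) 0"
    "count_list w (n - 2) \<le> count_list (expand p m w) (n + m - 1 - 2)"
proof -
  have cl: "q \<in> set v \<Longrightarrow> 1 \<le> count_list v q" for q and v :: "nat list"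
    by (metis One_nat_def Suc_leI bot_nat_0.not_eq_extremum count_list_0_iff)
  have "count_list w 0 \<le> count_list (expand p m w) 0 \<and> count_list w (n - 2) \<le> count_list (expand p m w) (n + m - 1 - 2)"
    using assms(1,2)
  proof (induction w arbitrary: p)
    case (Cons a w)
    have "a = 0 \<Longrightarrow> 1 \<le> count_list (pass p m a) 0" using assms(3) Cons.prems by (intro cl) (auto simp: pass_def)
    moreover have "a = n - 2 \<Longrightarrow> 1 \<le> count_list (pass p m a) (n + m - 1 - 2)" using assms(3) Cons.prems by (intro cl) (auto simp: pass_def)
    moreover have "count_list w 0 \<le> count_list (expand (swap_at a p) m w) 0 \<and> count_list w (n - 2) \<le> count_list (expand (swap_at a p) m w) (n + m - 1 - 2)"
      using Cons by (simp add: swap_at_less)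
    ultimately show ?case by (cases "a = 0"; cases "a = n - 2") (simp_all del: One_nat_def)
  qed simp
  then show "count_list w 0 \<le> count_list (expand p m w) 0"
    "count_list w (n - 2) \<le> count_list (expand p m w) (n + m - 1 - 2)" by auto
qed

text \<open>The state of the expanded diagram: \<open>c\<close> outside the bundle, \<open>u\<close> between its strands; \<open>u 0\<close> and
  \<open>u m\<close> are additional contributions to the two cells bordering the bundle.\<close>

definition joined :: "nat \<Rightarrow> nat \<Rightarrow> (nat \<Rightarrow> nat) \<Rightarrow> (nat \<Rightarrow> nat) \<Rightarrow> nat \<Rightarrow> nat" where
  "joined p m c u k = (if k < p then c k else if k = p then c p + u 0 else if k < p + m then u (k - p)
     else if k = p + m then c (Suc p) + u m else c (k + 1 - m))"

text \<open>The state inside a bundle just after another strand has crossed all of it: every inner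
  cell starts with two corners on that strand, and the next strand to cross closes it as a
  quadrilateral.\<close>

definition two :: "nat \<Rightarrow> nat \<Rightarrow> nat" where "two m k = (if 0 < k \<and> k < m then 2 else 0)"

lemma joined_step: "Suc l < m \<Longrightarrow> step (p + l) (joined p m c u) = joined p m c (step l u)"
  by (rule ext) (auto simp: step_def joined_def Suc_diff_le)

lemma joined_block:
  assumes "\<forall>l\<in>set v. Suc l < m"
  shows "run (map ((+) p) v) (joined p m c u) = joined p m c (run v u)"
    "triangle_count (map ((+) p) v) (joined p m c u) = triangle_count v u" "no_digons (map ((+) p) v) (joined p m c u) = no_digons v u"
  using assms by (induction v arbitrary: u) (auto simp: joined_step, auto simp: joined_def)

text \<open>Hands the corners that a block has put on the two bordering cells over to the outer
  state, where they count for the word that is run next.\<close>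

lemma joined_walls:
  assumes "0 < m"
  shows "joined p m c u = joined p m (c(p := c p + u 0, Suc p := c (Suc p) + u m)) (u(0 := 0, m := 0))"
  using assms by (intro ext) (auto simp: joined_def)

lemma run_up: "run [l..<l + Suc m] d = (\<lambda>k. if k < l then d k else if k = l then d l + 1 else if k < l + m + 1 then 2
   else if k = l + m + 1 then 1 else if k = l + m + 2 then d k + 1 else d k)"
proof (induction m arbitrary: l d)
  case 0 then show ?case by (auto simp: step_def)
next
  case (Suc m)
  have "[l..<l + Suc (Suc m)] = l # [Suc l..<Suc l + Suc m]" by (simp add: upt_conv_Cons)
  then show ?case unfolding Suc[of "Suc l" "step l d", symmetric] using Suc[of "Suc l" "step l d"]
    by (simp only: fold_simps) (auto simp: step_def)
qed

lemma run_down: "run (rev [p..<p + Suc m]) d = (\<lambda>k. if k < p then d k else if k = p then d p + 1 else if k = p + 1 then 1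
   else if k < p + m + 2 then 2 else if k = p + m + 2 then d k + 1 else d k)"
proof (induction m arbitrary: d)
  case 0 then show ?case by (auto simp: step_def)
next
  case (Suc m)
  have "rev [p..<p + Suc (Suc m)] = (p + Suc m) # rev [p..<p + Suc m]" by simp
  then show ?case using Suc[of "step (p + Suc m) d"]
    by (simp only: fold_simps) (auto simp: step_def)
qed

lemma triangle_count_up: "triangle_count [l..<l + Suc m] d = (if d (Suc l) \<le> 2 then 1 else 0) + (\<Sum>j<m. if d (l + j + 2) \<le> 1 then 1 else 0)"
proof (induction m arbitrary: l d)
  case (Suc m)
  have "[l..<l + Suc (Suc m)] = l # [Suc l..<Suc l + Suc m]" by (simp add: upt_conv_Cons)
  then have "triangle_count [l..<l + Suc (Suc m)] d = (if d (Suc l) \<le> 2 then 1 else 0) + triangle_count [Suc l..<Suc l + Suc m] (step l d)"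
    by (simp only: triangle_count.simps)
  also have "\<dots> = (if d (Suc l) \<le> 2 then 1 else 0) + ((if d (l + 2) \<le> 1 then 1 else 0) + (\<Sum>j<m. if d (l + Suc j + 2) \<le> 1 then 1 else 0))"
    unfolding Suc by (simp add: step_def)
  also have "(if d (l + 2) \<le> 1 then 1 else 0) + (\<Sum>j<m. if d (l + Suc j + 2) \<le> 1 then 1 else 0) = (\<Sum>j<Suc m. if d (l + j + 2) \<le> 1 then 1 else 0)"
    by (subst sum.lessThan_Suc_shift) simp
  finally show ?case .
qed simp

lemma triangle_count_down: "triangle_count (rev [p..<p + Suc m]) d = (if d (p + m + 1) \<le> 2 then 1 else 0) + (\<Sum>j<m. if d (p + j + 1) \<le> 1 then 1 else 0)"
proof (induction m arbitrary: d)
  case (Suc m)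
  have "rev [p..<p + Suc (Suc m)] = (p + Suc m) # rev [p..<p + Suc m]" by simp
  then have "triangle_count (rev [p..<p + Suc (Suc m)]) d = (if d (p + Suc m + 1) \<le> 2 then 1 else 0) + triangle_count (rev [p..<p + Suc m]) (step (p + Suc m) d)"
    by (simp only: triangle_count.simps) simp
  also have "\<dots> = (if d (p + Suc m + 1) \<le> 2 then 1 else 0) + (\<Sum>j<Suc m. if d (p + j + 1) \<le> 1 then 1 else 0)"
    unfolding Suc by (simp add: step_def)
  finally show ?case .
qed simp

lemma no_digons_up: "no_digons [l..<l + Suc m] d \<longleftrightarrow> 2 \<le> d (Suc l) \<and> (\<forall>j<m. 1 \<le> d (l + j + 2))"
proof (induction m arbitrary: l d)
  case (Suc m)
  have "[l..<l + Suc (Suc m)] = l # [Suc l..<Suc l + Suc m]" by (simp add: upt_conv_Cons)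
  then have "no_digons [l..<l + Suc (Suc m)] d \<longleftrightarrow> 2 \<le> d (Suc l) \<and> no_digons [Suc l..<Suc l + Suc m] (step l d)"
    by (simp only: no_digons.simps)
  also have "\<dots> \<longleftrightarrow> 2 \<le> d (Suc l) \<and> 1 \<le> d (l + 2) \<and> (\<forall>j<m. 1 \<le> d (l + Suc j + 2))"
    unfolding Suc by (auto simp: step_def)
  finally show ?case by (simp add: All_less_Suc2)
qed simp

lemma no_digons_down: "no_digons (rev [p..<p + Suc m]) d \<longleftrightarrow> 2 \<le> d (p + m + 1) \<and> (\<forall>j<m. 1 \<le> d (p + j + 1))"
proof (induction m arbitrary: d)
  case (Suc m)
  have "rev [p..<p + Suc (Suc m)] = (p + Suc m) # rev [p..<p + Suc m]" by simp
  then have "no_digons (rev [p..<p + Suc (Suc m)]) d \<longleftrightarrow> 2 \<le> d (p + Suc m + 1) \<and> no_digons (rev [p..<p + Suc m]) (step (p + Suc m) d)"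
    by (simp only: no_digons.simps) simp
  also have "\<dots> \<longleftrightarrow> 2 \<le> d (p + Suc m + 1) \<and> (\<forall>j<Suc m. 1 \<le> d (p + j + 1))"
    unfolding Suc by (auto simp: step_def less_Suc_eq)
  finally show ?case .
qed simp

text \<open>A strand crossing the bundle adds two corners to an inner cell, so a cell with one
  corner becomes a triangle; hence the threshold \<open>1\<close> here and \<open>2\<close> in
  \<open>triangle_count\<close>.\<close>

definition ones :: "nat \<Rightarrow> (nat \<Rightarrow> nat) \<Rightarrow> nat" where
  "ones m u = (\<Sum>j<m - 1. if u (Suc j) \<le> 1 then 1 else 0)"

text \<open>A strand that crosses the bundle closes all its inner cells and opens fresh ones,
  whereas a strand elsewhere leaves the inside alone. Outside, the bundle acts like the single
  strand it replaces.\<close>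

lemma pass_run:
  assumes m: "0 < m" and u: "u 0 = 0" "u m = 0"
  shows "run (pass p m l) (joined p m c u) = joined (swap_at l p) m (step l c) (if l = p \<or> Suc l = p then two m else u)"
proof -
  obtain m' where m': "m = Suc m'" using m by (cases m) auto
  consider "Suc l = p" | "l = p" | "Suc l < p" | "p < l" by linarith
  then show ?thesis
  proof cases
    case 1
    have "run (pass p m l) (joined p m c u) = run [l..<l + Suc m'] (joined p m c u)" using 1 m' by (simp add: pass_def)
    also have "\<dots> = joined (swap_at l p) m (step l c) (two m)"
      unfolding run_up using 1 u m' by (intro ext) (auto simp: joined_def step_def swap_at_def two_def)
    finally show ?thesis using 1 by simp
  next
    case 2
    have "run (pass p m l) (joined p m c u) = run (rev [p..<p + Suc m']) (joined p m c u)" using 2 m' by (simp add: pass_def)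
    also have "\<dots> = joined (swap_at l p) m (step l c) (two m)"
      unfolding run_down using 2 u m' by (intro ext) (auto simp: joined_def step_def swap_at_def two_def)
    finally show ?thesis using 2 by simp
  next
    case 3
    then show ?thesis using u by (intro ext) (auto simp: pass_def joined_def step_def swap_at_def)
  next
    case 4
    then show ?thesis using u m' by (intro ext) (auto simp: pass_def joined_def step_def swap_at_def Suc_diff_le)
  qed
qed

lemma pass_triangle_count:
  assumes m: "0 < m" and u: "u 0 = 0" "u m = 0"
  shows "triangle_count (pass p m l) (joined p m c u) = (if c (Suc l) \<le> 2 then 1 else 0) + (if l = p \<or> Suc l = p then ones m u else 0)"
    and "no_digons (pass p m l) (joined p m c u) \<longleftrightarrow> 2 \<le> c (Suc l) \<and> (l = p \<or> Suc l = p \<longrightarrow> (\<forall>j<m - 1. 1 \<le> u (Suc j)))"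
proof -
  obtain m' where m': "m = Suc m'" using m by (cases m) auto
  have e: "j < m' \<Longrightarrow> joined p m c u (p + j + 1) = u (Suc j)" for j using m' by (auto simp: joined_def)
  have f: "joined p m c u p = c p" "joined p m c u (p + m) = c (Suc p)" using u m' by (auto simp: joined_def)
  have s: "(\<Sum>j<m'. if joined p m c u (p + j + 1) \<le> 1 then 1 else 0) = ones m u"
    unfolding ones_def using e m' by (intro sum.cong) auto
  consider "Suc l = p" | "l = p" | "Suc l < p" | "p < l" by linarith
  then have "triangle_count (pass p m l) (joined p m c u) = (if c (Suc l) \<le> 2 then 1 else 0) + (if l = p \<or> Suc l = p then ones m u else 0)
    \<and> (no_digons (pass p m l) (joined p m c u) \<longleftrightarrow> 2 \<le> c (Suc l) \<and> (l = p \<or> Suc l = p \<longrightarrow> (\<forall>j<m - 1. 1 \<le> u (Suc j))))"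
  proof cases
    case 1
    then have q: "pass p m l = [l..<l + Suc m']" "l + j + 2 = p + j + 1" for j using m' by (auto simp: pass_def)
    show ?thesis unfolding q(1) triangle_count_up no_digons_up q(2) s using 1 e f m' by auto
  next
    case 2
    then have q: "pass p m l = rev [p..<p + Suc m']" "p + m' + 1 = p + m" using m' by (auto simp: pass_def)
    show ?thesis unfolding q(1) triangle_count_down no_digons_down q(2) s using 2 e f m' by auto
  next
    case 3
    then show ?thesis by (auto simp: pass_def joined_def)
  next
    case 4
    then show ?thesis using m' by (auto simp: pass_def joined_def)
  qed
  then show "triangle_count (pass p m l) (joined p m c u) = (if c (Suc l) \<le> 2 then 1 else 0) + (if l = p \<or> Suc l = p then ones m u else 0)"
    and "no_digons (pass p m l) (joined p m c u) \<longleftrightarrow> 2 \<le> c (Suc l) \<and> (l = p \<or> Suc l = p \<longrightarrow> (\<forall>j<m - 1. 1 \<le> u (Suc j)))" by auto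
qed

lemma two_facts: "two m 0 = 0" "two m m = 0" "ones m (two m) = 0" "j < m - 1 \<Longrightarrow> 1 \<le> two m (Suc j)"
  by (auto simp: two_def ones_def)

text \<open>From the state \<open>two\<close> on, crossing strands cut only quadrilaterals out of
  the bundle, so all counts are those of the original word.\<close>

lemma expand_two:
  assumes m: "0 < m"
  shows "run (expand p m w) (joined p m c (two m)) = joined (fold swap_at w p) m (run w c) (two m)"
    "triangle_count (expand p m w) (joined p m c (two m)) = triangle_count w c" "no_digons (expand p m w) (joined p m c (two m)) \<longleftrightarrow> no_digons w c"
  by (induction w arbitrary: p c)
    (auto simp: pass_run[OF m] pass_triangle_count[OF m] two_facts[simplified] triangle_count_append no_digons_append)

text \<open>The hypothesis on \<open>crossing_count\<close> guarantees that some strand crosses the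
  bundle, and the first such crossing already produces the state \<open>two\<close>.\<close>

lemma expand_run:
  assumes m: "0 < m" and u: "u 0 = 0" "u m = 0" and cr: "0 < crossing_count w p j"
  shows "run (expand p m w) (joined p m c u) = joined (fold swap_at w p) m (run w c) (two m)"
  using cr
proof (induction w arbitrary: p c j)
  case (Cons l w)
  show ?case
  proof (cases "l = p \<or> Suc l = p")
    case True then show ?thesis by (simp add: pass_run[OF m u] expand_two[OF m])
  next
    case False
    then have "0 < crossing_count w (swap_at l p) (swap_at l j)" using Cons.prems by auto
    then show ?thesis using Cons.IH False by (simp add: pass_run[OF m u])
  qed
qed simp

text \<open>Only the first strand to cross the bundle can find inner cells with few corners, so they
  are paid for once.\<close>

lemma expand_triangle_count:
  assumes m: "0 < m" and u: "u 0 = 0" "u m = 0"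
  shows "triangle_count (expand p m w) (joined p m c u) \<le> triangle_count w c + ones m u"
    "no_digons w c \<Longrightarrow> (\<And>j. 0 < j \<Longrightarrow> j < m \<Longrightarrow> 1 \<le> u j) \<Longrightarrow> no_digons (expand p m w) (joined p m c u)"
proof -
  show "triangle_count (expand p m w) (joined p m c u) \<le> triangle_count w c + ones m u"
  proof (induction w arbitrary: p c)
    case (Cons l w)
    show ?case
    proof (cases "l = p \<or> Suc l = p")
      case True then show ?thesis by (simp add: pass_run[OF m u] pass_triangle_count[OF m u] triangle_count_append expand_two[OF m])
    next
      case False
      then show ?thesis using Cons.IH[of "swap_at l p" "step l c"] by (simp add: pass_run[OF m u] pass_triangle_count[OF m u] triangle_count_append)
    qed
  qed simp
  assume uj: "\<And>j. 0 < j \<Longrightarrow> j < m \<Longrightarrow> 1 \<le> u j"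
  show "no_digons w c \<Longrightarrow> no_digons (expand p m w) (joined p m c u)"
  proof (induction w arbitrary: p c)
    case (Cons l w)
    show ?case
    proof (cases "l = p \<or> Suc l = p")
      case True then show ?thesis using Cons.prems uj by (auto simp: pass_run[OF m u] pass_triangle_count[OF m u] no_digons_append expand_two[OF m])
    next
      case False
      then show ?thesis using Cons by (simp add: pass_run[OF m u] pass_triangle_count[OF m u] no_digons_append)
    qed
  qed simp
qed

section \<open>Arrangements of up to fourteen pseudocircles\<close>

definition of_list :: "nat list \<Rightarrow> nat \<Rightarrow> nat" where
  "of_list cs k = (if k < length cs then cs ! k else 0)"

text \<open>An executable run on lists that fails at a digon or at a letter out of range. One
  evaluation thus certifies the final state, the number of triangles and both side
  conditions.\<close>

fun sim :: "nat list \<Rightarrow> nat list \<Rightarrow> (nat list \<times> nat) option" where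
  "sim [] cs = Some (cs, 0)"
| "sim (l # w) cs = (if Suc (Suc l) < length cs \<and> 2 \<le> cs ! Suc l
     then case sim w (cs[l := cs ! l + 1, Suc l := 1, Suc (Suc l) := cs ! Suc (Suc l) + 1]) of
       None \<Rightarrow> None | Some (d, t) \<Rightarrow> Some (d, (if cs ! Suc l \<le> 2 then Suc t else t))
     else None)"

lemma step_of_list: "Suc (Suc l) < length cs \<Longrightarrow>
  step l (of_list cs) = of_list (cs[l := cs ! l + 1, Suc l := 1, Suc (Suc l) := cs ! Suc (Suc l) + 1])"
  by (rule ext) (auto simp: step_def of_list_def nth_list_update)

lemma sim_sound:
  "sim w cs = Some (d, t) \<Longrightarrow> run w (of_list cs) = of_list d \<and> triangle_count w (of_list cs) = t \<and> no_digons w (of_list cs)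
     \<and> length d = length cs \<and> (\<forall>l\<in>set w. Suc (Suc l) < length cs)"
proof (induction w arbitrary: cs d t)
  case (Cons l w)
  let ?cs = "cs[l := cs ! l + 1, Suc l := 1, Suc (Suc l) := cs ! Suc (Suc l) + 1]"
  have l: "Suc (Suc l) < length cs" "2 \<le> cs ! Suc l" using Cons.prems by (auto split: if_splits)
  then obtain t' where t': "sim w ?cs = Some (d, t')" "t = (if cs ! Suc l \<le> 2 then Suc t' else t')"
    using Cons.prems by (auto split: option.splits)
  have "of_list cs (Suc l) = cs ! Suc l" using l(1) by (simp add: of_list_def)
  then show ?case using Cons.IH[OF t'(1)] l t'(2) step_of_list[OF l(1)] by simp
qed simp

text \<open>Recursive functions instead of bounded quantifiers: \<open>code_simp\<close> would unfold the body of a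
  quantifier for a symbolic strand.\<close>

fun once_row :: "nat list \<Rightarrow> nat \<Rightarrow> nat list \<Rightarrow> bool" where
  "once_row w i [] = True"
| "once_row w i (j # js) = (if i = j \<or> crossing_count w i j = 1 then once_row w i js else False)"

fun once_rows :: "nat list \<Rightarrow> nat list \<Rightarrow> nat list \<Rightarrow> bool" where
  "once_rows w [] js = True"
| "once_rows w (i # is) js = (if fold swap_at w i = i \<and> once_row w i js then once_rows w is js else False)"

lemma once_row_sound: "once_row w i js \<Longrightarrow> j \<in> set js \<Longrightarrow> i \<noteq> j \<Longrightarrow> crossing_count w i j = 1"
  by (induction js) (auto split: if_splits)

lemma once_rows_sound: "once_rows w is js \<Longrightarrow> i \<in> set is \<Longrightarrow> fold swap_at w i = i \<and> once_row w i js"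
  by (induction "is") (auto split: if_splits)

definition permutes_once :: "nat \<Rightarrow> nat list \<Rightarrow> bool" where
  "permutes_once n w \<longleftrightarrow> once_rows w [0..<n] [0..<n]"

lemma closed_word_check:
  assumes "sim w cs = Some (d, t)" "length cs = Suc n" "permutes_once n w"
  shows "closed_word n w"
proof -
  have "fold swap_at w i = i" "j < n \<Longrightarrow> i \<noteq> j \<Longrightarrow> crossing_count w i j = 1" if "i < n" for i j
    using once_rows_sound[OF assms(3)[unfolded permutes_once_def], of i] once_row_sound[of w i "[0..<n]" j] that by simp_all
  then show ?thesis using sim_sound[OF assms(1)] assms(2) unfolding closed_word_def by simp
qed

text \<open>\<open>butlast (tl cs)\<close> drops the entries of the innermost and the outermost
  cell, which no letter closes; \<open>count_list\<close> gives the corners of these two.\<close>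

lemma word_check:
  assumes eq: "sim w cs = Some (d, t)" and len: "length cs = Suc n" and per: "permutes_once n w"
    and st: "list_all2 (\<le>) (butlast (tl cs)) (butlast (tl d))"
    and n: "2 \<le> n" and bot: "3 \<le> count_list w 0" and top: "3 \<le> count_list w (n - 2)"
  shows "\<exists>A. admissible n A \<and> num_kcells 3 A \<le> t + (if count_list w 0 = 3 then 1 else 0) + (if count_list w (n - 2) = 3 then 1 else 0)"
proof -
  note s = sim_sound[OF assms(1)]
  have "of_list cs k \<le> run w (of_list cs) k" if k: "0 < k" "k < n" for k
  proof -
    obtain k' where k': "k = Suc k'" using k(1) by (cases k) auto
    have "butlast (tl cs) ! k' \<le> butlast (tl d) ! k'"
      by (rule list_all2_nthD[OF st]) (use k k' len in auto)
    then show ?thesis using s len k k' by (simp add: of_list_def nth_butlast nth_tl)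
  qed
  then show ?thesis using word_arrangement[OF n closed_word_check[OF eq len per] _ _ bot top, of "of_list cs"] s by auto
qed

text \<open>In this and the following words the start state recurs at the end except in its first
  and last entry, so it describes the cells that are open across the seam. With three strands the
  innermost and the outermost cell are triangles too, which gives \<open>6 + 2\<close>.\<close>

lemma upper_3: "\<exists>A. admissible 3 A \<and> num_kcells 3 A \<le> 8"
proof -
  define w :: "nat list" where "w = [0,1,0,1,0,1]"
  have 1: "sim w [0,2,1,0] = Some ([3,2,1,3], 6)" unfolding w_def by code_simp
  have 2: "permutes_once 3 w" unfolding w_def by code_simp
  have 3: "count_list w 0 = 3" "count_list w 1 = 3" unfolding w_def by simp_all
  show ?thesis using word_check[OF 1 _ 2] 3 by simp
qed

lemma upper_4: "\<exists>A. admissible 4 A \<and> num_kcells 3 A \<le> 8"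
proof -
  define w :: "nat list" where "w = [0,1,0,2,1,2,0,1,0,2,1,2]"
  have 1: "sim w [0,2,2,1,0] = Some ([4,2,2,1,4], 8)" unfolding w_def by code_simp
  have 2: "permutes_once 4 w" unfolding w_def by code_simp
  have 3: "count_list w 0 = 4" "count_list w 2 = 4" unfolding w_def by simp_all
  show ?thesis using word_check[OF 1 _ 2] 3 by simp
qed

lemma upper_5: "\<exists>A. admissible 5 A \<and> num_kcells 3 A \<le> 8"
proof -
  define w :: "nat list" where "w = [1,2,3,0,1,2,0,1,0,3,2,3,1,2,1,0,1,2,3,2]"
  have 1: "sim w [0,2,3,1,2,0] = Some ([4,2,3,1,2,4], 8)" unfolding w_def by code_simp
  have 2: "permutes_once 5 w" unfolding w_def by code_simp
  have 3: "count_list w 0 = 4" "count_list w 3 = 4" unfolding w_def by simp_all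
  show ?thesis using word_check[OF 1 _ 2] 3 by simp
qed

lemma upper_6: "\<exists>A. admissible 6 A \<and> num_kcells 3 A \<le> 8"
proof -
  define w :: "nat list" where "w = [2,1,0,1,2,3,4,3,2,1,0,2,1,3,2,1,0,4,3,4,2,1,3,2,3,4,0,1,2,3]"
  have 1: "sim w [0,2,2,2,1,2,0] = Some ([4,2,2,2,1,2,4], 8)" unfolding w_def by code_simp
  have 2: "permutes_once 6 w" unfolding w_def by code_simp
  have 3: "count_list w 0 = 4" "count_list w 4 = 4" unfolding w_def by simp_all
  show ?thesis using word_check[OF 1 _ 2] 3 by simp
qed

lemma upper_7: "\<exists>A. admissible 7 A \<and> num_kcells 3 A \<le> 10"
proof -
  define w :: "nat list" where "w = [5,4,3,2,3,4,5,0,1,3,4,2,3,4,0,1,2,3,1,2,0,1,5,4,3,2,3,4,5,4,3,2,1,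
    2,0,1,2,3,4,3,2,1]"
  have 1: "sim w [0,3,1,2,2,2,3,0] = Some ([4,3,1,2,2,2,3,4], 10)" unfolding w_def by code_simp
  have 2: "permutes_once 7 w" unfolding w_def by code_simp
  have 3: "count_list w 0 = 4" "count_list w 5 = 4" unfolding w_def by simp_all
  show ?thesis using word_check[OF 1 _ 2] 3 by simp
qed

lemma upper_8: "\<exists>A. admissible 8 A \<and> num_kcells 3 A \<le> 11"
proof -
  define w :: "nat list" where "w = [5,4,3,2,1,0,1,2,3,2,4,5,6,1,3,4,3,2,0,1,5,4,3,4,5,0,2,3,4,6,5,6,1,
    2,3,4,5,3,2,1,0,4,3,2,1,2,3,4,3,2,5,4,3,4,5,6]"
  have 1: "sim w [0,2,3,2,2,2,2,1,0] = Some ([4,2,3,2,2,2,2,1,4], 11)" unfolding w_def by code_simp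
  have 2: "permutes_once 8 w" unfolding w_def by code_simp
  have 3: "count_list w 0 = 4" "count_list w 6 = 4" unfolding w_def by simp_all
  show ?thesis using word_check[OF 1 _ 2] 3 by simp
qed

lemma upper_9: "\<exists>A. admissible 9 A \<and> num_kcells 3 A \<le> 12"
proof -
  define w :: "nat list" where "w = [1,5,4,3,2,6,5,4,3,4,5,6,7,6,5,4,3,2,1,2,3,4,5,4,6,5,0,1,2,3,1,2,0,
    1,4,7,6,5,6,7,3,4,2,3,1,0,2,1,5,4,6,5,6,7,3,2,3,4,5,6,5,4,3,2,1,0,
    1,2,3,4,3,2]"
  have 1: "sim w [0,2,3,1,2,2,3,2,2,0] = Some ([4,2,3,1,2,2,3,2,2,4], 12)" unfolding w_def by code_simp
  have 2: "permutes_once 9 w" unfolding w_def by code_simp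
  have 3: "count_list w 0 = 4" "count_list w 7 = 4" unfolding w_def by simp_all
  show ?thesis using word_check[OF 1 _ 2] 3 by simp
qed

lemma upper_10: "\<exists>A. admissible 10 A \<and> num_kcells 3 A \<le> 14"
proof -
  define w :: "nat list" where "w = [6,5,2,3,4,1,2,3,4,5,6,0,1,2,3,4,5,1,0,2,3,2,4,3,7,6,5,4,3,2,8,7,6,
    8,7,5,4,3,6,5,6,4,1,2,3,1,0,2,1,5,6,4,5,3,4,2,3,4,5,6,5,4,3,7,8,6,
    7,5,6,4,5,4,3,2,1,0,1,2,3,4,5,6,7,8,6,7,5,4,3,4]"
  have 1: "sim w [0,2,2,3,2,1,3,3,1,2,0] = Some ([4,2,2,3,2,1,3,3,1,2,4], 14)" unfolding w_def by code_simp
  have 2: "permutes_once 10 w" unfolding w_def by code_simp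
  have 3: "count_list w 0 = 4" "count_list w 8 = 4" unfolding w_def by simp_all
  show ?thesis using word_check[OF 1 _ 2] 3 by simp
qed

lemma upper_11: "\<exists>A. admissible 11 A \<and> num_kcells 3 A \<le> 15"
proof -
  define w :: "nat list" where "w = [3,2,1,3,2,4,3,5,0,1,2,4,3,2,1,6,5,4,5,6,7,8,3,4,5,4,6,7,5,6,9,8,7,
    6,5,4,3,2,3,4,5,6,7,8,9,0,1,2,3,4,5,4,3,2,1,0,1,2,3,4,6,7,8,5,6,7,
    6,5,4,3,2,1,0,4,3,2,5,4,3,5,4,6,7,8,9,8,7,6,5,6,7,8,9,1,2,1,3,2,4,
    3,5,4,6,5,7,6,5,4,8,7]"
  have 1: "sim w [0,3,2,2,3,1,2,3,1,2,2,0] = Some ([4,3,2,2,3,1,2,3,1,2,2,4], 15)" unfolding w_def by code_simp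
  have 2: "permutes_once 11 w" unfolding w_def by code_simp
  have 3: "count_list w 0 = 4" "count_list w 9 = 4" unfolding w_def by simp_all
  show ?thesis using word_check[OF 1 _ 2] 3 by simp
qed

text \<open>The word is one half written twice, so the diagram has a rotational symmetry of order
  two. The case of twelve strands is left to the infinite family, whose first member it is.\<close>

lemma upper_13: "\<exists>A. admissible 13 A \<and> num_kcells 3 A \<le> 18"
proof -
  define w :: "nat list" where "w = [0,1,2,3,4,5,6,5,4,3,2,1,0,1,2,3,4,7,6,8,7,6,5,9,8,7,6,5,4,3,2,1,10,
    9,8,7,6,5,4,3,2,11,10,9,8,7,6,5,4,3,4,5,6,7,8,9,8,7,6,5,4,7,6,5,10,
    9,8,7,6,11,10,9,8,7,8,9,10,11,0,1,2,3,4,5,6,5,4,3,2,1,0,1,2,3,4,7,6,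
    8,7,6,5,9,8,7,6,5,4,3,2,1,10,9,8,7,6,5,4,3,2,11,10,9,8,7,6,5,4,3,4,
    5,6,7,8,9,8,7,6,5,4,7,6,5,10,9,8,7,6,11,10,9,8,7,8,9,10,11]"
  have 1: "sim w [0,3,2,2,3,2,2,2,2,2,2,2,1,0] = Some ([4,3,2,2,3,2,2,2,2,2,2,2,1,6], 18)" unfolding w_def by code_simp
  have 2: "permutes_once 13 w" unfolding w_def by code_simp
  have 3: "count_list w 0 = 4" "count_list w 11 = 6" unfolding w_def by simp_all
  show ?thesis using word_check[OF 1 _ 2] 3 by simp
qed

lemma upper_14: "\<exists>A. admissible 14 A \<and> num_kcells 3 A \<le> 19"
proof -
  define w :: "nat list" where "w = [0,1,2,3,4,5,6,7,8,9,10,9,8,7,6,5,4,3,2,1,0,3,2,1,2,3,4,5,6,5,4,3,7,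
    6,5,4,8,7,6,5,6,7,8,11,10,9,8,7,6,5,4,3,2,1,0,12,11,10,9,8,7,6,5,4,3,
    2,1,5,4,3,6,5,4,7,6,5,7,6,8,7,9,8,10,9,11,10,9,8,7,6,5,4,3,2,12,11,
    10,9,8,7,6,5,4,3,2,1,0,5,4,3,2,1,2,3,4,6,7,8,7,6,5,9,8,7,6,5,4,3,2,
    1,10,9,8,11,10,9,12,11,10,9,8,7,6,5,4,3,2,4,5,6,7,8,7,6,5,4,3,9,8,7,
    6,5,4,10,9,8,7,6,5,8,7,6,11,10,9,8,7,12,11,10,9,8]"
  have 1: "sim w [0,3,2,2,2,2,2,2,2,1,2,2,2,2,0] = Some ([4,3,2,2,2,2,2,2,2,1,2,2,2,2,4], 19)" unfolding w_def by code_simp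
  have 2: "permutes_once 14 w" unfolding w_def by code_simp
  have 3: "count_list w 0 = 4" "count_list w 12 = 4" unfolding w_def by simp_all
  show ?thesis using word_check[OF 1 _ 2] 3 by simp
qed

section \<open>An infinite family\<close>

lemma step_mono: "c \<le> c' \<Longrightarrow> step l c \<le> step l c'"
  by (auto simp: step_def le_fun_def)

lemma run_mono: "c \<le> c' \<Longrightarrow> run w c \<le> run w c'"
  by (induction w arbitrary: c c') (simp_all add: step_mono)

text \<open>Extra corners on open cells can only destroy triangles, so counts evaluated for one
  start state bound those for any larger one.\<close>

lemma triangle_count_mono: "c \<le> c' \<Longrightarrow> triangle_count w c' \<le> triangle_count w c"
proof (induction w arbitrary: c c')
  case (Cons l w)
  have "c (Suc l) \<le> c' (Suc l)" using Cons.prems by (simp add: le_fun_def)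
  then show ?case using Cons.IH[OF step_mono[OF Cons.prems], of l] by auto
qed simp

lemma no_digons_mono: "c \<le> c' \<Longrightarrow> no_digons w c \<Longrightarrow> no_digons w c'"
proof (induction w arbitrary: c c')
  case (Cons l w)
  have "c (Suc l) \<le> c' (Suc l)" using Cons.prems by (simp add: le_fun_def)
  then show ?case using Cons.IH[OF step_mono[OF Cons.prems(1)], of l] Cons.prems(2) by auto
qed simp

lemma block_step_swap_at: "Suc l < m \<Longrightarrow> x < m \<Longrightarrow> swap_at (p + l) (bundle_pos p m i x) = bundle_pos p m i (swap_at l x)"
  unfolding bundle_pos_def by (cases "i < p"; cases "i = p") (auto simp: swap_at_def)

lemma block_swap_at: "\<forall>l\<in>set v. Suc l < m \<Longrightarrow> x < m \<Longrightarrow> fold swap_at (map ((+) p) v) (bundle_pos p m i x) = bundle_pos p m i (fold swap_at v x)"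
  by (induction v arbitrary: x) (auto simp: block_step_swap_at swap_at_less)

lemma block_step_crossing_count:
  assumes "Suc l < m" "x < m" "y < m"
  shows "bundle_pos p m i x = p + l \<and> bundle_pos p m j y = Suc (p + l) \<longleftrightarrow> i = p \<and> j = p \<and> x = l \<and> y = Suc l"
proof -
  have "bundle_pos p m i x = p + l \<longleftrightarrow> i = p \<and> x = l" using assms unfolding bundle_pos_def by auto
  moreover have "bundle_pos p m j y = Suc (p + l) \<longleftrightarrow> j = p \<and> y = Suc l" using assms unfolding bundle_pos_def by auto
  ultimately show ?thesis by blast
qed

lemma block_crossing_count:
  "\<forall>l\<in>set v. Suc l < m \<Longrightarrow> x < m \<Longrightarrow> y < m \<Longrightarrow>
    crossing_count (map ((+) p) v) (bundle_pos p m i x) (bundle_pos p m j y) = (if i = p \<and> j = p then crossing_count v x y else 0)"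
  by (induction v arbitrary: x y) (auto simp: block_step_swap_at swap_at_less block_step_crossing_count)

lemma bundle_pos_surj:
  assumes "k < n + m - 1" "p < n" "0 < m"
  obtains i x where "i < n" "x < m" "k = bundle_pos p m i x"
proof -
  consider "k < p" | "p \<le> k" "k < p + m" | "p + m \<le> k" by linarith
  then show thesis
  proof cases
    case 1 then show thesis using that[of k 0] assms by (auto simp: bundle_pos_def)
  next
    case 2 then show thesis using that[of p "k - p"] assms by (auto simp: bundle_pos_def)
  next
    case 3
    then have "p < k + 1 - m" "k + 1 - m < n" "k + 1 - m + m - 1 = k" using assms by linarith+
    then show thesis using that[of "k + 1 - m" 0] assms(3) by (simp add: bundle_pos_def)
  qed
qed

text \<open>Two strands that are not both in the bundle cross within the expanded \<open>w\<close>
  just as their originals do, and nowhere else. Two strands of the bundle run parallel there and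
  cross as prescribed by \<open>v2\<close> and \<open>v1\<close> together.\<close>

lemma closed_word_insert:
  assumes w: "closed_word n w" and v: "closed_word m (v2 @ v1)" and p: "p < n" and m: "0 < m"
  shows "closed_word (n + m - 1) (map ((+) p) v2 @ expand p m w @ map ((+) p) v1)" (is "closed_word _ ?w")
proof -
  have wl: "\<forall>l\<in>set w. Suc l < n" and wp: "\<And>i. i < n \<Longrightarrow> fold swap_at w i = i" and
    wx: "\<And>i j. i < n \<Longrightarrow> j < n \<Longrightarrow> i \<noteq> j \<Longrightarrow> crossing_count w i j = 1" using w unfolding closed_word_def by auto
  have vl: "\<forall>l\<in>set v2. Suc l < m" "\<forall>l\<in>set v1. Suc l < m" and vp: "\<And>i. i < m \<Longrightarrow> fold swap_at v1 (fold swap_at v2 i) = i" and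
    vx: "\<And>x y. x < m \<Longrightarrow> y < m \<Longrightarrow> x \<noteq> y \<Longrightarrow> crossing_count v2 x y + crossing_count v1 (fold swap_at v2 x) (fold swap_at v2 y) = 1"
    using v unfolding closed_word_def by (auto simp: crossing_count_append)
  have v2m: "x < m \<Longrightarrow> fold swap_at v2 x < m" for x using fold_swap_at_less[OF vl(1)] by simp
  have swap_at: "fold swap_at ?w (bundle_pos p m i x) = bundle_pos p m i x" if "i < n" "x < m" for i x
    using that wp[OF p] wp vp v2m by (simp add: block_swap_at[OF vl(1)] expand_swap_at block_swap_at[OF vl(2)])
  have all1: "crossing_count ?w (bundle_pos p m i x) (bundle_pos p m j y) = 1" if "i < n" "j < n" "x < m" "y < m" "bundle_pos p m i x \<noteq> bundle_pos p m j y" for i j x y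
  proof -
    have "crossing_count ?w (bundle_pos p m i x) (bundle_pos p m j y) = (if i = p \<and> j = p then crossing_count v2 x y else 0) + crossing_count w i j
        + (if i = p \<and> j = p then crossing_count v1 (fold swap_at v2 x) (fold swap_at v2 y) else 0)"
      using that wp[OF p] wp v2m
      by (simp add: crossing_count_append block_swap_at[OF vl(1)] block_crossing_count[OF vl(1)] expand_swap_at expand_crossing_count block_crossing_count[OF vl(2)])
    moreover have "i \<noteq> j \<or> i = p \<and> j = p \<and> x \<noteq> y" using that(5) by (auto simp: bundle_pos_def split: if_splits)
    moreover have "crossing_count w i j = 1 \<and> \<not> (i = p \<and> j = p)" if "i \<noteq> j" using wx[of i j] \<open>i < n\<close> \<open>j < n\<close> that by blast
    moreover have "crossing_count w p p = 0" by (rule crossing_count_refl)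
    ultimately show ?thesis using vx[of x y] \<open>x < m\<close> \<open>y < m\<close> by (cases "i = j") auto
  qed
  have "Suc l < n + m - 1" if "l \<in> set ?w" for l
    using that vl expand_letters[OF wl p m] p by fastforce
  moreover have "fold swap_at ?w k = k" if "k < n + m - 1" for k
    using bundle_pos_surj[OF that p m] swap_at by metis
  moreover have "crossing_count ?w k k' = 1" if "k < n + m - 1" "k' < n + m - 1" "k \<noteq> k'" for k k'
    using bundle_pos_surj[OF that(1) p m] bundle_pos_surj[OF that(2) p m] all1 that(3) by metis
  ultimately show ?thesis unfolding closed_word_def by blast
qed

text \<open>One more corner on the cell above the strand at position \<open>p\<close> removes a triangle. A block inserted
  into that strand supplies such a corner, which makes the insertion cost one triangle less.\<close>

definition good :: "nat \<Rightarrow> nat \<Rightarrow> nat list \<Rightarrow> (nat \<Rightarrow> nat) \<Rightarrow> nat \<Rightarrow> bool" where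
  "good n p w c T \<longleftrightarrow> closed_word n w \<and> 1 \<le> p \<and> Suc p < n \<and> no_digons w c \<and> (\<forall>k. 0 < k \<longrightarrow> k < n \<longrightarrow> c k \<le> run w c k)
    \<and> triangle_count w c \<le> T + 1 \<and> triangle_count w (c(Suc p := c (Suc p) + 1)) \<le> T
    \<and> 4 \<le> count_list w 0 \<and> 4 \<le> count_list w (n - 2)"

text \<open>The block is cut so that \<open>w\<close> runs between \<open>v2\<close> and
  \<open>v1\<close>. The corner that \<open>v2\<close> leaves on the cell above the bundle,
  \<open>1 \<le> u2 m\<close>, is the one that \<open>good\<close> rewards, so \<open>w\<close>
  costs \<open>T\<close> and not \<open>T + 1\<close>. The cost \<open>b\<close> is due to the first
  strand crossing the bundle, \<open>a\<close> and \<open>d\<close> to the two parts of the block.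
  The cell above position \<open>q\<close> takes over the rewarded role for the next insertion; an
  extra corner on it is absorbed within \<open>v2\<close>.\<close>

lemma insert_block:
  assumes g: "good n p w c T" and v: "closed_word m (v2 @ v1)" and q: "1 \<le> q" "Suc q < m"
    and u: "u 0 = 0" "u m = 0" and v2: "run v2 u = u2" "no_digons v2 u" "triangle_count v2 u \<le> a + 1"
    and sp: "run v2 (u(Suc q := u (Suc q) + 1)) = u2" "triangle_count v2 (u(Suc q := u (Suc q) + 1)) \<le> a"
    and u2: "\<And>j. 0 < j \<Longrightarrow> j < m \<Longrightarrow> 1 \<le> u2 j" "1 \<le> u2 m" "ones m u2 \<le> b"
    and v1: "triangle_count v1 (two m) \<le> d" "no_digons v1 (two m)" "\<And>j. 0 < j \<Longrightarrow> j < m \<Longrightarrow> u j \<le> run v1 (two m) j"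
  shows "good (n + m - 1) (p + q) (map ((+) p) v2 @ expand p m w @ map ((+) p) v1) (joined p m c u) (T + a + b + d)"
    (is "good _ _ ?w ?c _")
proof -
  have w: "closed_word n w" and p: "1 \<le> p" "Suc p < n" and okw: "no_digons w c" and
    cw: "\<And>k. 0 < k \<Longrightarrow> k < n \<Longrightarrow> c k \<le> run w c k" and tw: "triangle_count w (c(Suc p := c (Suc p) + 1)) \<le> T"
    and cnt: "4 \<le> count_list w 0" "4 \<le> count_list w (n - 2)"
    using g unfolding good_def by auto
  have m: "0 < m" using q by simp
  have vl: "\<forall>l\<in>set v2. Suc l < m" "\<forall>l\<in>set v1. Suc l < m" using v unfolding closed_word_def by auto
  have wl: "\<forall>l\<in>set w. Suc l < n" and wp: "fold swap_at w p = p" and wx: "crossing_count w p 0 = 1"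
    using w p unfolding closed_word_def by auto
  define cp where "cp = c(p := c p + u2 0, Suc p := c (Suc p) + u2 m)"
  define uz where "uz = u2(0 := 0, m := 0)"
  have uz: "uz 0 = 0" "uz m = 0" "ones m uz = ones m u2" "\<And>j. 0 < j \<Longrightarrow> j < m \<Longrightarrow> 1 \<le> uz j"
    using u2(1) unfolding uz_def ones_def by (auto intro!: sum.cong)
  have walls: "joined p m c u2 = joined p m cp uz" unfolding cp_def uz_def by (rule joined_walls[OF m])
  have ccp: "c \<le> cp" unfolding cp_def le_fun_def by auto
  have "c(Suc p := c (Suc p) + 1) \<le> cp" using u2(2) unfolding cp_def le_fun_def by auto
  then have tcp: "triangle_count w cp \<le> T" using triangle_count_mono[of _ cp w] tw by fastforce
  have rE: "run (expand p m w) (joined p m cp uz) = joined p m (run w cp) (two m)"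
    using expand_run[OF m uz(1,2), of w p 0 cp] wx wp by simp
  have tE: "triangle_count (expand p m w) (joined p m cp uz) \<le> T + b"
    using expand_triangle_count(1)[OF m uz(1,2), of p w cp] tcp u2(3) uz(3) by linarith
  have oE: "no_digons (expand p m w) (joined p m cp uz)"
    by (rule expand_triangle_count(2)[OF m uz(1,2) no_digons_mono[OF ccp okw] uz(4)])
  have run': "run ?w ?c = joined p m (run w cp) (run v1 (two m))"
    by (simp add: joined_block[OF vl(1)] joined_block[OF vl(2)] v2(1) walls rE)
  have tri': "triangle_count ?w (joined p m c u') \<le> triangle_count v2 u' + (T + b) + d" if "run v2 u' = u2" for u'
    using tE v1(1) that by (simp add: triangle_count_append joined_block[OF vl(1)] joined_block[OF vl(2)] walls rE)
  have ok': "no_digons ?w ?c"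
    using v2(2) v1(2) oE by (simp add: no_digons_append joined_block[OF vl(1)] joined_block[OF vl(2)] v2(1) walls rE)
  have low: "?c k \<le> run ?w ?c k" if k: "0 < k" "k < n + m - 1" for k
  proof -
    have "c k' \<le> run w cp k'" if "0 < k'" "k' < n" for k'
      using cw[OF that] run_mono[OF ccp, of w] unfolding le_fun_def by (meson order_trans)
    then show ?thesis unfolding run' using v1(3)[of "k - p"] p k u m by (auto simp: joined_def trans_le_add1)
  qed
  \<comment> \<open>The newly rewarded cell lies inside the bundle, because
    \<open>Suc q < m\<close>; an extra corner on it therefore changes \<open>u\<close> and not
    \<open>c\<close>.\<close>
  have spc: "?c(Suc (p + q) := ?c (Suc (p + q)) + 1) = joined p m c (u(Suc q := u (Suc q) + 1))"
    using q by (intro ext) (auto simp: joined_def)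
  have cnt': "4 \<le> count_list ?w 0" "4 \<le> count_list ?w (n + m - 1 - 2)"
    using expand_count[OF wl _ m, of p] cnt p by simp_all
  show ?thesis
    unfolding good_def spc
    using closed_word_insert[OF w v _ m, of p] p q ok' low tri'[OF v2(1)] tri'[OF sp(1)] v2(3) sp(2) cnt' by simp
qed

text \<open>\<open>block2 @ block1\<close> is a twelve-strand arrangement with at most sixteen
  triangles, cut where the rest of the diagram is to be inserted. It is one word of 66 letters taken
  twice, except that in the second copy \<open>9, 10\<close> is moved past \<open>0, ..., 7\<close>,
  with which it commutes.\<close>

definition block1 :: "nat list" where
  "block1 = [9,10,8,7,6,5,4,3,2,1,0,9,8,7,6,5,4,3]"

definition block2 :: "nat list" where
  "block2 = [2,1,3,4,5,6,7,8,9,10,9,8,7,6,5,4,3,2,5,4,3,6,5,4,3,7,6,5,4,7,6,5,8,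
    7,6,5,4,3,2,1,9,10,0,1,2,3,4,5,6,7,8,7,6,5,4,3,2,1,0,9,8,7,6,5,4,3,
    2,1,3,4,5,6,7,8,9,10,9,8,7,6,5,4,3,2,5,4,3,6,5,4,3,7,6,5,4,7,6,5,8,
    7,6,5,4,3,2,1,0,1,2,3,4,5,6,7]"

text \<open>The second and the fourth run start with one more corner on the cell above position
  \<open>3\<close>. Without it that cell closes as a triangle; with it the count drops by one, and
  the final state is the same.\<close>

lemma block_sim:
  "sim (block2 @ block1) [0,1,2,3,1,2,2,2,2,2,2,2,0] = Some ([4,1,2,3,1,2,2,2,2,2,2,2,4], 16)"
  "sim (block2 @ block1) [0,1,2,3,2,2,2,2,2,2,2,2,0] = Some ([4,1,2,3,1,2,2,2,2,2,2,2,4], 15)"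
  "sim block2 [0,1,2,3,1,2,2,2,2,2,2,2,0] = Some ([3,2,2,2,2,2,2,2,1,3,3,2,3], 15)"
  "sim block2 [0,1,2,3,2,2,2,2,2,2,2,2,0] = Some ([3,2,2,2,2,2,2,2,1,3,3,2,3], 14)"
  "sim block1 [0,2,2,2,2,2,2,2,2,2,2,2,0] = Some ([1,1,2,3,1,2,2,2,2,2,2,2,1], 1)"
  unfolding block1_def block2_def append.simps by code_simp+

lemma block_permutes: "permutes_once 12 (block2 @ block1)"
  unfolding block1_def block2_def append.simps by code_simp

lemma block_counts: "4 \<le> count_list (block2 @ block1) 0" "4 \<le> count_list (block2 @ block1) 10"
  unfolding block1_def block2_def by simp_all

lemma of_list_upd: "k < length cs \<Longrightarrow> (of_list cs)(k := of_list cs k + 1) = of_list (cs[k := cs ! k + 1])"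
  by (rule ext) (simp add: of_list_def nth_list_update)

lemma range_12: "0 < k \<Longrightarrow> k < 12 \<Longrightarrow> k \<in> {1, 2, 3, 4, 5, 6, 7, 8, 9, 10, 11}" for k :: nat
  unfolding insert_iff empty_iff by presburger

lemma two_12: "two 12 = of_list [0,2,2,2,2,2,2,2,2,2,2,2,0]"
proof
  fix k :: nat
  have "\<forall>k\<in>{1, 2, 3, 4, 5, 6, 7, 8, 9, 10, 11}. two 12 k = of_list [0,2,2,2,2,2,2,2,2,2,2,2,0] k" by (simp add: of_list_def two_def)
  moreover have "k \<in> {1, 2, 3, 4, 5, 6, 7, 8, 9, 10, 11} \<or> k = 0 \<or> 12 \<le> k" using range_12[of k] by linarith
  moreover have "12 \<le> k \<Longrightarrow> two 12 k = of_list [0,2,2,2,2,2,2,2,2,2,2,2,0] k" by (cases "k = 12") (simp_all add: two_def of_list_def)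
  ultimately show "two 12 k = of_list [0,2,2,2,2,2,2,2,2,2,2,2,0] k" by (auto simp: two_def of_list_def)
qed

lemma family_base: "good 12 3 (block2 @ block1) (of_list [0,1,2,3,1,2,2,2,2,2,2,2,0]) 15"
proof -
  note s = sim_sound[OF block_sim(1)] sim_sound[OF block_sim(2)]
  have "\<forall>k\<in>{1, 2, 3, 4, 5, 6, 7, 8, 9, 10, 11}. of_list [0,1,2,3,1,2,2,2,2,2,2,2,0] k \<le> of_list [4,1,2,3,1,2,2,2,2,2,2,2,4] k" by (simp add: of_list_def)
  then have "of_list [0,1,2,3,1,2,2,2,2,2,2,2,0] k \<le> of_list [4,1,2,3,1,2,2,2,2,2,2,2,4] k" if "0 < k" "k < 12" for k
    using range_12[OF that] by blast
  moreover have "(of_list [0,1,2,3,1,2,2,2,2,2,2,2,0])(4 := of_list [0,1,2,3,1,2,2,2,2,2,2,2,0] 4 + 1) = of_list [0,1,2,3,2,2,2,2,2,2,2,2,0]"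
    by (subst of_list_upd) (simp_all add: numeral_2_eq_2)
  ultimately show ?thesis
    using s closed_word_check[OF block_sim(1) _ block_permutes] block_counts by (simp add: good_def)
qed

lemma family_step:
  assumes "good n p w c T" shows "\<exists>w' c'. good (n + 11) (p + 3) w' c' (T + 16)"
proof -
  note s = sim_sound[OF block_sim(3)] sim_sound[OF block_sim(4)] sim_sound[OF block_sim(5)]
  \<comment> \<open>The summands \<open>14\<close>, \<open>1\<close> and \<open>1\<close> bound the
    triangles within \<open>block2\<close>, those closed by the first strand that crosses the
    bundle, and those within \<open>block1\<close>.\<close>
  have "good (n + 12 - 1) (p + 3) (map ((+) p) block2 @ expand p 12 w @ map ((+) p) block1)
    (joined p 12 c (of_list [0,1,2,3,1,2,2,2,2,2,2,2,0])) (T + 14 + 1 + 1)"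
  proof (rule insert_block[OF assms])
    show "closed_word 12 (block2 @ block1)" using closed_word_check[OF block_sim(1) _ block_permutes] by simp
    show "run block2 (of_list [0,1,2,3,1,2,2,2,2,2,2,2,0]) = of_list [3,2,2,2,2,2,2,2,1,3,3,2,3]" "no_digons block2 (of_list [0,1,2,3,1,2,2,2,2,2,2,2,0])"
      "triangle_count block2 (of_list [0,1,2,3,1,2,2,2,2,2,2,2,0]) \<le> 14 + 1" using s by simp_all
    have e: "(of_list [0,1,2,3,1,2,2,2,2,2,2,2,0])(Suc 3 := of_list [0,1,2,3,1,2,2,2,2,2,2,2,0] (Suc 3) + 1) = of_list [0,1,2,3,2,2,2,2,2,2,2,2,0]"
      by (subst of_list_upd) (simp_all add: numeral_2_eq_2)
    show "triangle_count block2 ((of_list [0,1,2,3,1,2,2,2,2,2,2,2,0])(Suc 3 := of_list [0,1,2,3,1,2,2,2,2,2,2,2,0] (Suc 3) + 1)) \<le> 14"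
      "run block2 ((of_list [0,1,2,3,1,2,2,2,2,2,2,2,0])(Suc 3 := of_list [0,1,2,3,1,2,2,2,2,2,2,2,0] (Suc 3) + 1)) = of_list [3,2,2,2,2,2,2,2,1,3,3,2,3]"
      unfolding e using s by simp_all
    have "\<forall>j\<in>{1, 2, 3, 4, 5, 6, 7, 8, 9, 10, 11}. 1 \<le> of_list [3,2,2,2,2,2,2,2,1,3,3,2,3] j" by (simp add: of_list_def)
    then show "1 \<le> of_list [3,2,2,2,2,2,2,2,1,3,3,2,3] j" if "0 < j" "j < 12" for j
      using range_12[OF that] by blast
    show "ones 12 (of_list [3,2,2,2,2,2,2,2,1,3,3,2,3]) \<le> 1"
      by (simp add: ones_def of_list_def lessThan_nat_numeral lessThan_Suc)
    show "triangle_count block1 (two 12) \<le> 1" "no_digons block1 (two 12)" unfolding two_12 using s by simp_all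
    have "\<forall>j\<in>{1, 2, 3, 4, 5, 6, 7, 8, 9, 10, 11}. of_list [0,1,2,3,1,2,2,2,2,2,2,2,0] j \<le> of_list [1,1,2,3,1,2,2,2,2,2,2,2,1] j" by (simp add: of_list_def)
    moreover have "run block1 (two 12) = of_list [1,1,2,3,1,2,2,2,2,2,2,2,1]" unfolding two_12 using s(3) by simp
    ultimately show "of_list [0,1,2,3,1,2,2,2,2,2,2,2,0] j \<le> run block1 (two 12) j" if "0 < j" "j < 12" for j
      using range_12[OF that] by metis
  qed (simp_all add: of_list_def)
  moreover have "n + 12 - 1 = n + 11" "T + 14 + 1 + 1 = T + 16" by simp_all
  ultimately show ?thesis by metis
qed

text \<open>The invariant carries \<open>16 k - 1\<close> while the arrangement is only bounded by
  \<open>16 k\<close>: the rewarded corner appears when a further block is inserted. Four letters at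
  each extreme level keep the innermost and the outermost cell from being triangles.\<close>

lemma family:
  assumes "1 \<le> k" shows "\<exists>A. admissible (11 * k + 1) A \<and> num_kcells 3 A \<le> 16 * k"
proof -
  have "\<exists>w c. good (11 * k + 1) (3 * k) w c (16 * k - 1)" using assms
  proof (induction k rule: dec_induct)
    case base
    show ?case using family_base by (intro exI) simp
  next
    case (step k)
    then obtain w c where "good (11 * k + 1) (3 * k) w c (16 * k - 1)" by blast
    from family_step[OF this] obtain w' c' where g: "good (11 * k + 1 + 11) (3 * k + 3) w' c' (16 * k - 1 + 16)" by blast
    moreover have "11 * k + 1 + 11 = 11 * Suc k + 1" "3 * k + 3 = 3 * Suc k" "16 * k - 1 + 16 = 16 * Suc k - 1" using step by simp_all
    ultimately show ?case by metis
  qed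
  then obtain w c where g: "good (11 * k + 1) (3 * k) w c (16 * k - 1)" by blast
  have t: "triangle_count w c \<le> 16 * k - 1 + 1" "4 \<le> count_list w 0" "4 \<le> count_list w (11 * k + 1 - 2)"
    "closed_word (11 * k + 1) w" "no_digons w c" "\<And>j. 0 < j \<Longrightarrow> j < 11 * k + 1 \<Longrightarrow> c j \<le> run w c j"
    using g unfolding good_def by blast+
  obtain A where "admissible (11 * k + 1) A" "num_kcells 3 A \<le> triangle_count w c + (if count_list w 0 = 3 then 1 else 0) + (if count_list w (11 * k + 1 - 2) = 3 then 1 else 0)"
    using word_arrangement[OF _ t(4) t(6) t(5)] assms t(2,3) by fastforce
  moreover have "triangle_count w c \<le> 16 * k" "count_list w 0 \<noteq> 3" "count_list w (11 * k + 1 - 2) \<noteq> 3"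
    using t(1-3) assms by linarith+
  ultimately show ?thesis by (intro exI[of _ A]) simp
qed

lemma min_triangles_le: "admissible n A \<Longrightarrow> num_kcells 3 A \<le> t \<Longrightarrow> min_triangles n \<le> t"
  unfolding min_triangles_def by (rule order_trans[OF cInf_lower]) auto

text \<open>The condition on \<open>t\<close> says that one of the two lower bounds, rounded up,
  reaches \<open>t\<close>: \<open>3 * t < 4 * n + 3\<close> means that \<open>t\<close> is at most
  the ceiling of \<open>4 n / 3\<close>.\<close>

lemma min_triangles_eq:
  assumes ex: "\<exists>A. admissible n A \<and> num_kcells 3 A \<le> t" and n: "2 \<le> n" and t: "t \<le> 8 \<or> 3 * t < 4 * n + 3"
  shows "(\<exists>A. admissible n A) \<and> min_triangles n = t"
proof -
  obtain A where A: "admissible n A" "num_kcells 3 A \<le> t" using ex by blast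
  have "t \<le> num_kcells 3 B" if B: "admissible n B" for B
    using admissible_bounds[OF B n] t by linarith
  then have "t \<le> min_triangles n" unfolding min_triangles_def using A(1) by (intro cInf_greatest) auto
  then show ?thesis using min_triangles_le[OF A] A(1) by auto
qed

theorem theorem1:
  shows "(\<forall>n::nat. 3 \<le> n \<and> n \<le> 6 \<longrightarrow> (\<exists>A. admissible n A) \<and> min_triangles n = 8)
       \<and> (\<forall>n::nat. 6 \<le> n \<and> n \<le> 14 \<longrightarrow> (\<exists>A. admissible n A) \<and>
              int (min_triangles n) = \<lceil>4 * real n / 3\<rceil>)
       \<and> (\<forall>k::nat. k \<ge> 1 \<longrightarrow> (\<exists>A. admissible (11 * k + 1) A) \<and>
              real (min_triangles (11 * k + 1)) < 16 / 11 * real (11 * k + 1))"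
proof (intro conjI allI impI)
  fix n :: nat
  assume n: "3 \<le> n \<and> n \<le> 6"
  then consider "n = 3" | "n = 4" | "n = 5" | "n = 6" by linarith
  then have "(\<exists>A. admissible n A) \<and> min_triangles n = 8"
    using min_triangles_eq[OF upper_3] min_triangles_eq[OF upper_4] min_triangles_eq[OF upper_5] min_triangles_eq[OF upper_6]
    by cases simp_all
  then show "\<exists>A. admissible n A" "min_triangles n = 8" by auto
next
  fix n :: nat
  assume "6 \<le> n \<and> n \<le> 14"
  then consider "n = 6" | "n = 7" | "n = 8" | "n = 9" | "n = 10" | "n = 11" | "n = 12" | "n = 13" | "n = 14" by linarith
  then have "(\<exists>A. admissible n A) \<and> int (min_triangles n) = \<lceil>4 * real n / 3\<rceil>"
  proof cases
    case 1 then show ?thesis using min_triangles_eq[OF upper_6] by (simp add: ceiling_eq_iff)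
  next
    case 2 then show ?thesis using min_triangles_eq[OF upper_7] by (simp add: ceiling_eq_iff)
  next
    case 3 then show ?thesis using min_triangles_eq[OF upper_8] by (simp add: ceiling_eq_iff)
  next
    case 4 then show ?thesis using min_triangles_eq[OF upper_9] by (simp add: ceiling_eq_iff)
  next
    case 5 then show ?thesis using min_triangles_eq[OF upper_10] by (simp add: ceiling_eq_iff)
  next
    case 6 then show ?thesis using min_triangles_eq[OF upper_11] by (simp add: ceiling_eq_iff)
  next
    \<comment> \<open>For twelve pseudocircles the block on its own is optimal, as
      \<open>16 = 4 * 12 / 3\<close>.\<close>
    case 7 then show ?thesis using min_triangles_eq[of 12 16] family[of 1] by (simp add: ceiling_eq_iff)
  next
    case 8 then show ?thesis using min_triangles_eq[OF upper_13] by (simp add: ceiling_eq_iff)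
  next
    case 9 then show ?thesis using min_triangles_eq[OF upper_14] by (simp add: ceiling_eq_iff)
  qed
  then show "\<exists>A. admissible n A" "int (min_triangles n) = \<lceil>4 * real n / 3\<rceil>" by auto
next
  fix k :: nat
  assume "1 \<le> k"
  then obtain A where A: "admissible (11 * k + 1) A" "num_kcells 3 A \<le> 16 * k" using family by blast
  then show "\<exists>A. admissible (11 * k + 1) A" by blast
  have "real (min_triangles (11 * k + 1)) \<le> real (16 * k)" using min_triangles_le[OF A] by (simp only: of_nat_le_iff)
  then show "real (min_triangles (11 * k + 1)) < 16 / 11 * real (11 * k + 1)" by simp
qed

end
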